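(* Let $n \geq 3$ be an integer, let $S_+^n = \{x \in S^n \subset \mathbb{R}^{n+1} : x_{n+1} \geq 0\}$ be the closed upper hemisphere, and let $\overline{g}$ denote the standard (round) metric on $S_+^n$. Then there exists a smooth Riemannian metric $g$ on $S_+^n$ with the following properties: (i) the scalar curvature of $g$ is strictly greater than $n(n-1)$ at every point of $S_+^n$; (ii) at each point of $\partial S_+^n$ we have $g - \overline{g} = 0$ (as bilinear forms on the full tangent space of $S_+^n$); (iii) the mean curvature of $\partial S_+^n$ with respect to $g$ is strictly positive, i.e. the mean curvature vector of $\partial S_+^n$ with respect to $g$ is inward-pointing.
   Context: Mean curvature convention: for a metric $g$, the mean curvature vector of the boundary is $-H_g\,\nu_g$, where $\nu_g$ is the outward-pointing unit normal; so $H_g > 0$ means the mean curvature vector points into the manifold. *)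

theory Defs
  imports "HOL-Analysis.Analysis"
begin

text \<open>Coordinates: the closed upper hemisphere S^n_+ is identified with the closed unit ball
  of R^n (index type 'n, CARD('n) = n) via stereographic projection from the south pole,
  a diffeomorphism of manifolds with boundary.  A metric is a matrix-valued function.\<close>

definition pd :: "'n::finite \<Rightarrow> (real^'n \<Rightarrow> real) \<Rightarrow> real^'n \<Rightarrow> real" where
  "pd i f x = frechet_derivative f (at x) (axis i 1)"

fun pds :: "'n::finite list \<Rightarrow> (real^'n \<Rightarrow> real) \<Rightarrow> real^'n \<Rightarrow> real" where
  "pds [] f = f"
| "pds (i # is) f = pd i (pds is f)"

definition smooth_fun_on :: "(real^'n::finite) set \<Rightarrow> (real^'n \<Rightarrow> real) \<Rightarrow> bool" where
  "smooth_fun_on U f \<longleftrightarrow> (\<forall>is. pds is f differentiable_on U)"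

definition riemannian_metric_on :: "(real^'n::finite) set \<Rightarrow> (real^'n \<Rightarrow> real^'n^'n) \<Rightarrow> bool" where
  "riemannian_metric_on U g \<longleftrightarrow>
     (\<forall>i j. smooth_fun_on U (\<lambda>x. g x $ i $ j)) \<and>
     (\<forall>x\<in>U. transpose (g x) = g x \<and> (\<forall>v. v \<noteq> 0 \<longrightarrow> v \<bullet> (g x *v v) > 0))"

definition ginv :: "(real^'n::finite \<Rightarrow> real^'n^'n) \<Rightarrow> real^'n \<Rightarrow> real^'n^'n" where
  "ginv g x = matrix_inv (g x)"

definition christ :: "(real^'n::finite \<Rightarrow> real^'n^'n) \<Rightarrow> 'n \<Rightarrow> 'n \<Rightarrow> 'n \<Rightarrow> real^'n \<Rightarrow> real" where
  "christ g k i j x = (1/2) * (\<Sum>l\<in>UNIV. ginv g x $ k $ l *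
      (pd i (\<lambda>y. g y $ j $ l) x + pd j (\<lambda>y. g y $ i $ l) x - pd l (\<lambda>y. g y $ i $ j) x))"

definition ricci :: "(real^'n::finite \<Rightarrow> real^'n^'n) \<Rightarrow> 'n \<Rightarrow> 'n \<Rightarrow> real^'n \<Rightarrow> real" where
  "ricci g i j x = (\<Sum>k\<in>UNIV. pd k (christ g k i j) x - pd j (christ g k i k) x
      + (\<Sum>l\<in>UNIV. christ g k k l x * christ g l i j x - christ g k j l x * christ g l i k x))"

definition scalar_curv :: "(real^'n::finite \<Rightarrow> real^'n^'n) \<Rightarrow> real^'n \<Rightarrow> real" where
  "scalar_curv g x = (\<Sum>i\<in>UNIV. \<Sum>j\<in>UNIV. ginv g x $ i $ j * ricci g i j x)"

text \<open>Round metric on the hemisphere in stereographic coordinates: 4/(1+|x|^2)^2 times Euclidean.\<close>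
definition round_metric :: "real^'n::finite \<Rightarrow> real^'n^'n" where
  "round_metric x = (4 / (1 + norm x ^ 2) ^ 2) *\<^sub>R mat 1"

text \<open>Outward g-unit normal field nu^i = grad_g(phi)/|grad_g phi|_g, phi(x) = |x|^2;
  on the unit sphere (the boundary) it is the outward unit normal.\<close>
definition unit_normal :: "(real^'n::finite \<Rightarrow> real^'n^'n) \<Rightarrow> 'n \<Rightarrow> real^'n \<Rightarrow> real" where
  "unit_normal g i x =
     (\<Sum>j\<in>UNIV. ginv g x $ i $ j * (2 * x $ j)) /
     sqrt (\<Sum>a\<in>UNIV. \<Sum>b\<in>UNIV. ginv g x $ a $ b * (2 * x $ a) * (2 * x $ b))"

text \<open>Mean curvature of the boundary: trace over the tangent space (projector g^ij - nu^i nu^j)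
  of the second fundamental form h(X,Y) = g(nabla_X nu, Y).  With this sign the mean curvature
  vector is -H nu, so H > 0 means it points into the manifold (round sphere in R^n: H = n-1).\<close>
definition mean_curv :: "(real^'n::finite \<Rightarrow> real^'n^'n) \<Rightarrow> real^'n \<Rightarrow> real" where
  "mean_curv g x = (\<Sum>i\<in>UNIV. \<Sum>j\<in>UNIV. \<Sum>k\<in>UNIV.
      (ginv g x $ i $ j - unit_normal g i x * unit_normal g j x) * g x $ j $ k *
      (pd i (unit_normal g k) x + (\<Sum>l\<in>UNIV. christ g k i l x * unit_normal g l x)))"

end

theory Submission
  imports Defs
begin

text \<open>The argument is a competition of orders in \<open>t\<close>. The mean curvature gains
  order \<open>t\<close>, while the layer costs it only order \<open>t^2\<close>; so the layer
  cannot spoil it as long as \<open>N\<close> and \<open>L\<close> are fixed before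
  \<open>t\<close>. The scalar curvature gains nothing from the pullback, and the layer changes it
  at order \<open>t^2\<close> only. Hence it must be exactly constant before the correction, and
  every other effect of the layer must be dominated at that same order. This fixes the order of the
  choices: first a Lipschitz constant for the lower order part of the scalar curvature, which
  depends only on the round metric because all metrics coincide with it at \<open>t = 0\<close>;
  then \<open>L\<close> and \<open>N\<close>; finally \<open>t\<close>, by compactness. There is no
  cutoff: the layer is a global exponential, so the interior has to be treated as well. The term of
  order \<open>N^2\<close> carries a factor \<open>|x|^2\<close> and disappears at the origin. There
  a term of order \<open>N\<close> takes over, which has the right sign if the full trace of
  \<open>K\<close> is negative. Away from the boundary neither sign is automatic, which forces the
  extra summand \<open>- L (1 - |x|^2)\<close> times the identity in \<open>K\<close>.\<close>

text \<open>
  Let \<open>m = n - 1\<close>.  The round metric is pulled back under maps \<open>\<Phi>\<^sub>t\<close> with \<open>\<Phi>\<^sub>0 = id\<close> that move the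
  boundary with normal speed \<open>t p\<close> and are chosen such that the full metric at the boundary changes
  only at order \<open>t\<^sup>2\<close>.  The scalar curvature stays equal to \<open>n(n-1)\<close>, and the mean curvature of the
  boundary is \<open>t w + O(t\<^sup>2)\<close> with \<open>w = -(\<Delta>p + m p)\<close>.  One can have \<open>w > 0\<close> and at the same time
  \<open>\<integral>(\<bar>\<nabla>p\<bar>\<^sup>2 - m p\<^sup>2) > 0\<close>, that is, boundary area growing at order \<open>t\<^sup>2\<close>: it suffices to concentrate
  \<open>w\<close> near two antipodal points, because Green's function has infinite energy in dimension \<open>m \<ge> 2\<close>.
  After a tangential reparametrization of order \<open>t\<^sup>2\<close> the area element then grows pointwise.  The
  boundary metric is restored by adding \<open>t\<^sup>2 exp(N(\<bar>x\<bar>\<^sup>2 - 1)) K\<close>, where the tangential trace of \<open>K\<close> is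
  negative.  This raises the scalar curvature: in its linearization the second normal derivative of
  the layer contributes a positive term of order \<open>N\<^sup>2\<close>, all other terms are smaller for large \<open>N\<close>.
\<close>

subsection \<open>Partial derivatives\<close>

lemma pd_eqI: "(f has_derivative f') (at x) \<Longrightarrow> pd i f x = f' (axis i 1)"
  unfolding pd_def using frechet_derivative_at by metis

lemma differentiable_derivI:
  "f differentiable (at x) \<Longrightarrow> (f has_derivative frechet_derivative f (at x)) (at x)"
  by (simp add: frechet_derivative_works)

lemma pd_const [simp]: "pd i (\<lambda>x. c) = (\<lambda>x. 0)"
  by (rule ext, subst pd_eqI[where f'="\<lambda>_. 0"]) auto

lemma pd_coord: "pd i (\<lambda>x. x $ j) = (\<lambda>x. if i = j then 1 else 0)"
proof
  fix x :: "real^'a"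
  have "((\<lambda>x. x $ j) has_derivative (\<lambda>x. x $ j)) (at x)"
    by (intro bounded_linear.has_derivative[OF bounded_linear_vec_nth] has_derivative_ident)
  from pd_eqI[OF this, of i] show "pd i (\<lambda>x. x $ j) x = (if i = j then 1 else 0)"
    by (simp add: axis_def)
qed

lemma pd_add:
  assumes "f differentiable (at x)" "g differentiable (at x)"
  shows "pd i (\<lambda>x. f x + g x) x = pd i f x + pd i g x"
  by (subst pd_eqI[OF has_derivative_add[OF assms[THEN differentiable_derivI]]]) (simp add: pd_def)

lemma pd_diff:
  assumes "f differentiable (at x)" "g differentiable (at x)"
  shows "pd i (\<lambda>x. f x - g x) x = pd i f x - pd i g x"
  by (subst pd_eqI[OF has_derivative_diff[OF assms[THEN differentiable_derivI]]]) (simp add: pd_def)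

lemma pd_minus:
  assumes "f differentiable (at x)"
  shows "pd i (\<lambda>x. - f x) x = - pd i f x"
  by (subst pd_eqI[OF has_derivative_minus[OF assms[THEN differentiable_derivI]]]) (simp add: pd_def)

lemma pd_mult:
  assumes "f differentiable (at x)" "g differentiable (at x)"
  shows "pd i (\<lambda>x. f x * g x) x = pd i f x * g x + f x * pd i g x"
  by (subst pd_eqI[OF has_derivative_mult[OF assms[THEN differentiable_derivI]]]) (simp add: pd_def)

lemma pd_cmult:
  assumes "f differentiable (at x)"
  shows "pd i (\<lambda>x. c * f x) x = c * pd i f x"
  using pd_mult[of "\<lambda>_. c" x f i] assms by simp

lemma pd_sum:
  assumes "\<And>a. a \<in> A \<Longrightarrow> f a differentiable (at x)"
  shows "pd i (\<lambda>x. \<Sum>a\<in>A. f a x) x = (\<Sum>a\<in>A. pd i (f a) x)"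
proof -
  have "((\<lambda>x. \<Sum>a\<in>A. f a x) has_derivative (\<lambda>h. \<Sum>a\<in>A. frechet_derivative (f a) (at x) h)) (at x)"
    by (intro has_derivative_sum differentiable_derivI assms)
  from pd_eqI[OF this] show ?thesis by (simp add: pd_def)
qed

lemma pd_exp:
  fixes f :: "real^'n \<Rightarrow> real"
  assumes "f differentiable (at x)"
  shows "pd i (\<lambda>x. exp (f x)) x = pd i f x * exp (f x)"
  by (subst pd_eqI[OF has_derivative_exp[OF differentiable_derivI[OF assms]]]) (simp add: pd_def)

lemma pd_inverse:
  fixes f :: "real^'n \<Rightarrow> real"
  assumes "f differentiable (at x)" "f x \<noteq> 0"
  shows "pd i (\<lambda>x. inverse (f x)) x = - (pd i f x * inverse (f x) * inverse (f x))"
  by (subst pd_eqI[OF Deriv.has_derivative_inverse[OF assms(2) differentiable_derivI[OF assms(1)]]])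
     (simp add: pd_def)

lemma differentiable_exp_real:
  fixes f :: "real^'n \<Rightarrow> real"
  assumes "f differentiable (at x)"
  shows "(\<lambda>x. exp (f x)) differentiable (at x)"
  using has_derivative_exp[OF differentiable_derivI[OF assms]] by (auto simp: differentiable_def)

lemma differentiable_coord: "(\<lambda>x. x $ j :: real) differentiable (at (x :: real^'n))"
  by (auto simp: differentiable_def intro!: exI bounded_linear.has_derivative[OF bounded_linear_vec_nth] has_derivative_ident)

lemma pd_cong_open:
  assumes "open S" "x \<in> S" "\<And>y. y \<in> S \<Longrightarrow> f y = g y"
  shows "pd i f x = pd i g x"
proof -
  have "(f has_derivative D) (at x) \<longleftrightarrow> (g has_derivative D) (at x)" for D
    using has_derivative_transform_within_open[of f D x UNIV S g]
      has_derivative_transform_within_open[of g D x UNIV S f] assms by auto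
  then show ?thesis by (simp add: pd_def frechet_derivative_def)
qed

lemma differentiable_cong_open:
  assumes "open S" "x \<in> S" "\<And>y. y \<in> S \<Longrightarrow> f y = g y" "f differentiable (at x)"
  shows "g differentiable (at x)"
  using assms has_derivative_transform_within_open[of f _ x UNIV S g]
  unfolding differentiable_def by blast

lemma frechet_eq_pd_sum:
  fixes f :: "real^'n \<Rightarrow> real"
  assumes "f differentiable (at x)"
  shows "frechet_derivative f (at x) v = (\<Sum>i\<in>UNIV. v $ i * pd i f x)"
proof -
  have l: "linear (frechet_derivative f (at x))"
    by (rule linear_frechet_derivative[OF assms])
  have "v = (\<Sum>i\<in>UNIV. v $ i *\<^sub>R axis i 1)"
    by (simp add: basis_expansion flip: scalar_mult_eq_scaleR)
  then have "frechet_derivative f (at x) v = frechet_derivative f (at x) (\<Sum>i\<in>UNIV. v $ i *\<^sub>R axis i 1)"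
    by simp
  also have "\<dots> = (\<Sum>i\<in>UNIV. v $ i * pd i f x)"
    by (simp add: linear_sum[OF l] linear_cmul[OF l] pd_def)
  finally show ?thesis .
qed

lemma pd_chain_curve:
  fixes f :: "real^'n \<Rightarrow> real"
  assumes "f differentiable (at (c s))" "(c has_vector_derivative v) (at s)"
  shows "((\<lambda>s. f (c s)) has_real_derivative (\<Sum>i\<in>UNIV. v $ i * pd i f (c s))) (at s)"
proof -
  have "((f \<circ> c) has_derivative (frechet_derivative f (at (c s)) \<circ> (\<lambda>h. h *\<^sub>R v))) (at s)"
    using assms(2) by (intro diff_chain_at differentiable_derivI assms) (simp add: has_vector_derivative_def)
  moreover have "frechet_derivative f (at (c s)) \<circ> (\<lambda>h. h *\<^sub>R v) = (\<lambda>h. h * (\<Sum>i\<in>UNIV. v $ i * pd i f (c s)))"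
    by (auto simp: frechet_eq_pd_sum[OF assms(1)] sum_distrib_left mult.assoc)
  ultimately show ?thesis
    by (simp add: has_field_derivative_def o_def mult.commute[of _ "sum _ _"] fun_eq_iff)
qed

subsection \<open>Smooth functions depending on a real parameter\<close>

text \<open>The symmetry of second partial derivatives is made part of the definition: it is preserved by
  all closure properties below, so Schwarz's theorem is not needed.\<close>

fun csm :: "nat \<Rightarrow> (real \<Rightarrow> real^'n::finite \<Rightarrow> real) \<Rightarrow> bool" where
  "csm 0 f \<longleftrightarrow> continuous_on UNIV (\<lambda>z. f (fst z) (snd z))"
| "csm (Suc k) f \<longleftrightarrow> continuous_on UNIV (\<lambda>z. f (fst z) (snd z)) \<and> (\<forall>t x. f t differentiable (at x)) \<and>
     (0 < k \<longrightarrow> (\<forall>t i j. pd i (pd j (f t)) = pd j (pd i (f t)))) \<and> (\<forall>i. csm k (\<lambda>t. pd i (f t)))"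

definition psmooth :: "(real \<Rightarrow> real^'n::finite \<Rightarrow> real) \<Rightarrow> bool" where
  "psmooth f \<longleftrightarrow> (\<forall>k. csm k f)"

lemma csm_Suc_diff: "csm (Suc k) f \<Longrightarrow> f t differentiable (at x)"
  by simp

lemma csm_Suc_pd: "csm (Suc k) f \<Longrightarrow> csm k (\<lambda>t. pd i (f t))"
  by simp

lemma csm_Suc_comm: "csm (Suc k) f \<Longrightarrow> 0 < k \<Longrightarrow> pd i (pd j (f t)) = pd j (pd i (f t))"
  unfolding csm.simps by blast

lemma csm_Suc_pd_diff: "csm (Suc k) f \<Longrightarrow> 0 < k \<Longrightarrow> pd i (f t) differentiable (at x)"
  using csm_Suc_diff[of "k - 1" "\<lambda>t. pd i (f t)"] csm_Suc_pd[of k f i] by simp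

lemma csm_SucI:
  assumes "continuous_on UNIV (\<lambda>z. f (fst z) (snd z))" "\<And>t x. f t differentiable (at x)"
    "\<And>t i j. 0 < k \<Longrightarrow> pd i (pd j (f t)) = pd j (pd i (f t))" "\<And>i. csm k (\<lambda>t. pd i (f t))"
  shows "csm (Suc k) f"
  unfolding csm.simps using assms by blast

lemma csm_cont: "csm k f \<Longrightarrow> continuous_on UNIV (\<lambda>z. f (fst z) (snd z))"
  by (cases k) auto

lemma csm_mono: "csm (Suc k) f \<Longrightarrow> csm k f"
proof (induction k arbitrary: f)
  case 0
  then show ?case by simp
next
  case (Suc k)
  show ?case
    by (rule csm_SucI)
      (use Suc.prems[THEN csm_cont] Suc.prems[THEN csm_Suc_diff] csm_Suc_comm[OF Suc.prems]
        Suc.IH[OF Suc.prems[THEN csm_Suc_pd]] in auto)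
qed

lemma psmooth_cont: "psmooth f \<Longrightarrow> continuous_on UNIV (\<lambda>z. f (fst z) (snd z))"
  by (auto simp: psmooth_def intro: csm_cont)

lemma psmooth_diff: "psmooth f \<Longrightarrow> f t differentiable (at x)"
  unfolding psmooth_def using csm.simps(2)[of 0 f] by blast

lemma psmooth_pd: "psmooth f \<Longrightarrow> psmooth (\<lambda>t. pd i (f t))"
  unfolding psmooth_def using csm.simps(2)[of _ f] by blast

lemma psmooth_comm: "psmooth f \<Longrightarrow> pd i (pd j (f t)) = pd j (pd i (f t))"
  unfolding psmooth_def using csm.simps(2)[of 1 f] by simp

lemma csm_time: "continuous_on UNIV h \<Longrightarrow> csm k (\<lambda>t x. h t)"
proof (induction k arbitrary: h)
  case 0
  then show ?case by (auto intro!: continuous_on_compose2[of UNIV h] continuous_intros)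
next
  case (Suc k)
  then show ?case by (auto intro!: continuous_on_compose2[of UNIV h] continuous_intros)
qed

lemma csm_coord: "csm k (\<lambda>t x. x $ j)"
  by (cases k) (auto simp: pd_coord intro!: csm_time continuous_intros differentiable_coord)

lemma csm_add: "csm k f \<Longrightarrow> csm k g \<Longrightarrow> csm k (\<lambda>t x. f t x + g t x)"
proof (induction k arbitrary: f g)
  case 0
  then show ?case by (auto intro!: continuous_intros)
next
  case (Suc k)
  note d = Suc.prems[THEN csm_Suc_diff] and c = Suc.prems[THEN csm_Suc_comm]
    and d2 = Suc.prems[THEN csm_Suc_pd_diff]
  have eq: "pd i (\<lambda>x. f t x + g t x) = (\<lambda>x. pd i (f t) x + pd i (g t) x)" for i t
    by (intro ext pd_add d)
  show ?case
  proof (rule csm_SucI, goal_cases)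
    case 1
    then show ?case using Suc.prems[THEN csm_cont] by (intro continuous_intros)
  next
    case 2
    then show ?case using d by simp
  next
    case (3 t i j)
    then show ?case unfolding eq by (simp add: pd_add d2 c[of i j] fun_eq_iff)
  next
    case 4
    then show ?case unfolding eq by (intro Suc.IH Suc.prems[THEN csm_Suc_pd])
  qed
qed

lemma csm_mult: "csm k f \<Longrightarrow> csm k g \<Longrightarrow> csm k (\<lambda>t x. f t x * g t x)"
proof (induction k arbitrary: f g)
  case 0
  then show ?case by (auto intro!: continuous_intros)
next
  case (Suc k)
  note d = Suc.prems[THEN csm_Suc_diff] and c = Suc.prems[THEN csm_Suc_comm]
    and d2 = Suc.prems[THEN csm_Suc_pd_diff]
  have eq: "pd i (\<lambda>x. f t x * g t x) = (\<lambda>x. pd i (f t) x * g t x + f t x * pd i (g t) x)" for i t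
    by (intro ext pd_mult d)
  show ?case
  proof (rule csm_SucI, goal_cases)
    case 1
    then show ?case using Suc.prems[THEN csm_cont] by (intro continuous_intros)
  next
    case 2
    then show ?case using d by simp
  next
    case (3 t i j)
    then show ?case unfolding eq
      by (simp add: pd_add pd_mult d d2 c[of i j] fun_eq_iff del: ring_distribs)
  next
    case 4
    then show ?case unfolding eq
      by (intro csm_add Suc.IH Suc.prems[THEN csm_Suc_pd] Suc.prems[THEN csm_mono])
  qed
qed

lemma csm_inverse: "csm k f \<Longrightarrow> (\<And>t x. f t x \<noteq> 0) \<Longrightarrow> csm k (\<lambda>t x. inverse (f t x))"
proof (induction k arbitrary: f)
  case 0
  then show ?case by (auto intro!: continuous_intros)
next
  case (Suc k)
  note nz = Suc.prems(2)
  note d = Suc.prems(1)[THEN csm_Suc_diff] and c = Suc.prems(1)[THEN csm_Suc_comm]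
    and d2 = Suc.prems(1)[THEN csm_Suc_pd_diff]
  have di: "(\<lambda>x. inverse (f t x)) differentiable (at x)" for t x
    using d nz by (intro differentiable_inverse) auto
  have eq: "pd i (\<lambda>x. inverse (f t x)) = (\<lambda>x. - 1 * (pd i (f t) x * inverse (f t x) * inverse (f t x)))" for i t
    using d nz by (auto simp: pd_inverse)
  show ?case
  proof (rule csm_SucI, goal_cases)
    case 1
    then show ?case using Suc.prems(1)[THEN csm_cont] nz by (auto intro!: continuous_intros)
  next
    case 2
    then show ?case using di by simp
  next
    case (3 t i j)
    then show ?case unfolding eq
      by (simp add: pd_minus pd_mult d d2 di pd_inverse nz c[of i j] fun_eq_iff)
  next
    case 4
    then show ?case unfolding eq
      by (intro csm_mult csm_time Suc.IH nz Suc.prems(1)[THEN csm_Suc_pd] Suc.prems(1)[THEN csm_mono] continuous_intros)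
  qed
qed

lemma csm_exp: "csm k f \<Longrightarrow> csm k (\<lambda>t x. exp (f t x))"
proof (induction k arbitrary: f)
  case 0
  then show ?case by (auto intro!: continuous_intros)
next
  case (Suc k)
  note d = Suc.prems(1)[THEN csm_Suc_diff] and c = Suc.prems(1)[THEN csm_Suc_comm]
    and d2 = Suc.prems(1)[THEN csm_Suc_pd_diff]
  have di: "(\<lambda>x. exp (f t x)) differentiable (at x)" for t x
    using d by (intro differentiable_exp_real) auto
  have eq: "pd i (\<lambda>x. exp (f t x)) = (\<lambda>x. pd i (f t) x * exp (f t x))" for i t
    using d by (auto simp: pd_exp)
  show ?case
  proof (rule csm_SucI, goal_cases)
    case 1
    then show ?case using Suc.prems[THEN csm_cont] by (auto intro!: continuous_intros)
  next
    case 2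
    then show ?case using di by simp
  next
    case (3 t i j)
    then show ?case unfolding eq
      by (simp add: pd_mult d d2 di pd_exp c[of i j] fun_eq_iff)
  next
    case 4
    then show ?case unfolding eq
      by (intro csm_mult Suc.IH Suc.prems(1)[THEN csm_Suc_pd] Suc.prems(1)[THEN csm_mono])
  qed
qed

lemma continuous_on_freeze:
  fixes f :: "real \<Rightarrow> real^'n \<Rightarrow> real"
  assumes "continuous_on UNIV (\<lambda>z. f (fst z) (snd z))"
  shows "continuous_on UNIV (\<lambda>z :: real \<times> (real^'n). f s (snd z))"
proof -
  have "continuous_on UNIV (\<lambda>z. (\<lambda>z. f (fst z) (snd z)) (s, snd (z :: real \<times> (real^'n))))"
    by (rule continuous_on_compose2[OF assms]) (auto intro!: continuous_intros)
  then show ?thesis by simp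
qed

text \<open>Lets the metric at one fixed parameter value be treated as a parameter-independent
  family, the form in which the pointwise curvature formulas ask for smoothness.\<close>

lemma csm_freeze: "csm k f \<Longrightarrow> csm k (\<lambda>_. f s)"
proof (induction k arbitrary: f)
  case 0
  then show ?case by (simp add: continuous_on_freeze)
next
  case (Suc k)
  show ?case
  proof (rule csm_SucI, goal_cases)
    case 1
    then show ?case using Suc.prems[THEN csm_cont] by (intro continuous_on_freeze)
  next
    case 2
    then show ?case using Suc.prems by simp
  next
    case (3 t i j)
    then show ?case using csm_Suc_comm[OF Suc.prems] by blast
  next
    case (4 i)
    then show ?case using Suc.IH[of "\<lambda>t. pd i (f t)"] Suc.prems by simp
  qed
qed

lemma psmooth_time: "continuous_on UNIV h \<Longrightarrow> psmooth (\<lambda>t x. h t)"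
  by (simp add: psmooth_def csm_time)

lemma psmooth_const: "psmooth (\<lambda>t x. c)"
  by (rule psmooth_time) simp

lemma psmooth_coord: "psmooth (\<lambda>t x. x $ j)"
  by (simp add: psmooth_def csm_coord)

lemma psmooth_add: "psmooth f \<Longrightarrow> psmooth g \<Longrightarrow> psmooth (\<lambda>t x. f t x + g t x)"
  by (simp add: psmooth_def csm_add)

lemma psmooth_mult: "psmooth f \<Longrightarrow> psmooth g \<Longrightarrow> psmooth (\<lambda>t x. f t x * g t x)"
  by (simp add: psmooth_def csm_mult)

lemma psmooth_inverse: "psmooth f \<Longrightarrow> (\<And>t x. f t x \<noteq> 0) \<Longrightarrow> psmooth (\<lambda>t x. inverse (f t x))"
  by (simp add: psmooth_def csm_inverse)

lemma psmooth_exp: "psmooth f \<Longrightarrow> psmooth (\<lambda>t x. exp (f t x))"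
  by (simp add: psmooth_def csm_exp)

lemma psmooth_freeze: "psmooth f \<Longrightarrow> psmooth (\<lambda>_. f s)"
  unfolding psmooth_def using csm_freeze by blast

lemma psmooth_t: "psmooth (\<lambda>t x. t)"
  by (rule psmooth_time) (rule continuous_on_id)

lemma psmooth_minus: "psmooth f \<Longrightarrow> psmooth (\<lambda>t x. - f t x)"
  using psmooth_mult[OF psmooth_const[of "-1"], of f] by simp

lemma psmooth_sub: "psmooth f \<Longrightarrow> psmooth g \<Longrightarrow> psmooth (\<lambda>t x. f t x - g t x)"
  using psmooth_add[OF _ psmooth_minus, of f g] by simp

lemma psmooth_power: "psmooth f \<Longrightarrow> psmooth (\<lambda>t x. f t x ^ k)"
  by (induction k) (auto intro: psmooth_const psmooth_mult)

lemma psmooth_sum: "(\<And>a. a \<in> A \<Longrightarrow> psmooth (f a)) \<Longrightarrow> psmooth (\<lambda>t x. \<Sum>a\<in>A. f a t x)"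
  by (induction A rule: infinite_finite_induct) (auto intro: psmooth_const psmooth_add)

lemma psmooth_poly: "psmooth f \<Longrightarrow> psmooth (\<lambda>t x. poly q (f t x))"
  by (induction q) (auto intro: psmooth_const psmooth_mult psmooth_add)

lemmas psmooth_intros = psmooth_const psmooth_t psmooth_coord psmooth_add psmooth_mult psmooth_exp
  psmooth_minus psmooth_sub psmooth_power psmooth_sum psmooth_poly

lemma psmooth_imp_smooth_fun_on:
  assumes "psmooth f" "open U"
  shows "smooth_fun_on U (f t)"
proof -
  have "psmooth (\<lambda>t. pds is (f t))" for "is"
    by (induction "is") (auto intro: psmooth_pd assms)
  from psmooth_diff[OF this] show ?thesis
    by (auto simp: smooth_fun_on_def differentiable_on_def intro: differentiable_at_withinI)
qed

lemma psmooth_isCont: "psmooth f \<Longrightarrow> isCont (\<lambda>z. f (fst z) (snd z)) z"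
  using psmooth_cont continuous_on_eq_continuous_at by blast

lemma psmooth_isCont_x: "psmooth f \<Longrightarrow> isCont (f t) x"
  using psmooth_diff differentiable_imp_continuous_within by blast

lemma psmooth_cont_x: "psmooth f \<Longrightarrow> continuous_on S (f t)"
  by (simp add: psmooth_isCont_x continuous_at_imp_continuous_on)

subsection \<open>Inverse matrices and positive definiteness\<close>

lemma matrix_inv_both:
  fixes A :: "real^'n^'n"
  assumes "det A \<noteq> 0"
  shows "A ** matrix_inv A = mat 1" "matrix_inv A ** A = mat 1"
proof -
  have "\<exists>B. A ** B = mat 1 \<and> B ** A = mat 1"
    using assms invertible_det_nz[of A] by (auto simp: invertible_def)
  then have "A ** matrix_inv A = mat 1 \<and> matrix_inv A ** A = mat 1"
    unfolding matrix_inv_def by (rule someI_ex)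
  then show "A ** matrix_inv A = mat 1" "matrix_inv A ** A = mat 1" by auto
qed

lemma matrix_inv_left_entry:
  fixes A :: "real^'n^'n"
  assumes "det A \<noteq> 0"
  shows "(\<Sum>b\<in>UNIV. matrix_inv A $ k $ b * A $ b $ c) = (if k = c then 1 else 0)"
  using matrix_inv_both(2)[OF assms] by (simp add: vec_eq_iff matrix_matrix_mult_def mat_def)

lemma matrix_inv_right_entry:
  fixes A :: "real^'n^'n"
  assumes "det A \<noteq> 0"
  shows "(\<Sum>b\<in>UNIV. A $ k $ b * matrix_inv A $ b $ c) = (if k = c then 1 else 0)"
  using matrix_inv_both(1)[OF assms] by (simp add: vec_eq_iff matrix_matrix_mult_def mat_def)

lemma matrix_inv_unique_left:
  fixes A B :: "real^'n^'n"
  assumes "B ** A = mat 1"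
  shows "det A \<noteq> 0" "matrix_inv A = B"
proof -
  have "A ** B = mat 1" using assms matrix_left_right_inverse by blast
  then show *: "det A \<noteq> 0" using invertible_det_nz[of A] assms by (auto simp: invertible_def)
  have "matrix_inv A = B ** A ** matrix_inv A" by (simp add: assms)
  also have "\<dots> = B" by (simp add: matrix_mul_assoc[symmetric] matrix_inv_both[OF *])
  finally show "matrix_inv A = B" .
qed

text \<open>Entries as quotients of determinants: continuity and differentiability of the inverse
  are read off from this.\<close>

lemma matrix_inv_cramer:
  fixes A :: "real^'n^'n"
  assumes "det A \<noteq> 0"
  shows "matrix_inv A $ k $ l =
    det (\<chi> i j. if j = k then (if i = l then 1 else 0) else A $ i $ j) / det A"
proof -
  have "A *v (\<chi> k. matrix_inv A $ k $ l) = (\<chi> i. if i = l then 1 else 0)"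
    using matrix_inv_right_entry[OF assms] by (simp add: vec_eq_iff matrix_vector_mult_def)
  from iffD1[OF cramer[OF assms] this] show ?thesis
    by (simp add: vec_eq_iff cong: if_cong)
qed

lemma sum_delta_mult:
  fixes h :: "'n::finite \<Rightarrow> real"
  shows "(\<Sum>b\<in>UNIV. (if a = b then 1 else 0) * h b) = h a"
    "(\<Sum>b\<in>UNIV. (if b = a then 1 else 0) * h b) = h a"
    "(\<Sum>b\<in>UNIV. h b * (if a = b then 1 else 0)) = h a"
    "(\<Sum>b\<in>UNIV. h b * (if b = a then 1 else 0)) = h a"
proof -
  have d: "(\<Sum>b\<in>UNIV. if b = a then h b else 0) = h a" by simp
  show "(\<Sum>b\<in>UNIV. (if a = b then 1 else 0) * h b) = h a"
    by (rule trans[OF sum.cong d]) auto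
  show "(\<Sum>b\<in>UNIV. (if b = a then 1 else 0) * h b) = h a"
    by (rule trans[OF sum.cong d]) auto
  show "(\<Sum>b\<in>UNIV. h b * (if a = b then 1 else 0)) = h a"
    by (rule trans[OF sum.cong d]) auto
  show "(\<Sum>b\<in>UNIV. h b * (if b = a then 1 else 0)) = h a"
    by (rule trans[OF sum.cong d]) auto
qed

text \<open>The identity \<open>W - W' = W' (A' - A) W\<close>. It bounds the change of the inverse
  metric linearly by the change of the metric.\<close>

lemma matrix_inv_difference:
  fixes A A' :: "real^'n^'n"
  assumes "det A \<noteq> 0" "det A' \<noteq> 0"
  shows "matrix_inv A $ i $ j - matrix_inv A' $ i $ j =
    (\<Sum>a\<in>UNIV. \<Sum>b\<in>UNIV. matrix_inv A' $ i $ a * (A' $ a $ b - A $ a $ b) * matrix_inv A $ b $ j)"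
proof -
  let ?W = "\<lambda>i j. matrix_inv A $ i $ j" and ?W' = "\<lambda>i j. matrix_inv A' $ i $ j"
  have "(\<Sum>a\<in>UNIV. \<Sum>b\<in>UNIV. ?W' i a * (A' $ a $ b - A $ a $ b) * ?W b j) =
     (\<Sum>a\<in>UNIV. \<Sum>b\<in>UNIV. ?W' i a * A' $ a $ b * ?W b j) - (\<Sum>a\<in>UNIV. \<Sum>b\<in>UNIV. ?W' i a * A $ a $ b * ?W b j)"
    by (simp add: sum_subtractf algebra_simps)
  also have "(\<Sum>a\<in>UNIV. \<Sum>b\<in>UNIV. ?W' i a * A' $ a $ b * ?W b j) = (\<Sum>b\<in>UNIV. (\<Sum>a\<in>UNIV. ?W' i a * A' $ a $ b) * ?W b j)"
    by (subst sum.swap) (simp only: sum_distrib_right)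
  also have "\<dots> = ?W i j"
    unfolding matrix_inv_left_entry[OF assms(2)] sum_delta_mult ..
  also have "(\<Sum>a\<in>UNIV. \<Sum>b\<in>UNIV. ?W' i a * A $ a $ b * ?W b j) = (\<Sum>a\<in>UNIV. ?W' i a * (\<Sum>b\<in>UNIV. A $ a $ b * ?W b j))"
    by (simp only: sum_distrib_left mult.assoc)
  also have "\<dots> = ?W' i j"
    unfolding matrix_inv_right_entry[OF assms(1)] sum_delta_mult ..
  finally show ?thesis by simp
qed

lemma isCont_tendsto_nhds: "isCont f z \<Longrightarrow> (f \<longlongrightarrow> f z) (nhds z)"
  by (simp add: isCont_def tendsto_at_iff_tendsto_nhds)

lemma isCont_det:
  fixes A :: "'a::t2_space \<Rightarrow> real^'n^'n"
  assumes "\<And>i j. isCont (\<lambda>z. A z $ i $ j) z"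
  shows "isCont (\<lambda>z. det (A z)) z"
  unfolding det_def by (intro continuous_intros assms)

lemma isCont_matrix_inv:
  fixes A :: "'a::t2_space \<Rightarrow> real^'n^'n"
  assumes c: "\<And>i j. isCont (\<lambda>z. A z $ i $ j) z" and d: "det (A z) \<noteq> 0"
  shows "isCont (\<lambda>z. matrix_inv (A z) $ k $ l) z"
proof -
  have cd: "isCont (\<lambda>z. det (A z)) z" by (rule isCont_det[OF c])
  have "isCont (\<lambda>z. det (\<chi> i j. if j = k then (if i = l then 1 else 0) else A z $ i $ j)) z"
  proof (rule isCont_det)
    fix i j show "isCont (\<lambda>z. (\<chi> i j. if j = k then (if i = l then 1 else 0) else A z $ i $ j) $ i $ j) z"
      using c[of i j] by (cases "j = k") auto
  qed
  then have "isCont (\<lambda>z. det (\<chi> i j. if j = k then (if i = l then 1 else 0) else A z $ i $ j) / det (A z)) z"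
    using cd d by (intro continuous_intros)
  moreover have "\<forall>\<^sub>F y in nhds z. det (A y) \<noteq> 0"
    by (rule tendsto_imp_eventually_ne[OF isCont_tendsto_nhds[OF cd] d])
  then have "\<forall>\<^sub>F y in nhds z. det (\<chi> i j. if j = k then (if i = l then 1 else 0) else A y $ i $ j) / det (A y) 
      = matrix_inv (A y) $ k $ l"
    by eventually_elim (simp add: matrix_inv_cramer)
  ultimately show ?thesis by (simp add: isCont_cong)
qed

lemma differentiable_prod_real:
  fixes f :: "'a \<Rightarrow> real^'n \<Rightarrow> real"
  shows "(\<And>a. a \<in> A \<Longrightarrow> f a differentiable (at x)) \<Longrightarrow> (\<lambda>x. \<Prod>a\<in>A. f a x) differentiable (at x)"
  by (induction A rule: infinite_finite_induct) (auto intro: differentiable_mult)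

lemma differentiable_det:
  fixes A :: "real^'m \<Rightarrow> real^'n^'n"
  assumes "\<And>i j. (\<lambda>z. A z $ i $ j) differentiable (at z)"
  shows "(\<lambda>z. det (A z)) differentiable (at z)"
  unfolding det_def
  by (intro differentiable_sum differentiable_mult differentiable_const differentiable_prod_real assms finite_permutations ballI finite)
 
lemma open_det_nz:
  fixes A :: "real^'m \<Rightarrow> real^'n^'n"
  assumes "\<And>i j z. isCont (\<lambda>z. A z $ i $ j) z"
  shows "open {z. det (A z) \<noteq> 0}"
  by (intro open_Collect_neq continuous_at_imp_continuous_on ballI isCont_det assms continuous_intros)

lemma differentiable_matrix_inv:
  fixes A :: "real^'m \<Rightarrow> real^'n^'n"
  assumes c: "\<And>i j z. (\<lambda>z. A z $ i $ j) differentiable (at z)" and d: "det (A z) \<noteq> 0"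
  shows "(\<lambda>z. matrix_inv (A z) $ k $ l) differentiable (at z)"
proof (rule differentiable_cong_open)
  show "open {z. det (A z) \<noteq> 0}"
    by (intro open_det_nz differentiable_imp_continuous_within c)
  show "z \<in> {z. det (A z) \<noteq> 0}" using d by simp
  show "det (\<chi> i j. if j = k then (if i = l then 1 else 0) else A y $ i $ j) / det (A y) 
      = matrix_inv (A y) $ k $ l" if "y \<in> {z. det (A z) \<noteq> 0}" for y
    using that by (simp add: matrix_inv_cramer)
  have "(\<lambda>z. det (\<chi> i j. if j = k then (if i = l then 1 else 0) else A z $ i $ j)) differentiable (at z)"
  proof (rule differentiable_det)
    fix i j show "(\<lambda>z. (\<chi> i j. if j = k then (if i = l then 1 else 0) else A z $ i $ j) $ i $ j) differentiable (at z)"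
      using c[of i j] by (cases "j = k") auto
  qed
  moreover have "(\<lambda>z. det (A z)) differentiable (at z)"
    by (rule differentiable_det[OF c])
  ultimately show "(\<lambda>z. det (\<chi> i j. if j = k then (if i = l then 1 else 0) else A z $ i $ j) / det (A z)) differentiable (at z)"
    using d by (rule differentiable_divide)
qed

lemma pos_def_det_nz:
  fixes A :: "real^'n^'n"
  assumes "\<And>v. v \<noteq> 0 \<Longrightarrow> v \<bullet> (A *v v) > 0"
  shows "det A \<noteq> 0"
proof -
  have "\<forall>x. A *v x = 0 \<longrightarrow> x = 0" using assms by force
  then have "\<exists>B. B ** A = mat 1" by (simp add: matrix_left_invertible_ker)
  then show ?thesis using matrix_inv_unique_left by blast
qed

text \<open>The compactness principle behind every choice of a small \<open>t\<close>: by the tube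
  lemma, a strict inequality at \<open>t = 0\<close> survives uniformly for small
  \<open>t > 0\<close>.\<close>

lemma eventually_pos_on_compact:
  fixes f :: "real \<times> 'a::metric_space \<Rightarrow> real"
  assumes "compact K" "\<And>x. x \<in> K \<Longrightarrow> isCont f (0, x)" "\<And>x. x \<in> K \<Longrightarrow> f (0, x) > 0"
  shows "\<forall>\<^sub>F t in at_right 0. \<forall>x\<in>K. f (t, x) > 0"
proof -
  define W where "W = interior {z. f z > 0}"
  have "{0} \<times> K \<subseteq> W"
  proof
    fix z :: "real \<times> 'a" assume z: "z \<in> {0} \<times> K"
    then have c: "isCont f z" "f z > 0" using assms by auto
    then have "\<forall>\<^sub>F y in nhds z. f y > 0"
      using order_tendstoD(1)[OF isCont_tendsto_nhds] by blast
    then obtain S where "open S" "z \<in> S" "\<forall>y\<in>S. f y > 0" by (auto simp: eventually_nhds)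
    then show "z \<in> W" unfolding W_def by (auto simp: interior_def)
  qed
  from Elementary_Topology.tube_lemma[OF assms(1) _ this] obtain X0 where X0: "0 \<in> X0" "open X0" "X0 \<times> K \<subseteq> W"
    by (auto simp: W_def)
  then have "\<forall>\<^sub>F t in nhds 0. t \<in> X0" by (auto simp: eventually_nhds)
  then have "\<forall>\<^sub>F t in at_right 0. t \<in> X0"
    unfolding eventually_at_filter by (rule eventually_mono) simp
  then show ?thesis
  proof eventually_elim
    case (elim t)
    then show ?case using X0(3) interior_subset[of "{z. f z > 0}"] unfolding W_def by blast
  qed
qed

subsection \<open>Scalar curvature as a function of the two-jet of the metric\<close>

text \<open>In the following \<open>W\<close> stands for the inverse metric and \<open>B\<close>, \<open>C\<close> for its first and second
  partial derivatives.  The part \<open>QJ\<close> of lower order enters only through its local Lipschitz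
  continuity.\<close>

definition GamJ :: "('n::finite \<Rightarrow> 'n \<Rightarrow> real) \<Rightarrow> ('n \<Rightarrow> 'n \<Rightarrow> 'n \<Rightarrow> real) \<Rightarrow> 'n \<Rightarrow> 'n \<Rightarrow> 'n \<Rightarrow> real" where
  "GamJ W B k i j = (1/2) * (\<Sum>l\<in>UNIV. W k l * (B i j l + B j i l - B l i j))"

definition dGamJ :: "('n::finite \<Rightarrow> 'n \<Rightarrow> real) \<Rightarrow> ('n \<Rightarrow> 'n \<Rightarrow> 'n \<Rightarrow> real) \<Rightarrow> 'n \<Rightarrow> 'n \<Rightarrow> 'n \<Rightarrow> 'n \<Rightarrow> real" where
  "dGamJ W B p k i j = (1/2) * (\<Sum>l\<in>UNIV. (\<Sum>a\<in>UNIV. \<Sum>b\<in>UNIV. (-1) * (W k a * B p a b * W b l)) *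
     (B i j l + B j i l - B l i j))"

definition QJ :: "('n::finite \<Rightarrow> 'n \<Rightarrow> real) \<Rightarrow> ('n \<Rightarrow> 'n \<Rightarrow> 'n \<Rightarrow> real) \<Rightarrow> real" where
  "QJ W B = (\<Sum>i\<in>UNIV. \<Sum>j\<in>UNIV. W i j * (\<Sum>k\<in>UNIV. dGamJ W B k k i j - dGamJ W B j k i k
      + (\<Sum>l\<in>UNIV. GamJ W B k k l * GamJ W B l i j - GamJ W B k j l * GamJ W B l i k)))"

definition PrJ :: "('n::finite \<Rightarrow> 'n \<Rightarrow> real) \<Rightarrow> ('n \<Rightarrow> 'n \<Rightarrow> 'n \<Rightarrow> 'n \<Rightarrow> real) \<Rightarrow> real" where
  "PrJ W C = (\<Sum>i\<in>UNIV. \<Sum>j\<in>UNIV. W i j * (\<Sum>k\<in>UNIV.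
      (1/2) * (\<Sum>l\<in>UNIV. W k l * (C k i j l + C k j i l - C k l i j))
    - (1/2) * (\<Sum>l\<in>UNIV. W k l * (C j i k l + C j k i l - C j l i k))))"

text \<open>Differentiate \<open>W g = 1\<close> on the open set where \<open>g\<close> is
  invertible, then multiply by \<open>W\<close> from the right.\<close>

lemma pd_ginv:
  fixes g :: "real^'n \<Rightarrow> real^'n^'n"
  assumes d: "\<And>i j x. (\<lambda>y. g y $ i $ j) differentiable (at x)" and nz: "det (g x) \<noteq> 0"
  shows "pd p (\<lambda>y. ginv g y $ k $ l) x =
    (\<Sum>a\<in>UNIV. \<Sum>b\<in>UNIV. (-1) * (ginv g x $ k $ a * pd p (\<lambda>y. g y $ a $ b) x * ginv g x $ b $ l))"
proof -
  let ?W = "\<lambda>a b y. ginv g y $ a $ b" and ?g = "\<lambda>a b y. g y $ a $ b"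
  have dW: "?W a b differentiable (at x)" for a b
    unfolding ginv_def by (intro differentiable_matrix_inv d nz)
  have eq: "(\<Sum>b\<in>UNIV. pd p (?W k b) x * ?g b c x) = - (\<Sum>b\<in>UNIV. ?W k b x * pd p (?g b c) x)" for c
  proof -
    have "pd p (\<lambda>y. \<Sum>b\<in>UNIV. ?W k b y * ?g b c y) x = pd p (\<lambda>y. if k = c then 1 else 0) x"
      by (rule pd_cong_open[of "{y. det (g y) \<noteq> 0}"])
         (use nz in \<open>auto simp: ginv_def matrix_inv_left_entry intro!: open_det_nz differentiable_imp_continuous_within d\<close>)
    moreover have "pd p (\<lambda>y. \<Sum>b\<in>UNIV. ?W k b y * ?g b c y) x = (\<Sum>b\<in>UNIV. pd p (?W k b) x * ?g b c x + ?W k b x * pd p (?g b c) x)"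
      by (subst pd_sum) (auto simp: pd_mult d dW)
    ultimately show ?thesis by (simp add: sum.distrib)
  qed
  have "pd p (?W k l) x = (\<Sum>b\<in>UNIV. pd p (?W k b) x * (if b = l then 1 else 0))"
    by (simp add: if_distrib cong: if_cong)
  also have "\<dots> = (\<Sum>b\<in>UNIV. pd p (?W k b) x * (\<Sum>c\<in>UNIV. ?g b c x * ?W c l x))"
    by (simp add: ginv_def matrix_inv_right_entry[OF nz])
  also have "\<dots> = (\<Sum>c\<in>UNIV. (\<Sum>b\<in>UNIV. pd p (?W k b) x * ?g b c x) * ?W c l x)"
    unfolding sum_distrib_left sum_distrib_right by (subst sum.swap) (simp add: mult.assoc)
  also have "\<dots> = (\<Sum>c\<in>UNIV. \<Sum>b\<in>UNIV. (-1) * (?W k b x * pd p (?g b c) x * ?W c l x))"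
    unfolding eq by (simp add: sum_distrib_right sum_negf)
  also have "\<dots> = (\<Sum>a\<in>UNIV. \<Sum>b\<in>UNIV. (-1) * (?W k a x * pd p (?g a b) x * ?W b l x))"
    by (rule sum.swap)
  finally show ?thesis .
qed

lemma christ_eq_GamJ:
  "christ g k i j x = GamJ (\<lambda>k l. ginv g x $ k $ l) (\<lambda>p i j. pd p (\<lambda>y. g y $ i $ j) x) k i j"
  by (simp add: christ_def GamJ_def)

lemma pd_christ:
  fixes g :: "real^'n \<Rightarrow> real^'n^'n"
  assumes s: "\<And>i j. psmooth (\<lambda>_ x. g x $ i $ j)" and nz: "det (g x) \<noteq> 0"
  shows "pd p (christ g k i j) x =
    dGamJ (\<lambda>k l. ginv g x $ k $ l) (\<lambda>p i j. pd p (\<lambda>y. g y $ i $ j) x) p k i j +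
    (1/2) * (\<Sum>l\<in>UNIV. ginv g x $ k $ l * (pd p (pd i (\<lambda>y. g y $ j $ l)) x
       + pd p (pd j (\<lambda>y. g y $ i $ l)) x - pd p (pd l (\<lambda>y. g y $ i $ j)) x))"
    and differentiable_christ: "christ g k i j differentiable (at x)"
proof -
  note d = psmooth_diff[OF s]
  note d2 = psmooth_diff[OF psmooth_pd[OF s]]
  have dW: "(\<lambda>y. ginv g y $ a $ b) differentiable (at x)" for a b
    unfolding ginv_def by (intro differentiable_matrix_inv d nz)
  have dd: "(\<lambda>x. \<Sum>l\<in>UNIV. ginv g x $ k $ l * (pd i (\<lambda>y. g y $ j $ l) x + pd j (\<lambda>y. g y $ i $ l) x
      - pd l (\<lambda>y. g y $ i $ j) x)) differentiable (at x)"
    by (intro differentiable_mult differentiable_sum differentiable_add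
        differentiable_diff d2 dW ballI finite)
  have "pd p (christ g k i j) x = (1/2) * (\<Sum>l\<in>UNIV. pd p (\<lambda>y. ginv g y $ k $ l) x *
      (pd i (\<lambda>y. g y $ j $ l) x + pd j (\<lambda>y. g y $ i $ l) x - pd l (\<lambda>y. g y $ i $ j) x) +
      ginv g x $ k $ l * (pd p (pd i (\<lambda>y. g y $ j $ l)) x
       + pd p (pd j (\<lambda>y. g y $ i $ l)) x - pd p (pd l (\<lambda>y. g y $ i $ j)) x))"
    unfolding christ_def[abs_def] pd_cmult[OF dd]
    by (simp add: pd_sum pd_mult pd_add pd_diff d d2 dW)
  then show "pd p (christ g k i j) x =
    dGamJ (\<lambda>k l. ginv g x $ k $ l) (\<lambda>p i j. pd p (\<lambda>y. g y $ i $ j) x) p k i j +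
    (1/2) * (\<Sum>l\<in>UNIV. ginv g x $ k $ l * (pd p (pd i (\<lambda>y. g y $ j $ l)) x
       + pd p (pd j (\<lambda>y. g y $ i $ l)) x - pd p (pd l (\<lambda>y. g y $ i $ j)) x))"
    unfolding pd_ginv[OF d nz] dGamJ_def
    by (simp only: sum.distrib distrib_left[of "1/2"])
  show "christ g k i j differentiable (at x)"
    unfolding christ_def[abs_def]
    by (intro differentiable_mult differentiable_const differentiable_sum differentiable_add
        differentiable_diff d d2 dW ballI finite)
qed

lemma scalar_curv_jet:
  fixes g :: "real^'n \<Rightarrow> real^'n^'n"
  assumes s: "\<And>i j. psmooth (\<lambda>_ x. g x $ i $ j)" and nz: "det (g x) \<noteq> 0"
  shows "scalar_curv g x = PrJ (\<lambda>k l. ginv g x $ k $ l) (\<lambda>p q i j. pd p (pd q (\<lambda>y. g y $ i $ j)) x)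
    + QJ (\<lambda>k l. ginv g x $ k $ l) (\<lambda>p i j. pd p (\<lambda>y. g y $ i $ j) x)"
  unfolding scalar_curv_def ricci_def pd_christ[OF assms] christ_eq_GamJ PrJ_def QJ_def
  by (simp only: sum.distrib[symmetric] distrib_left[symmetric])
     (intro sum.cong refl arg_cong2[where f="(*)"], simp add: algebra_simps)

section \<open>Local Lipschitz dependence of the scalar curvature on the jet\<close>

definition jnear :: "real \<Rightarrow> real \<Rightarrow> ('n::finite \<Rightarrow> 'n \<Rightarrow> real) \<Rightarrow> ('n \<Rightarrow> 'n \<Rightarrow> 'n \<Rightarrow> real) \<Rightarrow> ('n \<Rightarrow> 'n \<Rightarrow> 'n \<Rightarrow> 'n \<Rightarrow> real)
    \<Rightarrow> ('n \<Rightarrow> 'n \<Rightarrow> real) \<Rightarrow> ('n \<Rightarrow> 'n \<Rightarrow> 'n \<Rightarrow> real) \<Rightarrow> ('n \<Rightarrow> 'n \<Rightarrow> 'n \<Rightarrow> 'n \<Rightarrow> real) \<Rightarrow> bool" where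
  "jnear A d W B C W' B' C' \<longleftrightarrow> 0 \<le> d \<and>
    (\<forall>i j. \<bar>W i j\<bar> \<le> A \<and> \<bar>W' i j\<bar> \<le> A \<and> \<bar>W i j - W' i j\<bar> \<le> d) \<and>
    (\<forall>i j k. \<bar>B i j k\<bar> \<le> A \<and> \<bar>B' i j k\<bar> \<le> A \<and> \<bar>B i j k - B' i j k\<bar> \<le> d) \<and>
    (\<forall>i j k l. \<bar>C i j k l\<bar> \<le> A \<and> \<bar>C' i j k l\<bar> \<le> A \<and> \<bar>C i j k l - C' i j k l\<bar> \<le> d)"

text \<open>Boundedness and Lipschitz continuity on bounded sets of jets are combined because the
  product rule for Lipschitz constants needs the bounds; thus every polynomial in the jet qualifies
  by its structure alone.\<close>

definition lipJ where
  "lipJ f \<longleftrightarrow> (\<forall>A. \<exists>M\<ge>0. \<forall>W B C W' B' C' d. jnear A d W B C W' B' C' \<longrightarrow>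
     \<bar>f W B C\<bar> \<le> M \<and> \<bar>f W' B' C'\<bar> \<le> M \<and> \<bar>f W B C - f W' B' C'\<bar> \<le> M * d)"

lemma lipJ_I:
  assumes "\<And>A. \<exists>M\<ge>0. \<forall>W B C W' B' C' d. jnear A d W B C W' B' C' \<longrightarrow>
     \<bar>f W B C\<bar> \<le> M \<and> \<bar>f W' B' C'\<bar> \<le> M \<and> \<bar>f W B C - f W' B' C'\<bar> \<le> M * d"
  shows "lipJ f"
  using assms unfolding lipJ_def by blast

lemma lipJ_const: "lipJ (\<lambda>W B C. c)"
  by (rule lipJ_I, rule exI[of _ "\<bar>c\<bar>"]) (auto simp: jnear_def)

lemma lipJ_proj: "lipJ (\<lambda>W B C. W i j)" "lipJ (\<lambda>W B C. B p i j)" "lipJ (\<lambda>W B C. C p q i j)"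
proof -
  have *: "x \<le> A \<Longrightarrow> x \<le> max A 1" "0 \<le> d \<Longrightarrow> x \<le> d \<Longrightarrow> x \<le> max A 1 * d" for x d A :: real
    using mult_right_mono[of 1 "max A 1" d] by auto
  show "lipJ (\<lambda>W B C. W i j)" "lipJ (\<lambda>W B C. B p i j)" "lipJ (\<lambda>W B C. C p q i j)"
    by (rule lipJ_I, rule_tac x="max A 1" in exI, simp only: jnear_def, use * in simp)+
qed

lemma lipJ_add:
  assumes "lipJ f" "lipJ g"
  shows "lipJ (\<lambda>W B C. f W B C + g W B C)"
proof (rule lipJ_I)
  fix A
  from assms obtain M N where M: "M \<ge> 0" "\<And>W B C W' B' C' d. jnear A d W B C W' B' C' \<Longrightarrow>
     \<bar>f W B C\<bar> \<le> M \<and> \<bar>f W' B' C'\<bar> \<le> M \<and> \<bar>f W B C - f W' B' C'\<bar> \<le> M * d"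
    and N: "N \<ge> 0" "\<And>W B C W' B' C' d. jnear A d W B C W' B' C' \<Longrightarrow>
     \<bar>g W B C\<bar> \<le> N \<and> \<bar>g W' B' C'\<bar> \<le> N \<and> \<bar>g W B C - g W' B' C'\<bar> \<le> N * d"
    unfolding lipJ_def by meson
  show "\<exists>M\<ge>0. \<forall>W B C W' B' C' d. jnear A d W B C W' B' C' \<longrightarrow>
     \<bar>f W B C + g W B C\<bar> \<le> M \<and> \<bar>f W' B' C' + g W' B' C'\<bar> \<le> M \<and>
     \<bar>f W B C + g W B C - (f W' B' C' + g W' B' C')\<bar> \<le> M * d"
  proof (intro exI[of _ "M + N"] conjI allI impI, goal_cases)
    case 1
    then show ?case using M(1) N(1) by simp
  qed (use M(2) N(2) in \<open>(fastforce simp: distrib_right)+\<close>)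
qed

lemma lipJ_mult:
  assumes "lipJ f" "lipJ g"
  shows "lipJ (\<lambda>W B C. f W B C * g W B C)"
proof (rule lipJ_I)
  fix A
  from assms obtain M N where M: "M \<ge> 0" "\<And>W B C W' B' C' d. jnear A d W B C W' B' C' \<Longrightarrow>
     \<bar>f W B C\<bar> \<le> M \<and> \<bar>f W' B' C'\<bar> \<le> M \<and> \<bar>f W B C - f W' B' C'\<bar> \<le> M * d"
    and N: "N \<ge> 0" "\<And>W B C W' B' C' d. jnear A d W B C W' B' C' \<Longrightarrow>
     \<bar>g W B C\<bar> \<le> N \<and> \<bar>g W' B' C'\<bar> \<le> N \<and> \<bar>g W B C - g W' B' C'\<bar> \<le> N * d"
    unfolding lipJ_def by meson
  show "\<exists>M\<ge>0. \<forall>W B C W' B' C' d. jnear A d W B C W' B' C' \<longrightarrow>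
     \<bar>f W B C * g W B C\<bar> \<le> M \<and> \<bar>f W' B' C' * g W' B' C'\<bar> \<le> M \<and>
     \<bar>f W B C * g W B C - (f W' B' C' * g W' B' C')\<bar> \<le> M * d"
  proof (intro exI[of _ "2 * (M * N)"] conjI allI impI, goal_cases)
    case 1
    then show ?case using M(1) N(1) by simp
  next
    case (2 W B C W' B' C' d)
    have "\<bar>f W B C * g W B C\<bar> \<le> M * N"
      unfolding abs_mult using M N 2 by (intro mult_mono) auto
    then show ?case using M(1) N(1) mult_nonneg_nonneg[of M N] by linarith
  next
    case (3 W B C W' B' C' d)
    have "\<bar>f W' B' C' * g W' B' C'\<bar> \<le> M * N"
      unfolding abs_mult using M N 3 by (intro mult_mono) auto
    then show ?case using M(1) N(1) mult_nonneg_nonneg[of M N] by linarith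
  next
    case (4 W B C W' B' C' d)
    have "\<bar>f W B C * g W B C - f W' B' C' * g W' B' C'\<bar> =
        \<bar>f W B C * (g W B C - g W' B' C') + (f W B C - f W' B' C') * g W' B' C'\<bar>"
      by (simp add: algebra_simps)
    also have "\<dots> \<le> \<bar>f W B C\<bar> * \<bar>g W B C - g W' B' C'\<bar> + \<bar>f W B C - f W' B' C'\<bar> * \<bar>g W' B' C'\<bar>"
      by (rule order_trans[OF abs_triangle_ineq]) (simp add: abs_mult)
    also have "\<dots> \<le> M * (N * d) + (M * d) * N"
      using M(1) N(1) M(2)[OF 4] N(2)[OF 4] 4
      by (intro add_mono mult_mono) (auto simp: jnear_def)
    finally show ?case by (simp add: algebra_simps)
  qed
qed

lemma lipJ_sum:
  "(\<And>a. a \<in> S \<Longrightarrow> lipJ (f a)) \<Longrightarrow> lipJ (\<lambda>W B C. \<Sum>a\<in>S. f a W B C)"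
  by (induction S rule: infinite_finite_induct) (auto intro: lipJ_const lipJ_add)

lemma lipJ_diff:
  assumes "lipJ f" "lipJ g"
  shows "lipJ (\<lambda>W B C. f W B C - g W B C)"
  using lipJ_add[OF assms(1) lipJ_mult[OF lipJ_const[of "-1"] assms(2)]] by simp

lemmas lipJ_intros = lipJ_const lipJ_proj lipJ_add lipJ_diff lipJ_mult lipJ_sum

lemma lipJ_scalar: "lipJ (\<lambda>W B C. PrJ W C + QJ W B)"
  unfolding PrJ_def QJ_def GamJ_def dGamJ_def by (intro lipJ_intros)

text \<open>Linearity in the second derivatives allows the large second derivatives of the layer to
  be split off exactly instead of being estimated.\<close>

lemma PrJ_add: "PrJ W (\<lambda>p q i j. C p q i j + e * D p q i j) = PrJ W C + e * PrJ W D"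
  unfolding PrJ_def sum_distrib_left
  by (simp only: sum.distrib[symmetric] sum_subtractf[symmetric])
     (intro sum.cong refl, simp add: algebra_simps sum.distrib sum_distrib_left sum_subtractf)

subsection \<open>Pullbacks of the round metric\<close>

lemma sum_option_UNIV:
  fixes h :: "'n::finite option \<Rightarrow> real"
  shows "(\<Sum>s\<in>UNIV. h s) = h None + (\<Sum>k\<in>UNIV. h (Some k))"
  by (simp add: UNIV_option_conv sum.reindex)

text \<open>A map \<open>F\<close> into the unit sphere of codimension one: the Gauss formula
  \<open>\<partial>\<^sub>i\<partial>\<^sub>jF = \<Gamma>\<^sup>k\<^sub>i\<^sub>j\<partial>\<^sub>kF - g\<^sub>i\<^sub>jF\<close> and the symmetry of third derivatives give the Gauss equation.\<close>

locale sphere_map =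
  fixes F :: "'n::finite option \<Rightarrow> real^'n \<Rightarrow> real" and g :: "real^'n \<Rightarrow> real^'n^'n"
  assumes sm: "\<And>a. psmooth (\<lambda>_. F a)"
    and sph: "\<And>x. (\<Sum>a\<in>UNIV. F a x * F a x) = 1"
    and g: "\<And>x i j. g x $ i $ j = (\<Sum>a\<in>UNIV. pd i (F a) x * pd j (F a) x)"
begin

lemma dF: "F a differentiable (at x)"
  using psmooth_diff[OF sm] .

lemma dF1: "pd i (F a) differentiable (at x)"
  using psmooth_diff[OF psmooth_pd[OF sm]] .

lemma comm: "pd i (pd j (F a)) = pd j (pd i (F a))"
  using psmooth_comm[OF sm] .

lemma third_comm: "pd k (pd i (pd j (F a))) = pd j (pd i (pd k (F a)))"
  using psmooth_comm[OF psmooth_pd[OF sm], of k j i a] comm by metis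

lemma smg: "psmooth (\<lambda>_ x. g x $ i $ j)"
  unfolding g by (intro psmooth_sum psmooth_mult psmooth_pd sm)

lemma dg: "(\<lambda>x. g x $ i $ j) differentiable (at x)"
  using psmooth_diff[OF smg] .

lemma g_sym: "g x $ i $ j = g x $ j $ i"
  unfolding g by (simp add: mult.commute)

lemma F_orth: "(\<Sum>a\<in>UNIV. F a x * pd i (F a) x) = 0"
proof -
  have "pd i (\<lambda>x. \<Sum>a\<in>UNIV. F a x * F a x) x = 0"
    unfolding sph by simp
  then have "(\<Sum>a\<in>UNIV. 2 * (F a x * pd i (F a) x)) = 0"
    by (simp add: pd_sum pd_mult dF algebra_simps)
  then show ?thesis by (simp flip: sum_distrib_left)
qed

lemma F_second: "(\<Sum>a\<in>UNIV. F a x * pd i (pd j (F a)) x) = - g x $ i $ j"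
proof -
  have "pd i (\<lambda>x. \<Sum>a\<in>UNIV. F a x * pd j (F a) x) x = 0"
    unfolding F_orth by simp
  then show ?thesis
    by (simp add: pd_sum pd_mult dF dF1 g sum.distrib)
qed

lemma pd_g: "pd l (\<lambda>x. g x $ i $ j) x =
    (\<Sum>a\<in>UNIV. pd l (pd i (F a)) x * pd j (F a) x + pd i (F a) x * pd l (pd j (F a)) x)"
  unfolding g by (simp add: pd_sum pd_mult dF1)

lemma first_kind:
  "pd i (\<lambda>y. g y $ j $ l) x + pd j (\<lambda>y. g y $ i $ l) x - pd l (\<lambda>y. g y $ i $ j) x =
     2 * (\<Sum>a\<in>UNIV. pd l (F a) x * pd i (pd j (F a)) x)"
  unfolding pd_g sum_distrib_left sum.distrib[symmetric] sum_subtractf[symmetric]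
  by (intro sum.cong refl) (simp add: comm[of l] comm[of j i] algebra_simps)

text \<open>The frame dual to the tangent vectors \<open>pd k F\<close>, obtained by raising the
  index with the inverse metric.\<close>

definition U where "U c a x = (\<Sum>q\<in>UNIV. ginv g x $ c $ q * pd q (F a) x)"

lemma christ_U: "christ g k i j x = (\<Sum>a\<in>UNIV. U k a x * pd i (pd j (F a)) x)"
proof -
  have "christ g k i j x = (\<Sum>l\<in>UNIV. \<Sum>a\<in>UNIV. ginv g x $ k $ l * (pd l (F a) x * pd i (pd j (F a)) x))"
    unfolding christ_def first_kind by (simp add: sum_distrib_left mult.left_commute)
  also have "\<dots> = (\<Sum>a\<in>UNIV. U k a x * pd i (pd j (F a)) x)"
    unfolding U_def by (subst sum.swap) (simp add: sum_distrib_right mult.assoc)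
  finally show ?thesis .
qed

lemma U_F: "(\<Sum>a\<in>UNIV. U c a x * F a x) = 0"
proof -
  have "(\<Sum>a\<in>UNIV. U c a x * F a x) = (\<Sum>q\<in>UNIV. ginv g x $ c $ q * (\<Sum>a\<in>UNIV. F a x * pd q (F a) x))"
    unfolding U_def sum_distrib_left sum_distrib_right
    by (subst sum.swap) (simp add: mult_ac)
  then show ?thesis by (simp add: F_orth)
qed

lemma U_dF:
  assumes "det (g x) \<noteq> 0"
  shows "(\<Sum>a\<in>UNIV. U c a x * pd l (F a) x) = (if c = l then 1 else 0)"
proof -
  have "(\<Sum>a\<in>UNIV. U c a x * pd l (F a) x) = (\<Sum>q\<in>UNIV. ginv g x $ c $ q * g x $ q $ l)"
    unfolding U_def g sum_distrib_left sum_distrib_right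
    by (subst sum.swap) (simp add: mult_ac)
  then show ?thesis by (simp add: ginv_def matrix_inv_left_entry[OF assms])
qed

text \<open>Where \<open>g\<close> is invertible, \<open>F\<close> and the \<open>pd k F\<close>
  form a basis whose dual basis is \<open>F\<close> and the \<open>U k\<close>. Duality says that
  one square matrix is a left inverse of another, so it is also a right inverse. Squareness is the
  codimension one hypothesis: the index type of the target has exactly one additional
  element.\<close>

lemma completeness:
  assumes "det (g x) \<noteq> 0"
  shows "F a x * F b x + (\<Sum>k\<in>UNIV. pd k (F a) x * U k b x) = (if a = b then 1 else 0)"
proof -
  define M :: "real^'n option^'n option"
    where "M = (\<chi> r a. case r of None \<Rightarrow> F a x | Some k \<Rightarrow> pd k (F a) x)"
  define E :: "real^'n option^'n option"
    where "E = (\<chi> r a. case r of None \<Rightarrow> F a x | Some k \<Rightarrow> U k a x)"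
  have "(E ** transpose M) $ r $ s = mat 1 $ r $ s" for r s
    using sph[of x] F_orth[of x] U_F[of _ x] U_dF[OF assms]
    by (cases r; cases s) (simp_all add: matrix_matrix_mult_def transpose_def M_def E_def mat_def)
  then have "E ** transpose M = mat 1" by (simp add: vec_eq_iff)
  then have "transpose M ** E = mat 1" using matrix_left_right_inverse by blast
  then have "(transpose M ** E) $ a $ b = (if a = b then 1 else 0)" by (simp add: mat_def)
  then show ?thesis
    by (simp add: matrix_matrix_mult_def transpose_def M_def E_def sum_option_UNIV)
qed

lemma gauss_formula:
  assumes "det (g x) \<noteq> 0"
  shows "pd i (pd j (F a)) x = (\<Sum>k\<in>UNIV. christ g k i j x * pd k (F a) x) - g x $ i $ j * F a x"
proof -
  have "pd i (pd j (F a)) x = (\<Sum>b\<in>UNIV. (if a = b then 1 else 0) * pd i (pd j (F b)) x)"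
    by (simp add: sum_delta_mult)
  also have "\<dots> = (\<Sum>b\<in>UNIV. F a x * (F b x * pd i (pd j (F b)) x) +
      (\<Sum>k\<in>UNIV. pd k (F a) x * (U k b x * pd i (pd j (F b)) x)))"
    unfolding completeness[OF assms, symmetric] by (simp add: distrib_right sum_distrib_right mult.assoc)
  also have "\<dots> = F a x * (\<Sum>b\<in>UNIV. F b x * pd i (pd j (F b)) x) +
      (\<Sum>k\<in>UNIV. pd k (F a) x * (\<Sum>b\<in>UNIV. U k b x * pd i (pd j (F b)) x))"
    unfolding sum.distrib sum_distrib_left by (subst (2) sum.swap) simp
  also have "\<dots> = (\<Sum>k\<in>UNIV. christ g k i j x * pd k (F a) x) - g x $ i $ j * F a x"
    unfolding F_second christ_U by (simp add: mult.commute)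
  finally show ?thesis .
qed

lemma third_derivative:
  assumes nz: "det (g x) \<noteq> 0"
  shows "pd k (pd i (pd j (F a))) x =
    (\<Sum>l\<in>UNIV. pd k (christ g l i j) x * pd l (F a) x + christ g l i j x * pd k (pd l (F a)) x)
    - (pd k (\<lambda>x. g x $ i $ j) x * F a x + g x $ i $ j * pd k (F a) x)"
proof -
  note dc = differentiable_christ[OF smg nz]
  have ds: "(\<lambda>x. \<Sum>l\<in>UNIV. christ g l i j x * pd l (F a) x) differentiable (at x)"
    by (intro differentiable_sum ballI differentiable_mult dF1 dc finite)
  have dm: "(\<lambda>x. g x $ i $ j * F a x) differentiable (at x)"
    by (intro differentiable_mult dg dF)
  have "pd k (pd i (pd j (F a))) x =
      pd k (\<lambda>x. (\<Sum>l\<in>UNIV. christ g l i j x * pd l (F a) x) - g x $ i $ j * F a x) x"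
    using nz by (intro pd_cong_open[of "{y. det (g y) \<noteq> 0}"] open_det_nz
        differentiable_imp_continuous_within dg) (auto simp: gauss_formula)
  then show ?thesis
    by (simp add: pd_diff ds dm pd_sum pd_mult dc dF1 dg dF)
qed

text \<open>Pairing the differentiated Gauss formula with the dual frame removes the multiple of
  \<open>F\<close> and leaves exactly the Christoffel terms of one half of the curvature
  tensor.\<close>

lemma U_third_derivative:
  assumes nz: "det (g x) \<noteq> 0"
  shows "(\<Sum>a\<in>UNIV. U c a x * pd k (pd i (pd j (F a))) x) =
    pd k (christ g c i j) x + (\<Sum>l\<in>UNIV. christ g l i j x * christ g c k l x) - g x $ i $ j * (if c = k then 1 else 0)"
proof -
  have "(\<Sum>a\<in>UNIV. U c a x * pd k (pd i (pd j (F a))) x) =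
      (\<Sum>l\<in>UNIV. pd k (christ g l i j) x * (\<Sum>a\<in>UNIV. U c a x * pd l (F a) x))
      + (\<Sum>l\<in>UNIV. christ g l i j x * (\<Sum>a\<in>UNIV. U c a x * pd k (pd l (F a)) x))
      - pd k (\<lambda>x. g x $ i $ j) x * (\<Sum>a\<in>UNIV. U c a x * F a x)
      - g x $ i $ j * (\<Sum>a\<in>UNIV. U c a x * pd k (F a) x)"
    unfolding third_derivative[OF nz] right_diff_distrib distrib_left sum_subtractf sum.distrib
    unfolding sum_distrib_left
    by (subst (2 3) sum.swap) (simp add: mult_ac)
  also have "\<dots> = pd k (christ g c i j) x + (\<Sum>l\<in>UNIV. christ g l i j x * christ g c k l x)
      - g x $ i $ j * (if c = k then 1 else 0)"
    unfolding U_F U_dF[OF nz] christ_U[symmetric] by (simp add: if_distrib cong: if_cong)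
  finally show ?thesis .
qed

text \<open>The two halves of the Ricci formula belong to third derivatives of \<open>F\<close> with
  outermost and innermost index exchanged. These agree by \<open>third_comm\<close>, so only the
  metric terms of \<open>U_third_derivative\<close> remain.\<close>

lemma ricci_eq:
  assumes nz: "det (g x) \<noteq> 0"
  shows "ricci g i j x = (real CARD('n) - 1) * g x $ i $ j"
proof -
  have "ricci g i j x = (\<Sum>k\<in>UNIV.
     (pd k (christ g k i j) x + (\<Sum>l\<in>UNIV. christ g l i j x * christ g k k l x))
     - (pd j (christ g k i k) x + (\<Sum>l\<in>UNIV. christ g l i k x * christ g k j l x)))"
    unfolding ricci_def by (intro sum.cong refl) (simp add: sum_subtractf mult.commute)
  also have "\<dots> = (\<Sum>k\<in>UNIV. g x $ i $ j - g x $ i $ k * (if k = j then 1 else 0))"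
  proof (intro sum.cong refl)
    fix k
    have "(\<Sum>a\<in>UNIV. U k a x * pd k (pd i (pd j (F a))) x) = (\<Sum>a\<in>UNIV. U k a x * pd j (pd i (pd k (F a))) x)"
      by (intro sum.cong refl, subst third_comm, rule refl)
    then show "(pd k (christ g k i j) x + (\<Sum>l\<in>UNIV. christ g l i j x * christ g k k l x))
     - (pd j (christ g k i k) x + (\<Sum>l\<in>UNIV. christ g l i k x * christ g k j l x)) =
      g x $ i $ j - g x $ i $ k * (if k = j then 1 else 0)"
      unfolding U_third_derivative[OF nz] by simp
  qed
  also have "\<dots> = (real CARD('n) - 1) * g x $ i $ j"
    by (simp add: sum_subtractf sum_delta_mult left_diff_distrib del: mult_if_delta mult.right_neutral mult_zero_right)
  finally show ?thesis .
qed

lemma scalar_curv_eq: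
  assumes nz: "det (g x) \<noteq> 0"
  shows "scalar_curv g x = real CARD('n) * (real CARD('n) - 1)"
proof -
  have "scalar_curv g x = (\<Sum>i\<in>UNIV. (real CARD('n) - 1) * (\<Sum>j\<in>UNIV. matrix_inv (g x) $ i $ j * g x $ j $ i))"
    unfolding scalar_curv_def ricci_eq[OF nz] sum_distrib_left ginv_def
    by (intro sum.cong refl) (simp add: g_sym[of x])
  then show ?thesis by (simp add: matrix_inv_left_entry[OF nz])
qed

end

subsection \<open>Mean curvature of the unit sphere\<close>

lemma sum_square_eq_1:
  fixes x :: "real^'n"
  assumes "norm x = 1"
  shows "(\<Sum>i\<in>UNIV. x $ i * x $ i) = 1"
  using assms by (simp add: norm_eq_1 inner_vec_def)

text \<open>The gradient of a function vanishing on the sphere is radial: its derivative along great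
  circles through \<open>x\<close> is zero.\<close>

lemma pd_vanishing_on_sphere:
  fixes f :: "real^'n \<Rightarrow> real"
  assumes d: "f differentiable (at x)" and z: "\<And>y. norm y = 1 \<Longrightarrow> f y = 0" and x: "norm x = 1"
  shows "pd i f x = x $ i * (\<Sum>l\<in>UNIV. x $ l * pd l f x)"
proof -
  have tang: "(\<Sum>i\<in>UNIV. v $ i * pd i f x) = 0" if v: "norm v = 1" "x \<bullet> v = 0" for v
  proof -
    define c where "c = (\<lambda>s. cos s *\<^sub>R x + sin s *\<^sub>R v)"
    have "norm (c s) = 1" for s
    proof -
      have "(norm (c s))\<^sup>2 = (cos s)\<^sup>2 * (x \<bullet> x) + (sin s)\<^sup>2 * (v \<bullet> v) + 2 * cos s * sin s * (x \<bullet> v)"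
        unfolding c_def power2_norm_eq_inner
        by (simp add: inner_add_left inner_add_right inner_commute power2_eq_square algebra_simps)
      also have "\<dots> = 1" using x v by (simp add: norm_eq_1)
      finally show ?thesis using norm_ge_zero[of "c s"] by (auto simp: power2_eq_1_iff)
    qed
    then have "f (c s) = 0" for s by (rule z)
    moreover have "(c has_vector_derivative v) (at 0)"
      unfolding c_def by (auto intro!: derivative_eq_intros)
    from pd_chain_curve[OF _ this, of f] have
      "((\<lambda>s. f (c s)) has_real_derivative (\<Sum>i\<in>UNIV. v $ i * pd i f x)) (at 0)"
      using d by (simp add: c_def)
    ultimately show ?thesis using DERIV_unique[of "\<lambda>_. 0" _ 0 0] by simp
  qed
  \<comment> \<open>The tangential part of the coordinate vector; scaled to length one it is the
    velocity of a great circle.\<close>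
  define w where "w = axis i 1 - x $ i *\<^sub>R x"
  have xw: "x \<bullet> w = 0"
    using x by (simp add: w_def inner_diff_right inner_axis norm_eq_1)
  have "(\<Sum>j\<in>UNIV. w $ j * pd j f x) = 0"
  proof (cases "w = 0")
    case False
    then have "(\<Sum>j\<in>UNIV. (w /\<^sub>R norm w) $ j * pd j f x) = 0"
      using xw by (intro tang) auto
    then have "inverse (norm w) * (\<Sum>j\<in>UNIV. w $ j * pd j f x) = 0"
      by (simp add: sum_distrib_left mult.assoc)
    then show ?thesis using False by simp
  qed simp
  moreover have "(\<Sum>j\<in>UNIV. w $ j * pd j f x) = pd i f x - x $ i * (\<Sum>l\<in>UNIV. x $ l * pd l f x)"
  proof -
    have "w $ j = (if j = i then 1 else 0) - x $ i * x $ j" for j by (simp add: w_def axis_def)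
    then have "(\<Sum>j\<in>UNIV. w $ j * pd j f x) = (\<Sum>j\<in>UNIV. (if j = i then 1 else 0) * pd j f x)
        - (\<Sum>j\<in>UNIV. x $ i * (x $ j * pd j f x))"
      by (simp only: left_diff_distrib sum_subtractf mult.assoc)
    then show ?thesis by (simp only: sum_delta_mult sum_distrib_left)
  qed
  ultimately show ?thesis by simp
qed

lemma radial_derivative:
  fixes f :: "real^'n \<Rightarrow> real"
  assumes "f differentiable (at x)"
  shows "((\<lambda>s. f (s *\<^sub>R x)) has_real_derivative (\<Sum>l\<in>UNIV. x $ l * pd l f x)) (at 1)"
proof -
  have "((\<lambda>s. s *\<^sub>R x) has_vector_derivative x) (at 1)"
    by (auto intro!: derivative_eq_intros)
  from pd_chain_curve[OF _ this, of f] assms show ?thesis by simp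
qed

text \<open>Since the metric is Euclidean along the sphere, the mean curvature is the Euclidean
  value plus half the tangential trace of the normal derivative of \<open>g\<close>. The two
  remaining Christoffel terms exchange their roles under transposition and cancel in the symmetric
  trace.\<close>

lemma mean_curv_unit_sphere:
  fixes g :: "real^'n \<Rightarrow> real^'n^'n"
  assumes s: "\<And>i j. psmooth (\<lambda>_ x. g x $ i $ j)"
    and sym: "\<And>y i j. g y $ i $ j = g y $ j $ i"
    and one: "\<And>y. norm y = 1 \<Longrightarrow> g y = mat 1"
    and x: "norm x = 1"
  shows "mean_curv g x = real CARD('n) - 1 + (1/2) * (\<Sum>i\<in>UNIV. \<Sum>k\<in>UNIV.
     ((if i = k then 1 else 0) - x $ i * x $ k) * (\<Sum>l\<in>UNIV. x $ l * pd l (\<lambda>y. g y $ i $ k) x))"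
proof -
  note d = psmooth_diff[OF s]
  have gi: "ginv g y = mat 1" if "norm y = 1" for y
    unfolding ginv_def one[OF that] by (rule matrix_inv_unique_left(2)) simp
  have nz: "det (g x) \<noteq> 0" by (simp add: one[OF x])
  have dW: "(\<lambda>y. ginv g y $ a $ b) differentiable (at x)" for a b
    unfolding ginv_def by (intro differentiable_matrix_inv d nz)
  note sq = sum_square_eq_1
  let ?S = "\<lambda>y. \<Sum>a\<in>UNIV. \<Sum>b\<in>UNIV. ginv g y $ a $ b * (2 * y $ a) * (2 * y $ b)"
  have Ssum: "?S y = 4" if "norm y = 1" for y
  proof -
    have "?S y = (\<Sum>a\<in>UNIV. \<Sum>b\<in>UNIV. (if a = b then 1 else 0) * (4 * (y $ a * y $ b)))"
      unfolding gi[OF that] by (intro sum.cong refl) (simp add: mat_def)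
    also have "\<dots> = 4 * (\<Sum>a\<in>UNIV. y $ a * y $ a)"
      unfolding sum_delta_mult by (simp add: sum_distrib_left)
    finally show ?thesis by (simp add: sq[OF that])
  qed
  have nu: "unit_normal g k y = y $ k" if "norm y = 1" for k y
  proof -
    have "(\<Sum>j\<in>UNIV. ginv g y $ k $ j * (2 * y $ j)) = 2 * y $ k"
      unfolding gi[OF that] by (simp add: mat_def sum_delta_mult)
    then show ?thesis unfolding unit_normal_def Ssum[OF that] by simp
  qed
  have dS: "?S differentiable (at x)"
    by (intro differentiable_sum ballI differentiable_mult differentiable_const differentiable_coord dW finite)
  have dnu: "unit_normal g k differentiable (at x)" for k
  proof -
    have "(\<lambda>y. sqrt (?S y)) differentiable (at x)"
      using has_derivative_real_sqrt[OF _ differentiable_derivI[OF dS]] Ssum[OF x]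
      by (auto simp: differentiable_def)
    moreover have "(\<lambda>y. \<Sum>j\<in>UNIV. ginv g y $ k $ j * (2 * y $ j)) differentiable (at x)"
      by (intro differentiable_sum ballI differentiable_mult differentiable_const differentiable_coord dW finite)
    ultimately show ?thesis
      unfolding unit_normal_def[abs_def] using Ssum[OF x] by (intro differentiable_divide) auto
  qed
  \<comment> \<open>The normal field equals \<open>x\<close> on the sphere, so by
    \<open>pd_vanishing_on_sphere\<close> its derivative differs from the Euclidean one by a term
    \<open>x $ i * r k\<close>. The tangential projector kills this term, so \<open>r\<close> never
    has to be computed.\<close>
  define r where "r k = (\<Sum>l\<in>UNIV. x $ l * pd l (\<lambda>y. unit_normal g k y - y $ k) x)" for k
  have pnu: "pd i (unit_normal g k) x = (if i = k then 1 else 0) + x $ i * r k" for i k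
  proof -
    have "pd i (\<lambda>y. unit_normal g k y - y $ k) x = x $ i * r k"
      unfolding r_def by (rule pd_vanishing_on_sphere)
        (auto simp: nu x intro!: differentiable_diff dnu differentiable_coord)
    then show ?thesis by (simp add: pd_diff dnu differentiable_coord pd_coord)
  qed
  let ?P = "\<lambda>i k. (if i = k then 1 else 0) - x $ i * x $ k"
  let ?B = "\<lambda>p i j. pd p (\<lambda>y. g y $ i $ j) x"
  have Pi: "(\<Sum>i\<in>UNIV. ?P i k * x $ i) = 0" for k
  proof -
    have "(\<Sum>i\<in>UNIV. ?P i k * x $ i) = (\<Sum>i\<in>UNIV. (if i = k then 1 else 0) * x $ i)
        - x $ k * (\<Sum>i\<in>UNIV. x $ i * x $ i)"
      unfolding sum_distrib_left sum_subtractf[symmetric]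
      by (intro sum.cong refl) (simp add: left_diff_distrib)
    then show ?thesis by (simp only: sum_delta_mult sq[OF x])
  qed
  have "mean_curv g x = (\<Sum>i\<in>UNIV. \<Sum>j\<in>UNIV. \<Sum>k\<in>UNIV. (if j = k then 1 else 0) *
      (?P i j * (pd i (unit_normal g k) x + (\<Sum>l\<in>UNIV. christ g k i l x * x $ l))))"
    unfolding mean_curv_def nu[OF x] gi[OF x] one[OF x]
    by (intro sum.cong refl) (simp add: mat_def)
  also have "\<dots> = (\<Sum>i\<in>UNIV. \<Sum>k\<in>UNIV. ?P i k * (pd i (unit_normal g k) x + (\<Sum>l\<in>UNIV. christ g k i l x * x $ l)))"
    unfolding sum_delta_mult ..
  also have "\<dots> = (\<Sum>i\<in>UNIV. \<Sum>k\<in>UNIV. ?P i k * (if i = k then 1 else 0))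
      + (\<Sum>k\<in>UNIV. (\<Sum>i\<in>UNIV. ?P i k * x $ i) * r k)
      + (\<Sum>i\<in>UNIV. \<Sum>k\<in>UNIV. ?P i k * (\<Sum>l\<in>UNIV. christ g k i l x * x $ l))"
    unfolding pnu sum_distrib_right
    by (subst (3) sum.swap) (simp add: distrib_left sum.distrib mult.assoc)
  also have "(\<Sum>i\<in>UNIV. \<Sum>k\<in>UNIV. ?P i k * (if i = k then 1 else 0)) = real CARD('n) - 1"
    unfolding sum_delta_mult using sq[OF x] by (simp add: sum_subtractf)
  also have "(\<Sum>i\<in>UNIV. \<Sum>k\<in>UNIV. ?P i k * (\<Sum>l\<in>UNIV. christ g k i l x * x $ l)) =
      (1/2) * (\<Sum>i\<in>UNIV. \<Sum>k\<in>UNIV. ?P i k * (\<Sum>l\<in>UNIV. x $ l * ?B l i k))"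
  proof -
    have ch: "christ g k i l x = (1/2) * (?B i l k + ?B l i k - ?B k i l)" for k i l
      unfolding christ_def gi[OF x] by (simp add: mat_def sum_delta_mult)
    have "(\<Sum>i\<in>UNIV. \<Sum>k\<in>UNIV. ?P i k * (\<Sum>l\<in>UNIV. christ g k i l x * x $ l)) =
      (1/2) * (\<Sum>i\<in>UNIV. \<Sum>k\<in>UNIV. ?P i k * (\<Sum>l\<in>UNIV. x $ l * ?B l i k)) +
      (1/2) * ((\<Sum>i\<in>UNIV. \<Sum>k\<in>UNIV. ?P i k * (\<Sum>l\<in>UNIV. x $ l * ?B i l k))
        - (\<Sum>i\<in>UNIV. \<Sum>k\<in>UNIV. ?P i k * (\<Sum>l\<in>UNIV. x $ l * ?B k i l)))"
      unfolding ch sum_distrib_left sum.distrib[symmetric] sum_subtractf[symmetric]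
      by (intro sum.cong refl) algebra
    moreover have "(\<Sum>i\<in>UNIV. \<Sum>k\<in>UNIV. ?P i k * (\<Sum>l\<in>UNIV. x $ l * ?B k i l)) =
      (\<Sum>i\<in>UNIV. \<Sum>k\<in>UNIV. ?P i k * (\<Sum>l\<in>UNIV. x $ l * ?B i l k))"
    proof -
      have "(\<lambda>y. g y $ l $ k) = (\<lambda>y. g y $ k $ l)" for l k using sym by auto
      then have B: "?B i l k = ?B i k l" for i l k by metis
      show ?thesis
        by (subst sum.swap, intro sum.cong refl arg_cong2[where f="(*)"]) (auto simp: B mult.commute)
    qed
    ultimately show ?thesis by simp
  qed
  finally show ?thesis by (simp add: Pi)
qed

subsection \<open>Second order Taylor expansion in the parameter\<close>

text \<open>An algebraic Taylor formula: \<open>psmooth\<close> requires only continuity in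
  \<open>t\<close>, so no derivative in \<open>t\<close> is ever taken. The remainder is again
  \<open>psmooth\<close>, which keeps its spatial derivatives under control near
  \<open>t = 0\<close>.\<close>

definition tay where
  "tay f f0 f1 f2 \<longleftrightarrow> psmooth (\<lambda>_. f0) \<and> psmooth (\<lambda>_. f1) \<and> psmooth (\<lambda>_. f2) \<and>
    (\<exists>r. psmooth r \<and> (\<forall>t x. f t x = f0 x + t * f1 x + t\<^sup>2 * f2 x + t ^ 3 * r t x))"

lemma tayI:
  assumes "psmooth (\<lambda>_. f0)" "psmooth (\<lambda>_. f1)" "psmooth (\<lambda>_. f2)" "psmooth r"
    "\<And>t x. f t x = f0 x + t * f1 x + t\<^sup>2 * f2 x + t ^ 3 * r t x"
  shows "tay f f0 f1 f2"
  using assms unfolding tay_def by blast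

lemma tay_quadratic:
  assumes "psmooth (\<lambda>_. f0)" "psmooth (\<lambda>_. f1)" "psmooth (\<lambda>_. f2)"
  shows "tay (\<lambda>t x. f0 x + t * f1 x + t\<^sup>2 * f2 x) f0 f1 f2"
  by (rule tayI[OF assms psmooth_const[of 0]]) simp

lemma tay_const: "tay (\<lambda>t x. c) (\<lambda>x. c) (\<lambda>x. 0) (\<lambda>x. 0)"
  by (rule tayI[OF psmooth_const psmooth_const psmooth_const psmooth_const[of 0]]) simp

lemma tay_add:
  assumes "tay f f0 f1 f2" "tay g g0 g1 g2"
  shows "tay (\<lambda>t x. f t x + g t x) (\<lambda>x. f0 x + g0 x) (\<lambda>x. f1 x + g1 x) (\<lambda>x. f2 x + g2 x)"
proof -
  from assms obtain r s where r: "psmooth r" "\<And>t x. f t x = f0 x + t * f1 x + t\<^sup>2 * f2 x + t ^ 3 * r t x"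
    and s: "psmooth s" "\<And>t x. g t x = g0 x + t * g1 x + t\<^sup>2 * g2 x + t ^ 3 * s t x"
    and sm: "psmooth (\<lambda>_. f0)" "psmooth (\<lambda>_. f1)" "psmooth (\<lambda>_. f2)"
      "psmooth (\<lambda>_. g0)" "psmooth (\<lambda>_. g1)" "psmooth (\<lambda>_. g2)"
    unfolding tay_def by blast
  show ?thesis
    by (rule tayI[where r="\<lambda>t x. r t x + s t x"])
       (auto intro!: psmooth_add r(1) s(1) sm simp: r(2) s(2) algebra_simps)
qed

lemma tay_mult:
  assumes "tay f f0 f1 f2" "tay g g0 g1 g2"
  shows "tay (\<lambda>t x. f t x * g t x) (\<lambda>x. f0 x * g0 x) (\<lambda>x. f0 x * g1 x + f1 x * g0 x)
    (\<lambda>x. f0 x * g2 x + f1 x * g1 x + f2 x * g0 x)"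
proof -
  from assms obtain r s where r: "psmooth r" "\<And>t x. f t x = f0 x + t * f1 x + t\<^sup>2 * f2 x + t ^ 3 * r t x"
    and s: "psmooth s" "\<And>t x. g t x = g0 x + t * g1 x + t\<^sup>2 * g2 x + t ^ 3 * s t x"
    and sm: "psmooth (\<lambda>_. f0)" "psmooth (\<lambda>_. f1)" "psmooth (\<lambda>_. f2)"
      "psmooth (\<lambda>_. g0)" "psmooth (\<lambda>_. g1)" "psmooth (\<lambda>_. g2)"
    unfolding tay_def by blast
  show ?thesis
  proof (rule tayI[where r="\<lambda>t x. f0 x * s t x + f1 x * g2 x + f2 x * g1 x + r t x * g0 x
      + t * (f1 x * s t x + f2 x * g2 x + r t x * g1 x) + t\<^sup>2 * (f2 x * s t x + r t x * g2 x)
      + t ^ 3 * (r t x * s t x)"], goal_cases)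
    case (5 t x)
    show ?case unfolding r(2) s(2) by algebra
  qed (intro psmooth_intros r(1) s(1) sm)+
qed

lemma tay_inverse:
  assumes "tay f f0 f1 f2" and nz: "\<And>t x. f t x \<noteq> 0"
  shows "tay (\<lambda>t x. inverse (f t x)) (\<lambda>x. inverse (f0 x)) (\<lambda>x. - f1 x * inverse (f0 x) ^ 2)
    (\<lambda>x. (f1 x)\<^sup>2 * inverse (f0 x) ^ 3 - f2 x * inverse (f0 x) ^ 2)"
proof -
  from assms obtain r where r: "psmooth r" "\<And>t x. f t x = f0 x + t * f1 x + t\<^sup>2 * f2 x + t ^ 3 * r t x"
    and sm: "psmooth (\<lambda>_. f0)" "psmooth (\<lambda>_. f1)" "psmooth (\<lambda>_. f2)"
    unfolding tay_def by blast
  have nz0: "f0 x \<noteq> 0" for x using nz[of 0 x] r(2)[of 0 x] by simp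
  have f: "psmooth f"
  proof -
    have "f = (\<lambda>t x. f0 x + t * f1 x + t\<^sup>2 * f2 x + t ^ 3 * r t x)" using r(2) by blast
    then show ?thesis using r(1) sm by (auto intro!: psmooth_intros)
  qed
  have i0: "psmooth (\<lambda>t x. inverse (f0 x))" by (intro psmooth_inverse sm nz0)
  have i: "psmooth (\<lambda>t x. inverse (f t x))" by (intro psmooth_inverse f nz)
  let ?h0 = "\<lambda>x. inverse (f0 x)" and ?h1 = "\<lambda>x. - f1 x * inverse (f0 x) ^ 2"
    and ?h2 = "\<lambda>x. (f1 x)\<^sup>2 * inverse (f0 x) ^ 3 - f2 x * inverse (f0 x) ^ 2"
  show ?thesis
  \<comment> \<open>Multiplying \<open>f\<close> by the truncated series of the inverse gives
    \<open>1 + t^3 E\<close>; dividing by \<open>f\<close> shows that the remainder is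
    \<open>- E / f\<close>.\<close>
  proof (rule tayI[where r="\<lambda>t x. - (inverse (f t x) * ((f1 x * ?h2 x + f2 x * ?h1 x + r t x * ?h0 x)
      + t * (f2 x * ?h2 x + r t x * ?h1 x) + t\<^sup>2 * (r t x * ?h2 x)))"], goal_cases)
    case (5 t x)
    let ?u = "inverse (f0 x)"
    have u: "f0 x * ?u = 1" using nz0 by simp
    have "f t x * (?h0 x + t * ?h1 x + t\<^sup>2 * ?h2 x) - 1 =
       t ^ 3 * ((f1 x * ?h2 x + f2 x * ?h1 x + r t x * ?h0 x)
      + t * (f2 x * ?h2 x + r t x * ?h1 x) + t\<^sup>2 * (r t x * ?h2 x))"
      unfolding r(2) using u by algebra
    moreover have "f t x * inverse (f t x) = 1" using nz by simp
    ultimately show ?case by algebra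
  qed (intro psmooth_intros r(1) sm i0 i)+
qed

lemma tay_sum:
  assumes "finite S" "\<And>a. a \<in> S \<Longrightarrow> tay (f a) (f0 a) (f1 a) (f2 a)"
  shows "tay (\<lambda>t x. \<Sum>a\<in>S. f a t x) (\<lambda>x. \<Sum>a\<in>S. f0 a x) (\<lambda>x. \<Sum>a\<in>S. f1 a x) (\<lambda>x. \<Sum>a\<in>S. f2 a x)"
  using assms by (induction S rule: finite_induct) (simp_all add: tay_const tay_add)

subsection \<open>The family of pullbacks\<close>

lemma pd_poly_coord:
  "pd i (\<lambda>x. poly p (x $ j)) x = poly (pderiv p) (x $ j) * (if i = j then 1 else 0)"
proof -
  have "((\<lambda>x. poly p (x $ j)) has_derivative (\<lambda>h. h $ j * poly (pderiv p) (x $ j))) (at x)"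
    by (rule DERIV_compose_FDERIV[OF poly_DERIV])
       (intro bounded_linear.has_derivative[OF bounded_linear_vec_nth] has_derivative_ident)
  from pd_eqI[OF this, of i] show ?thesis by (simp add: axis_def)
qed

definition rr :: "real^'n::finite \<Rightarrow> real" where
  "rr x = (\<Sum>a\<in>UNIV. x $ a * x $ a)"

lemma rr_norm: "rr x = (norm x)\<^sup>2"
  by (simp add: rr_def power2_norm_eq_inner inner_vec_def)

lemma rr_nonneg: "0 \<le> rr x"
  by (simp add: rr_norm)

lemma psmooth_rr: "psmooth (\<lambda>t. rr)"
  unfolding rr_def by (intro psmooth_intros)

lemma pd_rr: "pd i rr x = 2 * x $ i"
proof -
  have "pd i rr x = (\<Sum>a\<in>UNIV. (if i = a then 1 else 0) * (2 * x $ a))"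
    unfolding rr_def
    by (simp add: pd_sum pd_mult differentiable_coord pd_coord, intro sum.cong refl, simp)
  then show ?thesis by (simp only: sum_delta_mult)
qed

text \<open>The maps \<open>\<Phi>\<^sub>t\<close> move the boundary by \<open>t p\<close> in normal direction; the remaining first order
  term makes the full metric, not only the induced one, stationary at the boundary, and the
  second order field \<open>Y\<close> is a tangential reparametrization of the boundary.\<close>

locale deformation =
  fixes i0 :: "'n::finite" and p c :: "real poly"
begin

definition e :: "'n \<Rightarrow> real" where "e a = (if a = i0 then 1 else 0)"

definition X :: "'n \<Rightarrow> real^'n \<Rightarrow> real" where
  "X a x = poly p (x $ i0) * x $ a + (1/2) * (1 - rr x) * poly (pderiv p) (x $ i0) * e a"

text \<open>With \<open>z = x $ i0\<close>, on the boundary \<open>e\<close> is the gradient of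
  \<open>z\<close> plus the normal vector \<open>z x\<close>. The normal part does not affect the
  tangential trace at order \<open>t^2\<close>, as the boundary is totally geodesic in the round
  metric; the tangential part contributes \<open>2 div (c grad z)\<close>.\<close>

definition Y :: "'n \<Rightarrow> real^'n \<Rightarrow> real" where
  "Y a x = poly c (x $ i0) * e a"

definition Phi :: "real \<Rightarrow> 'n \<Rightarrow> real^'n \<Rightarrow> real" where
  "Phi t a x = x $ a + t * X a x + t\<^sup>2 * Y a x"

definition av :: "real \<Rightarrow> real^'n \<Rightarrow> real" where
  "av t x = 2 * inverse (1 + (\<Sum>a\<in>UNIV. Phi t a x * Phi t a x))"

text \<open>\<open>F t\<close> is \<open>\<Phi>\<^sub>t\<close> followed by inverse stereographic projection to the sphere in \<open>\<real>\<^sup>n\<^sup>+\<^sup>1\<close>.\<close>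

definition F :: "real \<Rightarrow> 'n option \<Rightarrow> real^'n \<Rightarrow> real" where
  "F t b x = (case b of None \<Rightarrow> av t x - 1 | Some a \<Rightarrow> av t x * Phi t a x)"

definition G :: "real \<Rightarrow> real^'n \<Rightarrow> real^'n^'n" where
  "G t x = (\<chi> i j. \<Sum>b\<in>UNIV. pd i (F t b) x * pd j (F t b) x)"

lemma psmooth_X: "psmooth (\<lambda>t. X a)"
  unfolding X_def by (intro psmooth_intros psmooth_rr)

lemma psmooth_Y: "psmooth (\<lambda>t. Y a)"
  unfolding Y_def by (intro psmooth_intros)

lemma psmooth_Phi: "psmooth (\<lambda>t. Phi t a)"
  unfolding Phi_def by (intro psmooth_intros psmooth_X psmooth_Y)

lemma D_pos: "0 < 1 + (\<Sum>a\<in>UNIV. Phi t a x * Phi t a x)"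
  using sum_nonneg[of UNIV "\<lambda>a. Phi t a x * Phi t a x"] by simp

lemma psmooth_av: "psmooth av"
  using D_pos less_imp_neq[OF D_pos]
  unfolding av_def[abs_def] by (intro psmooth_intros psmooth_inverse psmooth_Phi) metis

lemma psmooth_F: "psmooth (\<lambda>t. F t b)"
  unfolding F_def by (cases b) (auto intro!: psmooth_intros psmooth_av psmooth_Phi)

lemma psmooth_G: "psmooth (\<lambda>t x. G t x $ i $ j)"
  unfolding G_def by (auto intro!: psmooth_sum psmooth_mult psmooth_pd psmooth_F)

lemma av_eq: "av t x * (1 + (\<Sum>a\<in>UNIV. Phi t a x * Phi t a x)) = 2"
  using D_pos[of t x] by (simp add: av_def)

lemma F_sphere: "(\<Sum>b\<in>UNIV. F t b x * F t b x) = 1"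
proof -
  let ?s = "\<Sum>a\<in>UNIV. Phi t a x * Phi t a x"
  have "(\<Sum>b\<in>UNIV. F t b x * F t b x) = (av t x - 1)\<^sup>2 + (av t x)\<^sup>2 * ?s"
    by (simp add: sum_option_UNIV F_def power2_eq_square sum_distrib_left mult_ac)
  then show ?thesis using av_eq[of t x] by algebra
qed

sublocale sphere_map "F t" "G t" for t
  by unfold_locales (auto simp: G_def F_sphere intro: psmooth_freeze[OF psmooth_F])

lemma scalar_curv_G: "det (G t x) \<noteq> 0 \<Longrightarrow> scalar_curv (G t) x = real CARD('n) * (real CARD('n) - 1)"
  by (rule scalar_curv_eq)

lemma dPhi: "Phi t a differentiable (at x)"
  using psmooth_diff[OF psmooth_Phi] .

lemma dav: "av t differentiable (at x)"
  using psmooth_diff[OF psmooth_av] .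

lemma pd_av:
  "pd i (av t) x * (1 + (\<Sum>a\<in>UNIV. Phi t a x * Phi t a x)) =
     - 2 * av t x * (\<Sum>a\<in>UNIV. Phi t a x * pd i (Phi t a) x)"
proof -
  have "pd i (\<lambda>x. av t x * (1 + (\<Sum>a\<in>UNIV. Phi t a x * Phi t a x))) x = 0"
    by (simp add: av_eq)
  moreover have ds: "(\<lambda>x. \<Sum>a\<in>UNIV. Phi t a x * Phi t a x) differentiable (at x)"
    by (intro differentiable_sum ballI differentiable_mult dPhi finite)
  moreover have "pd i (\<lambda>x. \<Sum>a\<in>UNIV. Phi t a x * Phi t a x) x = 2 * (\<Sum>a\<in>UNIV. Phi t a x * pd i (Phi t a) x)"
    by (simp add: pd_sum pd_mult dPhi sum_distrib_left algebra_simps)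
  ultimately show ?thesis by (simp add: pd_mult pd_add dav)
qed

text \<open>Inverse stereographic projection is conformal with factor \<open>av\<close>: by
  \<open>pd_av\<close> the terms containing derivatives of \<open>av\<close> cancel.\<close>

lemma G_conformal: "G t x $ i $ j = (av t x)\<^sup>2 * (\<Sum>a\<in>UNIV. pd i (Phi t a) x * pd j (Phi t a) x)"
proof -
  let ?s = "\<Sum>a\<in>UNIV. Phi t a x * Phi t a x"
  let ?A = "av t x" and ?Ai = "pd i (av t) x" and ?Aj = "pd j (av t) x"
  let ?si = "\<lambda>i. \<Sum>a\<in>UNIV. Phi t a x * pd i (Phi t a) x"
  have pN: "pd i (F t None) x = pd i (av t) x" for i
    unfolding F_def by (simp add: pd_diff dav)
  have pS: "pd i (F t (Some a)) x = pd i (av t) x * Phi t a x + av t x * pd i (Phi t a) x" for i a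
    unfolding F_def by (simp add: pd_mult dav dPhi)
  have "G t x $ i $ j = ?Ai * ?Aj * (1 + ?s) + ?A * ?Ai * ?si j + ?A * ?Aj * ?si i
     + ?A\<^sup>2 * (\<Sum>a\<in>UNIV. pd i (Phi t a) x * pd j (Phi t a) x)"
    unfolding G_def sum_option_UNIV pN pS vec_lambda_beta
    by (simp add: sum_distrib_left sum.distrib distrib_left distrib_right power2_eq_square algebra_simps)
  moreover have "?Ai * ?Aj * (1 + ?s) + ?A * ?Ai * ?si j + ?A * ?Aj * ?si i = 0"
    using pd_av[of i t x] pd_av[of j t x] by algebra
  ultimately show ?thesis by simp
qed

lemma pd_X: "pd i (X a) x = poly (pderiv p) (x $ i0) * e i * x $ a + poly p (x $ i0) * (if i = a then 1 else 0)
    - x $ i * poly (pderiv p) (x $ i0) * e a + (1/2) * (1 - rr x) * poly (pderiv (pderiv p)) (x $ i0) * e i * e a"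
proof -
  have dp: "(\<lambda>x. poly q (x $ i0)) differentiable (at x)" for q :: "real poly" and x :: "real^'n"
    by (rule psmooth_diff[OF psmooth_poly[OF psmooth_coord]])
  have dr: "rr differentiable (at x)" for x :: "real^'n"
    by (rule psmooth_diff[OF psmooth_rr])
  define h where "h = (1/2) * e a"
  have X: "X a = (\<lambda>x. poly p (x $ i0) * x $ a + (1 - rr x) * (poly (pderiv p) (x $ i0) * h))"
    by (simp add: X_def h_def fun_eq_iff)
  have ei: "(if i = i0 then 1 else 0) = e i" by (simp add: e_def)
  have "pd i (X a) x = poly (pderiv p) (x $ i0) * e i * x $ a + poly p (x $ i0) * (if i = a then 1 else 0)
      + ((- 2 * x $ i) * (poly (pderiv p) (x $ i0) * h)
        + (1 - rr x) * (poly (pderiv (pderiv p)) (x $ i0) * e i * h))"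
    unfolding X
    by (simp add: pd_add pd_mult pd_diff dp dr differentiable_coord pd_poly_coord pd_rr pd_coord
        differentiable_mult differentiable_diff ei del: mult_if_delta)
  then show ?thesis by (simp add: h_def)
qed

lemma pd_Y: "pd i (Y a) x = poly (pderiv c) (x $ i0) * e i * e a"
proof -
  have dp: "(\<lambda>x. poly q (x $ i0)) differentiable (at x)" for q :: "real poly" and x :: "real^'n"
    by (rule psmooth_diff[OF psmooth_poly[OF psmooth_coord]])
  show ?thesis
    unfolding Y_def[abs_def] by (simp add: pd_mult dp pd_poly_coord e_def)
qed

lemma pd_Phi: "pd i (Phi t a) x = (if i = a then 1 else 0) + t * pd i (X a) x + t\<^sup>2 * pd i (Y a) x"
proof -
  have "X a differentiable (at x)" "Y a differentiable (at x)"
    using psmooth_diff[OF psmooth_X] psmooth_diff[OF psmooth_Y] by blast+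
  then show ?thesis
    unfolding Phi_def[abs_def] by (simp add: pd_add pd_cmult differentiable_coord pd_coord)
qed

section \<open>Taylor coefficients in \<open>t\<close> of the conformal factor and of the
  pulled-back metrics\<close>

definition D1 where "D1 x = 2 * (\<Sum>a\<in>UNIV. x $ a * X a x)"
definition D2 where "D2 x = (\<Sum>a\<in>UNIV. X a x * X a x) + 2 * (\<Sum>a\<in>UNIV. x $ a * Y a x)"
definition A0 :: "real^'n \<Rightarrow> real" where "A0 x = 2 * inverse (1 + rr x)"
definition A1 where "A1 x = - 2 * D1 x * inverse (1 + rr x) ^ 2"
definition A2 where "A2 x = 2 * ((D1 x)\<^sup>2 * inverse (1 + rr x) ^ 3 - D2 x * inverse (1 + rr x) ^ 2)"

lemma tay_av: "tay av A0 A1 A2"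
proof -
  have P: "tay (\<lambda>t. Phi t a) (\<lambda>x. x $ a) (X a) (Y a)" for a
    unfolding Phi_def by (rule tay_quadratic[OF psmooth_coord psmooth_X psmooth_Y])
  have T: "tay (\<lambda>t x. 1 + (\<Sum>a\<in>UNIV. Phi t a x * Phi t a x)) (\<lambda>x. 1 + (\<Sum>a\<in>UNIV. x $ a * x $ a))
     (\<lambda>x. 0 + (\<Sum>a\<in>UNIV. x $ a * X a x + X a x * x $ a))
     (\<lambda>x. 0 + (\<Sum>a\<in>UNIV. x $ a * Y a x + X a x * X a x + Y a x * x $ a))"
    by (intro tay_add tay_const tay_sum finite tay_mult P)
  have e0: "(\<lambda>x. 1 + (\<Sum>a\<in>UNIV. x $ a * x $ a)) = (\<lambda>x. 1 + rr x)"
    by (simp add: rr_def)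
  have e1: "(\<lambda>x. 0 + (\<Sum>a\<in>UNIV. x $ a * X a x + X a x * x $ a)) = D1"
    by (simp add: fun_eq_iff D1_def mult.commute sum_distrib_left)
  have e2: "(\<lambda>x. 0 + (\<Sum>a\<in>UNIV. x $ a * Y a x + X a x * X a x + Y a x * x $ a)) = D2"
    by (simp add: fun_eq_iff D2_def mult.commute sum_distrib_left flip: sum.distrib) (simp add: algebra_simps)
  have nz: "1 + (\<Sum>a\<in>UNIV. Phi t a x * Phi t a x) \<noteq> 0" for t x
    using D_pos[of t x] by linarith
  have f: "av = (\<lambda>t x. 2 * inverse (1 + (\<Sum>a\<in>UNIV. Phi t a x * Phi t a x)))"
    "A0 = (\<lambda>x. 2 * inverse (1 + rr x))"
    "A1 = (\<lambda>x. 2 * (- D1 x * inverse (1 + rr x) ^ 2) + 0 * inverse (1 + rr x))"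
    "A2 = (\<lambda>x. 2 * ((D1 x)\<^sup>2 * inverse (1 + rr x) ^ 3 - D2 x * inverse (1 + rr x) ^ 2)
      + 0 * (- D1 x * inverse (1 + rr x) ^ 2) + 0 * inverse (1 + rr x))"
    by (auto simp: fun_eq_iff av_def A0_def A1_def A2_def)
  show ?thesis
    unfolding f by (intro tay_mult tay_const tay_inverse nz T[unfolded e0 e1 e2])
qed

definition G0 :: "'n \<Rightarrow> 'n \<Rightarrow> real^'n \<Rightarrow> real" where "G0 i j x = (A0 x)\<^sup>2 * (if i = j then 1 else 0)"
definition G1 where "G1 i j x = (A0 x)\<^sup>2 * (pd i (X j) x + pd j (X i) x) + 2 * A0 x * A1 x * (if i = j then 1 else 0)"
definition G2 where "G2 i j x = (A0 x)\<^sup>2 * (pd i (Y j) x + pd j (Y i) x + (\<Sum>a\<in>UNIV. pd i (X a) x * pd j (X a) x))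
  + 2 * A0 x * A1 x * (pd i (X j) x + pd j (X i) x) + ((A1 x)\<^sup>2 + 2 * A0 x * A2 x) * (if i = j then 1 else 0)"

lemma tay_G: "tay (\<lambda>t x. G t x $ i $ j) (G0 i j) (G1 i j) (G2 i j)"
proof -
  have P: "tay (\<lambda>t x. pd i (Phi t a) x) (\<lambda>x. if i = a then 1 else 0) (pd i (X a)) (pd i (Y a))" for i a
    unfolding pd_Phi by (intro tay_quadratic psmooth_const psmooth_pd psmooth_X psmooth_Y)
  have M: "tay (\<lambda>t x. \<Sum>a\<in>UNIV. pd i (Phi t a) x * pd j (Phi t a) x)
     (\<lambda>x. \<Sum>a\<in>UNIV. (if i = a then 1 else 0) * (if j = a then 1 else 0))
     (\<lambda>x. \<Sum>a\<in>UNIV. (if i = a then 1 else 0) * pd j (X a) x + pd i (X a) x * (if j = a then 1 else 0))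
     (\<lambda>x. \<Sum>a\<in>UNIV. (if i = a then 1 else 0) * pd j (Y a) x + pd i (X a) x * pd j (X a) x
        + pd i (Y a) x * (if j = a then 1 else 0))"
    by (intro tay_sum finite tay_mult P)
  have M1: "(\<lambda>x. \<Sum>a\<in>UNIV. (if i = a then 1 else 0) * (if j = a then 1 else (0::real))) = (\<lambda>x. if i = j then 1 else 0)"
    "(\<lambda>x. \<Sum>a\<in>UNIV. (if i = a then 1 else 0) * pd j (X a) x + pd i (X a) x * (if j = a then 1 else 0)) =
      (\<lambda>x. pd i (X j) x + pd j (X i) x)"
    "(\<lambda>x. \<Sum>a\<in>UNIV. (if i = a then 1 else 0) * pd j (Y a) x + pd i (X a) x * pd j (X a) x
        + pd i (Y a) x * (if j = a then 1 else 0)) =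
     (\<lambda>x. pd i (Y j) x + pd j (Y i) x + (\<Sum>a\<in>UNIV. pd i (X a) x * pd j (X a) x))"
    by (auto simp: sum.distrib sum_delta_mult fun_eq_iff simp del: mult_if_delta)
  have eq: "(\<lambda>t x. G t x $ i $ j) = (\<lambda>t x. av t x * av t x * (\<Sum>a\<in>UNIV. pd i (Phi t a) x * pd j (Phi t a) x))"
    by (simp add: G_conformal power2_eq_square)
  have G0': "G0 i j = (\<lambda>x. A0 x * A0 x * (if i = j then 1 else 0))"
    by (simp add: G0_def fun_eq_iff power2_eq_square)
  have G1': "G1 i j = (\<lambda>x. A0 x * A0 x * (pd i (X j) x + pd j (X i) x) + (A0 x * A1 x + A1 x * A0 x) * (if i = j then 1 else 0))"
    by (simp add: G1_def fun_eq_iff power2_eq_square)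
  have G2': "G2 i j = (\<lambda>x. A0 x * A0 x * (pd i (Y j) x + pd j (Y i) x + (\<Sum>a\<in>UNIV. pd i (X a) x * pd j (X a) x))
     + (A0 x * A1 x + A1 x * A0 x) * (pd i (X j) x + pd j (X i) x)
     + (A0 x * A2 x + A1 x * A1 x + A2 x * A0 x) * (if i = j then 1 else 0))"
    by (simp add: G2_def fun_eq_iff power2_eq_square algebra_simps)
  show ?thesis
    unfolding eq G0' G1' G2' by (intro tay_mult tay_av M[unfolded M1])
qed

end

subsection \<open>The tangential trace on the unit sphere\<close>

definition PT :: "real^'n::finite \<Rightarrow> ('n \<Rightarrow> 'n \<Rightarrow> real) \<Rightarrow> real" where
  "PT x T = (\<Sum>i\<in>UNIV. \<Sum>k\<in>UNIV. ((if i = k then 1 else 0) - x $ i * x $ k) * T i k)"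

lemma PT_add: "PT x (\<lambda>i k. T i k + S i k) = PT x T + PT x S"
  by (simp add: PT_def distrib_left sum.distrib)

lemma PT_cmult: "PT x (\<lambda>i k. a * T i k) = a * PT x T"
  by (simp add: PT_def sum_distrib_left mult.left_commute)

lemma PT_prod:
  "PT x (\<lambda>i k. u i * v k) = (\<Sum>i\<in>UNIV. u i * v i) - (\<Sum>i\<in>UNIV. x $ i * u i) * (\<Sum>i\<in>UNIV. x $ i * v i)"
proof -
  have "PT x (\<lambda>i k. u i * v k) = (\<Sum>i\<in>UNIV. (\<Sum>k\<in>UNIV. (if i = k then 1 else 0) * (u i * v k)))
      - (\<Sum>i\<in>UNIV. \<Sum>k\<in>UNIV. (x $ i * u i) * (x $ k * v k))"
    unfolding PT_def sum_subtractf[symmetric]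
    by (intro sum.cong refl) (simp add: algebra_simps)
  then show ?thesis by (simp only: sum_delta_mult sum_product)
qed

lemma PT_delta: "norm x = 1 \<Longrightarrow> PT (x :: real^'n::finite) (\<lambda>i k. if i = k then 1 else 0) = real CARD('n) - 1"
  unfolding PT_def sum_delta_mult by (simp add: sum_subtractf sum_square_eq_1)

context deformation
begin

section \<open>Boundary values and radial derivatives of the Taylor coefficients\<close>

lemma sum_x_e: "(\<Sum>a\<in>UNIV. x $ a * e a) = x $ i0"
  and sum_e_x: "(\<Sum>a\<in>UNIV. e a * x $ a) = x $ i0"
  and sum_e_e: "(\<Sum>a\<in>UNIV. e a * e a) = 1"
proof -
  show "(\<Sum>a\<in>UNIV. x $ a * e a) = x $ i0" "(\<Sum>a\<in>UNIV. e a * x $ a) = x $ i0"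
    unfolding e_def by (simp_all only: sum_delta_mult)
  show "(\<Sum>a\<in>UNIV. e a * e a) = 1"
    unfolding e_def[of a for a] by (simp only: sum_delta_mult) simp
qed

lemma PT_e:
  assumes "norm x = 1"
  shows "PT x (\<lambda>i k. e i * x $ k) = 0" "PT x (\<lambda>i k. x $ i * e k) = 0"
    "PT x (\<lambda>i k. e i * e k) = 1 - (x $ i0)\<^sup>2" "PT x (\<lambda>i k. x $ i * x $ k) = 0"
  unfolding PT_prod sum_x_e sum_e_x sum_e_e sum_square_eq_1[OF assms] by (simp_all add: power2_eq_square)

text \<open>For functions of the height \<open>z\<close> on the unit sphere of dimension
  \<open>m = n - 1\<close> this is \<open>|grad p|^2 - m p^2 + 2 div (c grad z)\<close>, using
  \<open>|grad z|^2 = 1 - z^2\<close> and \<open>Laplace z = - m z\<close>. The divergence leaves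
  the integral unchanged.\<close>

definition energy :: "real \<Rightarrow> real" where
  "energy z = (1 - z\<^sup>2) * (poly (pderiv p) z)\<^sup>2 - (real CARD('n) - 1) * (poly p z)\<^sup>2
     + 2 * ((1 - z\<^sup>2) * poly (pderiv c) z - (real CARD('n) - 1) * z * poly c z)"

text \<open>The function \<open>w = - (Laplace p + m p)\<close> of the overview, written in the
  height \<open>z\<close>.\<close>

definition wmean :: "real \<Rightarrow> real" where
  "wmean z = - ((1 - z\<^sup>2) * poly (pderiv (pderiv p)) z - (real CARD('n) - 1) * z * poly (pderiv p) z + (real CARD('n) - 1) * poly p z)"

lemma sphere_values:
  assumes x: "norm x = 1"
  shows "rr x = 1" "X a x = poly p (x $ i0) * x $ a" "A0 x = 1" "D1 x = 2 * poly p (x $ i0)"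
    "A1 x = - poly p (x $ i0)"
    "A2 x = (poly p (x $ i0))\<^sup>2 / 2 - poly c (x $ i0) * x $ i0"
proof -
  show r: "rr x = 1" using x by (simp add: rr_norm)
  show X: "X a x = poly p (x $ i0) * x $ a" for a by (simp add: X_def r)
  show A0: "A0 x = 1" by (simp add: A0_def r)
  have "(\<Sum>a\<in>UNIV. x $ a * X a x) = poly p (x $ i0) * (\<Sum>a\<in>UNIV. x $ a * x $ a)"
    unfolding X sum_distrib_left by (intro sum.cong refl) simp
  then show D1: "D1 x = 2 * poly p (x $ i0)" by (simp add: D1_def sum_square_eq_1[OF x])
  then show A1: "A1 x = - poly p (x $ i0)" by (simp add: A1_def r power2_eq_square)
  have "(\<Sum>a\<in>UNIV. X a x * X a x) = (poly p (x $ i0))\<^sup>2 * (\<Sum>a\<in>UNIV. x $ a * x $ a)"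
    unfolding X sum_distrib_left by (intro sum.cong refl) (simp add: power2_eq_square)
  moreover have "(\<Sum>a\<in>UNIV. x $ a * Y a x) = poly c (x $ i0) * (\<Sum>a\<in>UNIV. x $ a * e a)"
    unfolding Y_def sum_distrib_left by (intro sum.cong refl) simp
  ultimately have "D2 x = (poly p (x $ i0))\<^sup>2 + 2 * (poly c (x $ i0) * x $ i0)"
    by (simp add: D2_def sum_square_eq_1[OF x] sum_x_e)
  then show "A2 x = (poly p (x $ i0))\<^sup>2 / 2 - poly c (x $ i0) * x $ i0"
    by (simp add: A2_def D1 r field_simps power2_eq_square power3_eq_cube)
qed

lemma sphere_pd_X:
  assumes x: "norm x = 1"
  shows "pd i (X a) x = poly (pderiv p) (x $ i0) * e i * x $ a + poly p (x $ i0) * (if i = a then 1 else 0)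
    - x $ i * poly (pderiv p) (x $ i0) * e a"
  using sphere_values(1)[OF x] by (simp add: pd_X)

lemma G0_sphere: "norm x = 1 \<Longrightarrow> G0 i j x = (if i = j then 1 else 0)"
  by (simp add: G0_def sphere_values)

lemma sphere_sym_X:
  "norm x = 1 \<Longrightarrow> pd i (X j) x + pd j (X i) x = 2 * poly p (x $ i0) * (if i = j then 1 else 0)"
  by (simp add: sphere_pd_X)

text \<open>The field \<open>p x\<close> alone would leave mixed terms
  \<open>p' (e_i x_j + x_i e_j)\<close>; the summand of \<open>X\<close> with the factor
  \<open>1 - rr\<close> cancels them. What remains, \<open>2 p\<close> times the identity, is
  compensated by the conformal factor through \<open>A1 = - p\<close>.\<close>

lemma G1_sphere: "norm x = 1 \<Longrightarrow> G1 i j x = 0"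
  unfolding G1_def sphere_sym_X by (simp add: sphere_values)

text \<open>Since \<open>G1\<close> vanishes on the boundary, half of this trace is the coefficient
  of \<open>t^2\<close> in the boundary area element. Its positivity is the pointwise area
  growth.\<close>

lemma PT_G2_sphere:
  assumes x: "norm x = 1"
  shows "PT x (\<lambda>i j. G2 i j x) = energy (x $ i0)"
proof -
  let ?z = "x $ i0"
  let ?p = "poly p ?z" and ?p1 = "poly (pderiv p) ?z" and ?c = "poly c ?z" and ?c1 = "poly (pderiv c) ?z"
  let ?d = "\<lambda>i j. if i = (j :: 'n) then 1 else (0 :: real)"
  have XX: "(\<Sum>a\<in>UNIV. pd i (X a) x * pd j (X a) x) =
      ?p1\<^sup>2 * (e i * e j) + (- ?p1\<^sup>2 * ?z) * (e i * x $ j) + (- ?p1\<^sup>2 * ?z) * (x $ i * e j) + ?p1\<^sup>2 * (x $ i * x $ j)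
      + ?p\<^sup>2 * ?d i j" for i j
  proof -
    have "(\<Sum>a\<in>UNIV. pd i (X a) x * pd j (X a) x) =
      (\<Sum>a\<in>UNIV. ?p1\<^sup>2 * e i * e j * (x $ a * x $ a) - ?p1\<^sup>2 * e i * x $ j * (x $ a * e a)
        - ?p1\<^sup>2 * x $ i * e j * (x $ a * e a) + ?p1\<^sup>2 * x $ i * x $ j * (e a * e a)
        + ?p * ?p1 * e i * (x $ a * ?d j a) + ?p * ?p1 * e j * (x $ a * ?d i a)
        - ?p * ?p1 * x $ i * (e a * ?d j a) - ?p * ?p1 * x $ j * (e a * ?d i a) + ?p\<^sup>2 * (?d i a * ?d j a))"
      unfolding sphere_pd_X[OF x] by (intro sum.cong refl) algebra
    also have "\<dots> = ?p1\<^sup>2 * e i * e j - ?p1\<^sup>2 * e i * x $ j * ?z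
        - ?p1\<^sup>2 * x $ i * e j * ?z + ?p1\<^sup>2 * x $ i * x $ j
        + ?p * ?p1 * e i * x $ j + ?p * ?p1 * e j * x $ i
        - ?p * ?p1 * x $ i * e j - ?p * ?p1 * x $ j * e i + ?p\<^sup>2 * ?d j i"
      unfolding sum.distrib sum_subtractf sum_distrib_left[symmetric] sum_square_eq_1[OF x] sum_x_e sum_e_e sum_delta_mult
      by simp
    also have "\<dots> = ?p1\<^sup>2 * (e i * e j) + (- ?p1\<^sup>2 * ?z) * (e i * x $ j) + (- ?p1\<^sup>2 * ?z) * (x $ i * e j)
      + ?p1\<^sup>2 * (x $ i * x $ j) + ?p\<^sup>2 * ?d i j"
      by (simp add: algebra_simps)
    finally show ?thesis .
  qed
  have "G2 i j x = 2 * ?c1 * (e i * e j) + (?p1\<^sup>2 * (e i * e j) + (- ?p1\<^sup>2 * ?z) * (e i * x $ j)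
      + (- ?p1\<^sup>2 * ?z) * (x $ i * e j) + ?p1\<^sup>2 * (x $ i * x $ j) + ?p\<^sup>2 * ?d i j)
      + (- 4 * ?p\<^sup>2 + 2 * ?p\<^sup>2 - 2 * ?c * ?z) * ?d i j" for i j
    unfolding G2_def sphere_sym_X[OF x] XX pd_Y
    by (simp add: sphere_values[OF x] power2_eq_square algebra_simps)
  then have "PT x (\<lambda>i j. G2 i j x) = 2 * ?c1 * (1 - ?z\<^sup>2) + (?p1\<^sup>2 * (1 - ?z\<^sup>2) + ?p\<^sup>2 * (real CARD('n) - 1))
      + (- 4 * ?p\<^sup>2 + 2 * ?p\<^sup>2 - 2 * ?c * ?z) * (real CARD('n) - 1)"
    by (simp only: PT_add PT_cmult PT_e[OF x] PT_delta[OF x] mult_zero_right add_0_right)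
  then show ?thesis by (simp add: energy_def algebra_simps)
qed

text \<open>Expresses that the boundary is totally geodesic in the round metric: half of this value
  cancels the Euclidean \<open>n - 1\<close> in \<open>mean_curv_unit_sphere\<close>.\<close>

lemma radial_G0:
  fixes x :: "real^'n"
  assumes x: "norm x = 1"
  shows "((\<lambda>s. PT x (\<lambda>i j. G0 i j (s *\<^sub>R x))) has_real_derivative - 2 * (real CARD('n) - 1)) (at 1)"
proof -
  have rs: "rr (s *\<^sub>R x) = s\<^sup>2" for s using x by (simp add: rr_norm)
  have "PT x (\<lambda>i j. G0 i j (s *\<^sub>R x)) = (2 * inverse (1 + s\<^sup>2))\<^sup>2 * (real CARD('n) - 1)" for s
    unfolding G0_def PT_cmult PT_delta[OF x] A0_def rs ..
  then show ?thesis by (auto intro!: derivative_eq_intros simp: power2_eq_square)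
qed

text \<open>The first variation of the mean curvature. The second derivative in
  \<open>Laplace p\<close> comes from the term with the factor \<open>1 - s^2\<close>, which is zero
  at the boundary but has a nonzero radial derivative there.\<close>

lemma radial_G1:
  assumes x: "norm x = 1"
  shows "((\<lambda>s. PT x (\<lambda>i j. G1 i j (s *\<^sub>R x))) has_real_derivative 2 * wmean (x $ i0)) (at 1)"
proof -
  let ?z = "x $ i0"
  let ?p = "\<lambda>s. poly p (s * ?z)" and ?p1 = "\<lambda>s. poly (pderiv p) (s * ?z)"
    and ?p2 = "\<lambda>s. poly (pderiv (pderiv p)) (s * ?z)"
  have rs: "rr (s *\<^sub>R x) = s\<^sup>2" for s using x by (simp add: rr_norm)
  have D: "D1 (s *\<^sub>R x) = 2 * (s\<^sup>2 * ?p s + 1/2 * (1 - s\<^sup>2) * ?p1 s * s * ?z)" for s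
  proof -
    have "(\<Sum>a\<in>UNIV. (s *\<^sub>R x) $ a * X a (s *\<^sub>R x)) =
       (\<Sum>a\<in>UNIV. s\<^sup>2 * ?p s * (x $ a * x $ a) + 1/2 * (1 - s\<^sup>2) * ?p1 s * s * (x $ a * e a))"
      unfolding X_def rs by (intro sum.cong refl) (simp add: power2_eq_square algebra_simps)
    then show ?thesis
      unfolding D1_def sum.distrib sum_distrib_left[symmetric] sum_square_eq_1[OF x] sum_x_e by simp
  qed
  have "G1 i j (s *\<^sub>R x) = (2 * inverse (1 + s\<^sup>2))\<^sup>2 * ((?p1 s * s - s * ?p1 s) * (e i * x $ j) + (?p1 s * s - s * ?p1 s) * (x $ i * e j)
      + (1 - s\<^sup>2) * ?p2 s * (e i * e j) + 2 * ?p s * (if i = j then 1 else 0))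
      + 2 * (2 * inverse (1 + s\<^sup>2)) * (- 2 * D1 (s *\<^sub>R x) * (inverse (1 + s\<^sup>2))\<^sup>2) * (if i = j then 1 else 0)" for s i j
    unfolding G1_def pd_X A0_def A1_def rs by (simp add: algebra_simps)
  then have "PT x (\<lambda>i j. G1 i j (s *\<^sub>R x)) = (2 * inverse (1 + s\<^sup>2))\<^sup>2 * ((1 - s\<^sup>2) * ?p2 s * (1 - ?z\<^sup>2) + 2 * ?p s * (real CARD('n) - 1))
      + 2 * (2 * inverse (1 + s\<^sup>2)) * (- 2 * (2 * (s\<^sup>2 * ?p s + 1/2 * (1 - s\<^sup>2) * ?p1 s * s * ?z)) * (inverse (1 + s\<^sup>2))\<^sup>2) * (real CARD('n) - 1)" for s
    by (simp only: PT_add PT_cmult PT_e[OF x] PT_delta[OF x] D) simp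
  moreover have dp: "((\<lambda>s. poly q (s * ?z)) has_real_derivative poly (pderiv q) (s * ?z) * ?z) (at s)" for q s
    by (rule DERIV_chain2[where f="poly q"]) (auto intro!: derivative_eq_intros poly_DERIV)
  have "((\<lambda>s. (2 * inverse (1 + s\<^sup>2))\<^sup>2 * ((1 - s\<^sup>2) * ?p2 s * (1 - ?z\<^sup>2) + 2 * ?p s * (real CARD('n) - 1))
      + 2 * (2 * inverse (1 + s\<^sup>2)) * (- 2 * (2 * (s\<^sup>2 * ?p s + 1/2 * (1 - s\<^sup>2) * ?p1 s * s * ?z)) * (inverse (1 + s\<^sup>2))\<^sup>2) * (real CARD('n) - 1))
      has_real_derivative 2 * wmean ?z) (at 1)"
    by (auto intro!: derivative_eq_intros dp[THEN DERIV_cong]) (simp add: wmean_def field_simps power2_eq_square)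
  ultimately show ?thesis by simp
qed

end

subsection \<open>The choice of the normal speed\<close>

primrec mom :: "real \<Rightarrow> nat \<Rightarrow> real" where
  "mom m 0 = 1"
| "mom m (Suc k) = mom m k * (2 * real k + 1) / (2 * real k + 1 + m)"

text \<open>\<open>mom m k\<close> is the mean of \<open>z\<^sup>2\<^sup>k\<close> over the unit sphere \<open>S\<^sup>m\<close>, and a function with mean zero is
  a divergence.\<close>

lemma even_power_mod_divergence:
  assumes "m > 0"
  shows "\<exists>c. \<forall>z. z ^ (2 * k) + 2 * ((1 - z\<^sup>2) * poly (pderiv c) z - m * z * poly c z) = mom m k"
proof (induction k)
  case 0
  show ?case by (rule exI[of _ 0]) simp
next
  case (Suc k)
  then obtain c where c: "\<And>z. z ^ (2 * k) + 2 * ((1 - z\<^sup>2) * poly (pderiv c) z - m * z * poly c z) = mom m k"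
    by blast
  let ?a = "2 * real k + 1"
  have nz: "?a + m \<noteq> 0" using assms by linarith
  \<comment> \<open>The recursion comes from
    \<open>div (z^(2k+1) grad z) = (2k+1) z^(2k) - (2k+1+m) z^(2k+2)\<close>; the coefficient
    \<open>1/2\<close> absorbs the factor 2 in front of the divergence.\<close>
  define d where "d = smult (1 / (?a + m)) (smult ?a c + monom (1/2) (Suc (2 * k)))"
  have "z ^ (2 * Suc k) + 2 * ((1 - z\<^sup>2) * poly (pderiv d) z - m * z * poly d z) = mom m (Suc k)" for z
  proof -
    have d: "poly d z = (?a * poly c z + z ^ Suc (2 * k) / 2) / (?a + m)"
      "poly (pderiv d) z = (?a * poly (pderiv c) z + ?a * z ^ (2 * k) / 2) / (?a + m)"
      by (simp_all add: d_def pderiv_smult pderiv_add pderiv_monom poly_monom)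
    define y where "y = z ^ (2 * k)"
    have "(?a + m) * (z ^ (2 * Suc k) + 2 * ((1 - z\<^sup>2) * poly (pderiv d) z - m * z * poly d z)) =
      (?a + m) * z\<^sup>2 * y + 2 * ((1 - z\<^sup>2) * (?a * poly (pderiv c) z + ?a * y / 2) - m * z * (?a * poly c z + z * y / 2))"
    proof -
      have cancel: "b * (A + 2 * ((1 - z\<^sup>2) * (P1 / b) - m * z * (P0 / b))) =
        b * A + 2 * ((1 - z\<^sup>2) * P1 - m * z * P0)" if "b \<noteq> 0" for b A P0 P1 :: real
        using that by (simp add: distrib_left right_diff_distrib) 
      have "z ^ (2 * Suc k) = z\<^sup>2 * y" "z ^ Suc (2 * k) = z * y"
        by (simp_all add: y_def power2_eq_square)
      note eqs = this
      show ?thesis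
        unfolding d y_def[symmetric] eqs by (subst cancel[OF nz]) (simp only: mult.assoc)
    qed
    also have "\<dots> = ?a * (y + 2 * ((1 - z\<^sup>2) * poly (pderiv c) z - m * z * poly c z))"
      by (simp add: field_simps power2_eq_square)
    also have "\<dots> = ?a * mom m k" using c[of z] by (simp add: y_def)
    finally show ?thesis using nz by (simp add: field_simps)
  qed
  then show ?case by blast
qed

text \<open>Turns positivity of a mean over the sphere into pointwise positivity: adding a
  divergence replaces the polynomial by its mean.\<close>

lemma even_poly_mod_divergence:
  assumes "m > 0"
  shows "\<exists>c. \<forall>z. (\<Sum>k\<le>K. q k * z ^ (2 * k)) + 2 * ((1 - z\<^sup>2) * poly (pderiv c) z - m * z * poly c z)
     = (\<Sum>k\<le>K. q k * mom m k)"
proof (induction K)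
  case 0
  show ?case by (rule exI[of _ 0]) simp
next
  case (Suc K)
  then obtain c where c: "\<And>z. (\<Sum>k\<le>K. q k * z ^ (2 * k)) + 2 * ((1 - z\<^sup>2) * poly (pderiv c) z - m * z * poly c z)
     = (\<Sum>k\<le>K. q k * mom m k)" by blast
  from even_power_mod_divergence[OF assms, of "Suc K"] obtain d where
    d: "\<And>z. z ^ (2 * Suc K) + 2 * ((1 - z\<^sup>2) * poly (pderiv d) z - m * z * poly d z) = mom m (Suc K)"
    by blast
  show ?case
  proof (rule exI[of _ "c + smult (q (Suc K)) d"], rule allI)
    fix z
    show "(\<Sum>k\<le>Suc K. q k * z ^ (2 * k)) + 2 * ((1 - z\<^sup>2) * poly (pderiv (c + smult (q (Suc K)) d)) z
       - m * z * poly (c + smult (q (Suc K)) d) z) = (\<Sum>k\<le>Suc K. q k * mom m k)"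
      unfolding sum.atMost_Suc c[of z, symmetric] d[of z, symmetric]
      by (simp add: pderiv_add pderiv_smult algebra_simps)
  qed
qed

text \<open>The polynomial \<open>p\<close> solves \<open>-(\<Delta> + m) p = 5m(m+2)(m+4)(m+6) z\<^sup>6 + m\<close> on \<open>S\<^sup>m\<close>.  Concentrating the
  right-hand side at the poles makes \<open>\<integral>(\<bar>\<nabla>p\<bar>\<^sup>2 - m p\<^sup>2)\<close> positive; 6 is the smallest even exponent
  that works for \<open>m = 2\<close>.\<close>

lemma normal_speed_exists:
  fixes m :: real
  assumes m: "m \<ge> 2"
  shows "\<exists>p c :: real poly. \<forall>z.
     - ((1 - z\<^sup>2) * poly (pderiv (pderiv p)) z - m * z * poly (pderiv p) z + m * poly p z) > 0 \<and>
     (1 - z\<^sup>2) * (poly (pderiv p) z)\<^sup>2 - m * (poly p z)\<^sup>2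
       + 2 * ((1 - z\<^sup>2) * poly (pderiv c) z - m * z * poly c z) > 0"
proof -
  \<comment> \<open>Descending recursion: \<open>-(Laplace + m) z^(2k)\<close> equals
    \<open>(2k-1)(2k+m) z^(2k) - 2k(2k-1) z^(2k-2)\<close>, and each coefficient is chosen to cancel
    the lower power left by the one above. The constant \<open>-240\<close> would finish the
    cancellation; \<open>-241\<close> leaves the summand \<open>m\<close>, which keeps the
    right-hand side positive at \<open>z = 0\<close>.\<close>
  define a3 a2 a1 where "a3 = m * (m + 2) * (m + 4)" and "a2 = 10 * m * (m + 2)" and "a1 = 120 * m"
  define p where "p = [:-241, 0, a1, 0, a2, 0, a3:]"
  have p: "poly p z = -241 + a1 * z ^ 2 + a2 * z ^ 4 + a3 * z ^ 6"
    "poly (pderiv p) z = 2 * a1 * z + 4 * a2 * z ^ 3 + 6 * a3 * z ^ 5"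
    "poly (pderiv (pderiv p)) z = 2 * a1 + 12 * a2 * z ^ 2 + 30 * a3 * z ^ 4" for z
    by (simp_all add: p_def pderiv_pCons algebra_simps numeral_eq_Suc)
  have w: "- ((1 - z\<^sup>2) * poly (pderiv (pderiv p)) z - m * z * poly (pderiv p) z + m * poly p z)
      = 5 * m * (m + 2) * (m + 4) * (m + 6) * z ^ 6 + m" for z
    unfolding p a3_def a2_def a1_def by algebra
  \<comment> \<open>Coefficients of \<open>|grad p|^2 - m p^2\<close> as a polynomial in
    \<open>z^2\<close>; note \<open>58081 = 241^2\<close> and \<open>482 = 2 * 241\<close>.\<close>
  define q :: "nat \<Rightarrow> real" where "q = (\<lambda>k. [- m * 58081, 4 * a1\<^sup>2 + 482 * m * a1,
      16 * a2 * a1 - 4 * a1\<^sup>2 - m * (a1\<^sup>2 - 482 * a2),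
      16 * a2\<^sup>2 + 24 * a3 * a1 - 16 * a2 * a1 - m * (- 482 * a3 + 2 * a2 * a1),
      48 * a3 * a2 - (16 * a2\<^sup>2 + 24 * a3 * a1) - m * (a2\<^sup>2 + 2 * a3 * a1),
      36 * a3\<^sup>2 - 48 * a3 * a2 - 2 * m * a3 * a2, - 36 * a3\<^sup>2 - m * a3\<^sup>2] ! k)"
  have six: "{..6::nat} = {0,1,2,3,4,5,6}" by auto
  have Q: "(1 - z\<^sup>2) * (poly (pderiv p) z)\<^sup>2 - m * (poly p z)\<^sup>2 = (\<Sum>k\<le>6. q k * z ^ (2 * k))" for z
    unfolding p six by (simp add: q_def) algebra
  from even_poly_mod_divergence[where m=m and K=6 and q=q] m obtain c where
    c: "\<And>z. (\<Sum>k\<le>6. q k * z ^ (2 * k)) + 2 * ((1 - z\<^sup>2) * poly (pderiv c) z - m * z * poly c z)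
       = (\<Sum>k\<le>6. q k * mom m k)" by auto
  have "(\<Sum>k\<le>6. q k * mom m k) > 0"
  proof -
    \<comment> \<open>After clearing denominators the numerator, expanded in \<open>j >= 0\<close>,
      has only positive coefficients. This settles all dimensions at once.\<close>
    define j where "j = m - 2"
    have j: "j \<ge> 0" "m = 2 + j" using m by (auto simp: j_def)
    have mom: "mom m 1 = 1 / (m + 1)" "mom m 2 = 3 / ((m + 1) * (m + 3))"
      "mom m 3 = 15 / ((m + 1) * (m + 3) * (m + 5))"
      "mom m 4 = 105 / ((m + 1) * (m + 3) * (m + 5) * (m + 7))"
      "mom m 5 = 945 / ((m + 1) * (m + 3) * (m + 5) * (m + 7) * (m + 9))"
      "mom m 6 = 10395 / ((m + 1) * (m + 3) * (m + 5) * (m + 7) * (m + 9) * (m + 11))"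
      by (simp_all add: numeral_eq_Suc algebra_simps)
    have sum: "(\<Sum>k\<le>6. q k * mom m k) = (q 0 * ((m + 1) * (m + 3) * (m + 5) * (m + 7) * (m + 9) * (m + 11))
        + q 1 * ((m + 3) * (m + 5) * (m + 7) * (m + 9) * (m + 11))
        + 3 * q 2 * ((m + 5) * (m + 7) * (m + 9) * (m + 11)) + 15 * q 3 * ((m + 7) * (m + 9) * (m + 11))
        + 105 * q 4 * ((m + 9) * (m + 11)) + 945 * q 5 * (m + 11) + 10395 * q 6)
        / ((m + 1) * (m + 3) * (m + 5) * (m + 7) * (m + 9) * (m + 11))" (is "_ = ?N / ?D")
    proof -
      have frac: "q0 + (q1 * (1 / d1) + (q2 * (3 / (d1 * d2)) + (q3 * (15 / (d1 * d2 * d3)) +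
          (q4 * (105 / (d1 * d2 * d3 * d4)) + (q5 * (945 / (d1 * d2 * d3 * d4 * d5)) +
          q6 * (10395 / (d1 * d2 * d3 * d4 * d5 * d6))))))) =
        (q0 * (d1 * d2 * d3 * d4 * d5 * d6) + q1 * (d2 * d3 * d4 * d5 * d6) + 3 * q2 * (d3 * d4 * d5 * d6)
          + 15 * q3 * (d4 * d5 * d6) + 105 * q4 * (d5 * d6) + 945 * q5 * d6 + 10395 * q6)
         / (d1 * d2 * d3 * d4 * d5 * d6)"
        if "d1 \<noteq> 0" "d2 \<noteq> 0" "d3 \<noteq> 0" "d4 \<noteq> 0" "d5 \<noteq> 0" "d6 \<noteq> 0"
        for q0 q1 q2 q3 q4 q5 q6 d1 d2 d3 d4 d5 d6 :: real
        using that by (simp add: add_divide_distrib ac_simps)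
      have "m + 1 \<noteq> 0" "m + 3 \<noteq> 0" "m + 5 \<noteq> 0" "m + 7 \<noteq> 0" "m + 9 \<noteq> 0" "m + 11 \<noteq> 0" using m by auto
      note f = frac[OF this, of "q 0" "q 1" "q 2" "q 3" "q 4" "q 5" "q 6"]
      have "(\<Sum>k\<le>6. q k * mom m k) = q 0 + (q 1 * mom m 1 + (q 2 * mom m 2 + (q 3 * mom m 3 +
          (q 4 * mom m 4 + (q 5 * mom m 5 + q 6 * mom m 6)))))"
        unfolding six by simp
      then show ?thesis unfolding mom f .
    qed
    have "?N = 793745730 + 5383845921 * j + 6019511410 * j ^ 2 + 2782270301 * j ^ 3 + 655507780 * j ^ 4
       + 83247029 * j ^ 5 + 5441950 * j ^ 6 + 144074 * j ^ 7"
      unfolding q_def a3_def a2_def a1_def j(2) by simp algebra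
    also have "\<dots> > 0" using j(1) by (intro add_pos_nonneg) auto
    finally show ?thesis unfolding sum using m by (intro divide_pos_pos) auto
  qed
  then have "\<forall>z. (1 - z\<^sup>2) * (poly (pderiv p) z)\<^sup>2 - m * (poly p z)\<^sup>2
       + 2 * ((1 - z\<^sup>2) * poly (pderiv c) z - m * z * poly c z) > 0"
    unfolding Q c by blast
  moreover have "5 * m * (m + 2) * (m + 4) * (m + 6) * z ^ 6 + m > 0" for z
  proof -
    have "z ^ 6 = (z ^ 3)\<^sup>2" by (simp add: power_mult[symmetric])
    then show ?thesis using m by (intro add_nonneg_pos mult_nonneg_nonneg) auto
  qed
  ultimately show ?thesis unfolding w[symmetric] by blast
qed

subsection \<open>Uniform estimates on compact sets\<close>

lemma isCont_poly_comp:
  fixes f :: "'a::t2_space \<Rightarrow> real"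
  shows "isCont f z \<Longrightarrow> isCont (\<lambda>z. poly q (f z)) z"
  by (induction q) (auto intro!: continuous_intros)

lemma finite_family_bound:
  fixes f :: "'i::finite \<Rightarrow> 'a::topological_space \<Rightarrow> real"
  assumes K: "compact K" and c: "\<And>i. continuous_on K (f i)"
  shows "\<exists>A>0. \<forall>i. \<forall>x\<in>K. \<bar>f i x\<bar> < A"
proof -
  have "\<exists>B. \<forall>x\<in>K. \<bar>f i x\<bar> \<le> B" for i
  proof -
    have "bounded (f i ` K)" by (intro compact_imp_bounded compact_continuous_image c K)
    then show ?thesis by (auto simp: bounded_iff)
  qed
  then obtain B where B: "\<And>i x. x \<in> K \<Longrightarrow> \<bar>f i x\<bar> \<le> B i" by metis
  define A where "A = 1 + (\<Sum>i\<in>UNIV. \<bar>B i\<bar>)"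
  have "\<bar>f i x\<bar> < A" if "x \<in> K" for i x
  proof -
    have "\<bar>B i\<bar> \<le> (\<Sum>i\<in>UNIV. \<bar>B i\<bar>)" by (rule member_le_sum) auto
    then show ?thesis using B[OF that, of i] unfolding A_def by linarith
  qed
  moreover have "A > 0" unfolding A_def by (intro add_pos_nonneg sum_nonneg) auto
  ultimately show ?thesis by blast
qed

lemma finite_family_bound2:
  fixes f :: "'i::finite \<Rightarrow> 'j::finite \<Rightarrow> 'a::topological_space \<Rightarrow> real"
  assumes "compact K" "\<And>i j. continuous_on K (f i j)"
  obtains A where "\<And>i j x. x \<in> K \<Longrightarrow> \<bar>f i j x\<bar> < A"
proof -
  obtain A where A: "\<And>u x. x \<in> K \<Longrightarrow> \<bar>f (fst u) (snd u) x\<bar> < A"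
    using finite_family_bound[OF assms(1), of "\<lambda>u. f (fst u) (snd u)"] assms(2) by blast
  show ?thesis by (rule that[of A]) (use A[of _ "(i, j)" for i j] in simp)
qed

lemma finite_family_bound3:
  fixes f :: "'i::finite \<Rightarrow> 'j::finite \<Rightarrow> 'k::finite \<Rightarrow> 'a::topological_space \<Rightarrow> real"
  assumes "compact K" "\<And>i j k. continuous_on K (f i j k)"
  obtains A where "\<And>i j k x. x \<in> K \<Longrightarrow> \<bar>f i j k x\<bar> < A"
proof -
  obtain A where A: "\<And>u k x. x \<in> K \<Longrightarrow> \<bar>f (fst u) (snd u) k x\<bar> < A"
    using finite_family_bound2[OF assms(1), of "\<lambda>u. f (fst u) (snd u)"] assms(2) by blast
  show ?thesis by (rule that[of A]) (use A[of _ "(i, j)" for i j] in simp)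
qed

lemma finite_family_bound4:
  fixes f :: "'i::finite \<Rightarrow> 'j::finite \<Rightarrow> 'k::finite \<Rightarrow> 'l::finite \<Rightarrow> 'a::topological_space \<Rightarrow> real"
  assumes "compact K" "\<And>i j k l. continuous_on K (f i j k l)"
  obtains A where "\<And>i j k l x. x \<in> K \<Longrightarrow> \<bar>f i j k l x\<bar> < A"
proof -
  obtain A where A: "\<And>u k l x. x \<in> K \<Longrightarrow> \<bar>f (fst u) (snd u) k l x\<bar> < A"
    using finite_family_bound3[OF assms(1), of "\<lambda>u. f (fst u) (snd u)"] assms(2) by blast
  show ?thesis by (rule that[of A]) (use A[of _ "(i, j)" for i j] in simp)
qed

lemma eventually_bounded_on_compact:
  fixes f :: "real \<times> 'a::metric_space \<Rightarrow> real"
  assumes "compact K" "\<And>x. x \<in> K \<Longrightarrow> isCont f (0, x)" "\<And>x. x \<in> K \<Longrightarrow> \<bar>f (0, x)\<bar> < A"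
  shows "\<forall>\<^sub>F t in at_right 0. \<forall>x\<in>K. \<bar>f (t, x)\<bar> < A"
proof -
  have "\<forall>\<^sub>F t in at_right 0. \<forall>x\<in>K. A - \<bar>f (t, x)\<bar> > 0"
    by (rule eventually_pos_on_compact[of K "\<lambda>z. A - \<bar>f z\<bar>"]) (use assms in \<open>auto intro!: continuous_intros\<close>)
  then show ?thesis by simp
qed

lemma abs_component_le_norm: "\<bar>x $ i\<bar> \<le> norm (x :: real^'n)"
  using component_le_norm_cart by blast

lemma abs_sum2_le:
  fixes f :: "'n::finite \<Rightarrow> 'n \<Rightarrow> real"
  assumes "\<And>i j. \<bar>f i j\<bar> \<le> B"
  shows "\<bar>\<Sum>i\<in>UNIV. \<Sum>j\<in>UNIV. f i j\<bar> \<le> real CARD('n) ^ 2 * B"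
proof -
  have "\<bar>\<Sum>i\<in>UNIV. \<Sum>j\<in>UNIV. f i j\<bar> \<le> (\<Sum>i::'n\<in>UNIV. \<Sum>j::'n\<in>UNIV. B)"
    by (intro order_trans[OF sum_abs] sum_mono assms)
  then show ?thesis by (simp add: power2_eq_square)
qed

lemma isCont_PrJ:
  assumes "\<And>i j. isCont (\<lambda>z. W z i j) z" "\<And>p q i j. isCont (\<lambda>z. C z p q i j) z"
  shows "isCont (\<lambda>z. PrJ (W z) (C z)) z"
  unfolding PrJ_def by (intro continuous_intros assms)

text \<open>For an inverse metric that is a multiple of the identity, the principal part is the
  double divergence minus the Laplacian of the trace.\<close>

lemma PrJ_conformal:
  fixes C :: "'n::finite \<Rightarrow> 'n \<Rightarrow> 'n \<Rightarrow> 'n \<Rightarrow> real"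
  shows "PrJ (\<lambda>i j. if i = j then w else 0) C = w\<^sup>2 * (\<Sum>i\<in>UNIV. \<Sum>k\<in>UNIV. C k i i k - C k k i i)"
proof -
  have w: "(\<lambda>i j. if i = j then w else 0) = (\<lambda>i j :: 'n. w * (if i = j then 1 else 0))" by (intro ext) simp
  have d: "(\<Sum>j\<in>UNIV. w * (if i = j then 1 else 0) * h j) = w * h i" for i :: 'n and h
    using sum_delta_mult(1)[of i h] by (simp add: mult.assoc flip: sum_distrib_left)
  have "PrJ (\<lambda>i j. if i = j then w else 0) C = (\<Sum>i\<in>UNIV. \<Sum>k\<in>UNIV.
      w\<^sup>2 * C k i i k - (1/2) * (w\<^sup>2 * C k k i i) - (1/2) * (w\<^sup>2 * C i i k k))"
    unfolding PrJ_def w unfolding d unfolding sum_distrib_left by (intro sum.cong refl) (simp add: algebra_simps power2_eq_square)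
  also have "\<dots> = (\<Sum>i\<in>UNIV. \<Sum>k\<in>UNIV. w\<^sup>2 * C k i i k)
      - (1/2) * (\<Sum>i\<in>UNIV. \<Sum>k\<in>UNIV. w\<^sup>2 * C k k i i) - (1/2) * (\<Sum>i\<in>UNIV. \<Sum>k\<in>UNIV. w\<^sup>2 * C i i k k)"
    by (simp only: sum_subtractf sum_distrib_left)
  also have "(\<Sum>i\<in>UNIV. \<Sum>k\<in>UNIV. w\<^sup>2 * C i i k k) = (\<Sum>i\<in>UNIV. \<Sum>k\<in>UNIV. w\<^sup>2 * C k k i i)"
    by (rule sum.swap)
  finally show ?thesis by (simp add: sum_subtractf sum_distrib_left right_diff_distrib sum_negf)
qed

text \<open>Here \<open>N\<close> is the rate of decay of the boundary layer and \<open>\<rho>\<close> the distance from the origin.\<close>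

lemma layer_dominates:
  fixes c L P k :: real
  assumes "c > 0" "L \<ge> 0" "P \<ge> 0" "k \<ge> 1"
  shows "\<exists>N>0. \<forall>\<rho>. 4 * N\<^sup>2 * c * \<rho>\<^sup>2 + 2 * N * k * (1 - L * \<rho>\<^sup>2) - N * P * \<rho> - P > 0"
proof -
  \<comment> \<open>Half of the term of order \<open>N^2\<close> absorbs the one with
    \<open>L\<close> (hence \<open>k * L / c\<close>), the other half absorbs
    \<open>N * P * \<rho>\<close> by completing the square at the cost \<open>P^2 / (8 * c)\<close>.
    The rest of order \<open>N\<close> then beats the constants.\<close>
  define N where "N = 1 + k * L / c + P\<^sup>2 / (8 * c) + P"
  have N: "N > k * L / c" "N > P\<^sup>2 / (8 * c) + P" "N > 0"
    using assms unfolding N_def by (auto intro!: add_pos_nonneg simp: add_nonneg_pos)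
  have "4 * N\<^sup>2 * c * \<rho>\<^sup>2 + 2 * N * k * (1 - L * \<rho>\<^sup>2) - N * P * \<rho> - P > 0" for \<rho>
  proof -
    have "k * L \<le> N * c" using N(1) assms(1) by (simp add: field_simps)
    then have "2 * N * \<rho>\<^sup>2 * (k * L) \<le> 2 * N * \<rho>\<^sup>2 * (N * c)"
      using N(3) by (intro mult_left_mono) auto
    moreover have "N * P * \<rho> \<le> 2 * c * N\<^sup>2 * \<rho>\<^sup>2 + P\<^sup>2 / (8 * c)"
    proof -
      have "0 \<le> (4 * c * N * \<rho> - P)\<^sup>2 / (8 * c)" using assms(1) by simp
      also have "\<dots> = 2 * c * N\<^sup>2 * \<rho>\<^sup>2 + P\<^sup>2 / (8 * c) - N * P * \<rho>"
        using assms(1) by (simp add: field_simps power2_eq_square)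
      finally show ?thesis by simp
    qed
    moreover have "N \<le> N * k" using N(3) assms(4) by simp
    moreover have "2 * N * \<rho>\<^sup>2 * (N * c) = 2 * c * N\<^sup>2 * \<rho>\<^sup>2" by (simp add: power2_eq_square)
    moreover have "4 * N\<^sup>2 * c * \<rho>\<^sup>2 = 2 * (2 * c * N\<^sup>2 * \<rho>\<^sup>2)" by simp
    moreover have "2 * N * k * (1 - L * \<rho>\<^sup>2) = 2 * (N * k) - 2 * N * \<rho>\<^sup>2 * (k * L)" by (simp add: algebra_simps)
    ultimately show ?thesis using N(2,3) by linarith
  qed
  then show ?thesis using N(3) by blast
qed

subsection \<open>The corrected metrics\<close>

locale good_deformation = deformation i0 p c
  for i0 :: "'n::finite" and p c :: "real poly" +
  assumes n3: "3 \<le> CARD('n)"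
    and wmean_pos: "wmean z > 0"
    and energy_pos: "energy z > 0"
begin

text \<open>A named remainder is needed because it enters the correction itself: the boundary values
  must be restored exactly, not only to leading order in \<open>t\<close>.\<close>

definition Rem :: "'n \<Rightarrow> 'n \<Rightarrow> real \<Rightarrow> real^'n \<Rightarrow> real" where
  "Rem i j = (SOME r. psmooth r \<and>
     (\<forall>t x. G t x $ i $ j = G0 i j x + t * G1 i j x + t\<^sup>2 * G2 i j x + t ^ 3 * r t x))"

lemma Rem: "psmooth (Rem i j)"
  "G t x $ i $ j = G0 i j x + t * G1 i j x + t\<^sup>2 * G2 i j x + t ^ 3 * Rem i j t x"
proof -
  have "\<exists>r. psmooth r \<and>
     (\<forall>t x. G t x $ i $ j = G0 i j x + t * G1 i j x + t\<^sup>2 * G2 i j x + t ^ 3 * r t x)"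
    using tay_G unfolding tay_def by blast
  from someI_ex[OF this] show "psmooth (Rem i j)"
    "G t x $ i $ j = G0 i j x + t * G1 i j x + t\<^sup>2 * G2 i j x + t ^ 3 * Rem i j t x"
    unfolding Rem_def[symmetric] by blast+
qed

lemma psmooth_G0: "psmooth (\<lambda>_. G0 i j)" and psmooth_G1: "psmooth (\<lambda>_. G1 i j)"
  and psmooth_G2: "psmooth (\<lambda>_. G2 i j)"
  using tay_G[of i j] unfolding tay_def by blast+

lemma G012_sym: "G0 i j x = G0 j i x" "G1 i j x = G1 j i x" "G2 i j x = G2 j i x"
  by (simp_all add: G0_def G1_def G2_def add.commute mult.commute)

text \<open>At \<open>t = 0\<close> the expansion does not determine the remainder, so symmetry is
  claimed only after multiplication by \<open>t\<close>, the form in which the remainder occurs in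
  \<open>K\<close>.\<close>

lemma t_Rem_sym: "t * Rem i j t x = t * Rem j i t x"
proof (cases "t = 0")
  case False
  have "G0 i j x + t * G1 i j x + t\<^sup>2 * G2 i j x + t ^ 3 * Rem i j t x =
      G0 j i x + t * G1 j i x + t\<^sup>2 * G2 j i x + t ^ 3 * Rem j i t x"
    using g_sym[of t x i j] unfolding Rem(2) .
  then have "t ^ 3 * Rem i j t x = t ^ 3 * Rem j i t x"
    unfolding G012_sym[of i j x] by linarith
  then show ?thesis using False by simp
qed simp

definition lay :: "real \<Rightarrow> real^'n \<Rightarrow> real" where
  "lay N x = exp (N * (rr x - 1))"

text \<open>The first part cancels all deviation from the round metric on the boundary. The second
  vanishes there and makes \<open>K\<close> sufficiently negative in the interior, where nothing is
  known about the sign of \<open>G2\<close>.\<close>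

definition K :: "real \<Rightarrow> real \<Rightarrow> 'n \<Rightarrow> 'n \<Rightarrow> real^'n \<Rightarrow> real" where
  "K L t i j x = - (G2 i j x + t * Rem i j t x) - L * (1 - rr x) * (if i = j then 1 else 0)"

definition kk :: "real \<Rightarrow> real \<Rightarrow> real \<Rightarrow> 'n \<Rightarrow> 'n \<Rightarrow> real^'n \<Rightarrow> real" where
  "kk N L t i j x = lay N x * K L t i j x"

definition gm :: "real \<Rightarrow> real \<Rightarrow> real \<Rightarrow> real^'n \<Rightarrow> real^'n^'n" where
  "gm N L t x = (\<chi> i j. G t x $ i $ j + t\<^sup>2 * kk N L t i j x)"

lemma psmooth_lay: "psmooth (\<lambda>_. lay N)"
  unfolding lay_def by (intro psmooth_intros psmooth_rr)

lemma psmooth_K: "psmooth (\<lambda>t. K L t i j)"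
  unfolding K_def by (intro psmooth_intros psmooth_rr psmooth_G2 Rem(1))

lemma psmooth_kk: "psmooth (\<lambda>t. kk N L t i j)"
  unfolding kk_def by (intro psmooth_intros psmooth_lay psmooth_K)

lemma psmooth_gm: "psmooth (\<lambda>t x. gm N L t x $ i $ j)"
  unfolding gm_def by (auto intro!: psmooth_intros psmooth_G psmooth_kk)

lemma gm_sym: "gm N L t x $ i $ j = gm N L t x $ j $ i"
  using g_sym[of t x i j] G012_sym[of i j x] t_Rem_sym[of t i j x]
  by (simp add: gm_def kk_def K_def)

lemma gm_0: "gm N L 0 = G 0"
  by (simp add: gm_def fun_eq_iff vec_eq_iff)

lemma G_0: "G 0 x = (A0 x)\<^sup>2 *\<^sub>R mat 1"
  by (simp add: vec_eq_iff Rem(2) G0_def mat_def)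

lemma gm_eq:
  "gm N L t x $ i $ j = G0 i j x + t * G1 i j x + t\<^sup>2 *
     ((1 - lay N x) * (G2 i j x + t * Rem i j t x) - lay N x * (L * (1 - rr x) * (if i = j then 1 else 0)))"
  by (simp add: gm_def kk_def K_def Rem(2) algebra_simps power2_eq_square power3_eq_cube)

lemma gm_sphere: "norm x = 1 \<Longrightarrow> gm N L t x = mat 1"
  by (simp add: vec_eq_iff gm_eq G0_sphere G1_sphere lay_def rr_norm mat_def)

subsubsection \<open>Mean curvature\<close>

definition rad :: "(real^'n \<Rightarrow> real) \<Rightarrow> real^'n \<Rightarrow> real" where
  "rad f x = (\<Sum>l\<in>UNIV. x $ l * pd l f x)"

lemma PT_rad:
  assumes "\<And>i j. f i j differentiable (at x)"
    "((\<lambda>s. PT x (\<lambda>i j. f i j (s *\<^sub>R x))) has_real_derivative d) (at 1)"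
  shows "PT x (\<lambda>i j. rad (f i j) x) = d"
proof -
  have "((\<lambda>s. PT x (\<lambda>i j. f i j (s *\<^sub>R x))) has_real_derivative PT x (\<lambda>i j. rad (f i j) x)) (at 1)"
    unfolding PT_def rad_def by (intro DERIV_sum DERIV_cmult radial_derivative assms)
  then show ?thesis using assms(2) DERIV_unique by blast
qed

text \<open>Holds for arbitrary \<open>N\<close> and \<open>L\<close>: the layer only enters the
  coefficient of \<open>t^2\<close>, so the mean curvature divided by \<open>t\<close> tends to
  \<open>wmean\<close>, uniformly on the sphere.\<close>

lemma mean_curv_gm:
  "\<forall>\<^sub>F t in at_right 0. \<forall>x\<in>sphere 0 1. mean_curv (gm N L t) x > 0"
proof -
  define S where "S i j t x = (1 - lay N x) * (G2 i j x + t * Rem i j t x)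
      - lay N x * (L * (1 - rr x) * (if i = j then 1 else 0))" for i j t x
  have sS: "psmooth (S i j)" for i j
    unfolding S_def[abs_def] by (intro psmooth_intros psmooth_lay psmooth_G2 Rem(1) psmooth_rr)
  define h where "h z = wmean (snd z $ i0) + (1/2) * (fst z * PT (snd z) (\<lambda>i j. rad (S i j (fst z)) (snd z)))" for z
  have mc: "mean_curv (gm N L t) x = t * h (t, x)" if x: "norm x = 1" for t x
  proof -
    note d0 = psmooth_diff[OF psmooth_G0] and d1 = psmooth_diff[OF psmooth_G1] and dS = psmooth_diff[OF sS]
    have "mean_curv (gm N L t) x = real CARD('n) - 1 + (1/2) * PT x (\<lambda>i j. rad (\<lambda>y. gm N L t y $ i $ j) x)"
      unfolding PT_def rad_def
      by (rule mean_curv_unit_sphere) (auto simp: gm_sphere x intro: psmooth_freeze[OF psmooth_gm] gm_sym)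
    also have "(\<lambda>i j. rad (\<lambda>y. gm N L t y $ i $ j) x) =
        (\<lambda>i j. rad (G0 i j) x + t * rad (G1 i j) x + t\<^sup>2 * rad (S i j t) x)"
    proof (intro ext)
      fix i j
      have "(\<lambda>y. gm N L t y $ i $ j) = (\<lambda>y. G0 i j y + t * G1 i j y + t\<^sup>2 * S i j t y)"
        by (simp add: gm_eq S_def)
      then show "rad (\<lambda>y. gm N L t y $ i $ j) x = rad (G0 i j) x + t * rad (G1 i j) x + t\<^sup>2 * rad (S i j t) x"
        by (simp add: rad_def pd_add pd_cmult d0 d1 dS sum_distrib_left sum.distrib distrib_left mult.left_commute)
    qed
    also have "PT x \<dots> = - 2 * (real CARD('n) - 1) + t * (2 * wmean (x $ i0)) + t\<^sup>2 * PT x (\<lambda>i j. rad (S i j t) x)"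
      unfolding PT_add PT_cmult PT_rad[OF d0 radial_G0[OF x]] PT_rad[OF d1 radial_G1[OF x]] ..
    finally show ?thesis by (simp add: h_def algebra_simps power2_eq_square)
  qed
  have "\<forall>\<^sub>F t in at_right 0. \<forall>x\<in>sphere 0 1. h (t, x) > 0"
  proof (rule eventually_pos_on_compact)
    fix x :: "real^'n"
    show "h (0, x) > 0" by (simp add: h_def wmean_pos)
    have "isCont (\<lambda>z. pd l (S i j (fst z)) (snd z)) (0, x)" for i j l
      by (rule psmooth_isCont[OF psmooth_pd[OF sS]])
    then show "isCont h (0, x)"
      unfolding h_def[abs_def] wmean_def PT_def rad_def
      by (intro continuous_intros isCont_poly_comp) auto
  qed simp
  moreover have "\<forall>\<^sub>F t :: real in at_right 0. t > 0" by (rule eventually_at_right_less)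
  ultimately show ?thesis by eventually_elim (auto simp: mc)
qed

subsubsection \<open>Positive definiteness\<close>

text \<open>By homogeneity it suffices to test unit vectors, which makes the domain compact. Radius
  2 instead of 1 provides an open neighbourhood of the closed unit ball.\<close>

lemma pos_def_family:
  assumes s: "\<And>i j. psmooth (\<lambda>t x. g t x $ i $ j)" and g0: "g 0 = G 0"
  shows "\<forall>\<^sub>F t in at_right 0. \<forall>x\<in>cball 0 2. \<forall>v. v \<noteq> 0 \<longrightarrow> v \<bullet> (g t x *v v) > 0"
proof -
  define f where "f z = snd (snd z) \<bullet> (g (fst z) (fst (snd z)) *v snd (snd z))" for z
  have "\<forall>\<^sub>F t in at_right 0. \<forall>y \<in> cball 0 2 \<times> sphere 0 1. f (t, y) > 0"
  proof (rule eventually_pos_on_compact)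
    show "compact (cball 0 2 \<times> sphere 0 1 :: ((real^'n) \<times> (real^'n)) set)"
      by (intro compact_Times) auto
    fix y :: "(real^'n) \<times> (real^'n)" assume y: "y \<in> cball 0 2 \<times> sphere 0 1"
    have "A0 (fst y) > 0" using rr_nonneg[of "fst y"] by (simp add: A0_def)
    moreover have "f (0, y) = (A0 (fst y))\<^sup>2 * (norm (snd y))\<^sup>2"
      by (simp add: f_def g0 G_0 power2_norm_eq_inner flip: matrix_scaleR scaleR_matrix_vector_assoc)
    ultimately show "f (0, y) > 0" using y by (cases y) auto
    have "isCont (\<lambda>z. g (fst z) (fst (snd z)) $ i $ j) (0, y)" for i j
    proof -
      have "isCont (\<lambda>z. (fst z, fst (snd z))) (0, y)" by (intro continuous_intros)
      then have "isCont ((\<lambda>z. g (fst z) (snd z) $ i $ j) \<circ> (\<lambda>z. (fst z, fst (snd z)))) (0, y)"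
        by (rule continuous_at_compose) (use psmooth_isCont[OF s] in auto)
      then show ?thesis by (simp add: o_def)
    qed
    then show "isCont f (0, y)"
      unfolding f_def[abs_def] inner_vec_def matrix_vector_mult_def
      by (auto intro!: continuous_intros)
  qed
  then show ?thesis
  proof eventually_elim
    case (elim t)
    show ?case
    proof (intro ballI allI impI)
      fix x v :: "real^'n" assume x: "x \<in> cball 0 2" and v: "v \<noteq> 0"
      let ?u = "v /\<^sub>R norm v"
      have "?u \<in> sphere 0 1" using v by simp
      then have "f (t, x, ?u) > 0" using elim x by blast
      then have "?u \<bullet> (g t x *v ?u) > 0" by (simp only: f_def fst_conv snd_conv)
      moreover have "v \<bullet> (g t x *v v) = (norm v)\<^sup>2 * (?u \<bullet> (g t x *v ?u))"
      proof -
        have "?u \<bullet> (g t x *v ?u) = inverse (norm v) * (inverse (norm v) * (v \<bullet> (g t x *v v)))"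
          by (simp add: matrix_vector_mult_scaleR)
        moreover have "norm v * inverse (norm v) = 1" using v by simp
        ultimately show ?thesis by algebra
      qed
      ultimately show "v \<bullet> (g t x *v v) > 0" using v by simp
    qed
  qed
qed

subsubsection \<open>The correction is negative in tangential directions\<close>

text \<open>On the sphere the first expression is minus the tangential trace of \<open>K\<close>,
  that is \<open>energy\<close>. In the interior it is governed by \<open>L\<close>. It vanishes at
  the origin, hence the factor \<open>rr x\<close> in the bound; near the origin the second bound,
  on the full trace, is the useful one.\<close>

lemma K_bounds:
  "\<exists>L cc. L \<ge> 0 \<and> cc > 0 \<and> (\<forall>x\<in>cball 0 1.
     (\<Sum>i\<in>UNIV. \<Sum>k\<in>UNIV. x $ i * x $ k * K L 0 i k x) - rr x * (\<Sum>i\<in>UNIV. K L 0 i i x) \<ge> cc * rr x \<and>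
     (\<Sum>i\<in>UNIV. K L 0 i i x) \<le> - 1 + real CARD('n) * L * rr x)"
proof -
  let ?n = "real CARD('n)"
  have n: "?n \<ge> 3" using n3 by simp
  define \<beta> where "\<beta> x = rr x * (\<Sum>i\<in>UNIV. G2 i i x) - (\<Sum>i\<in>UNIV. \<Sum>k\<in>UNIV. x $ i * x $ k * G2 i k x)" for x
  have cG: "continuous_on S (G2 i j)" for S i j
    using psmooth_cont_x[OF psmooth_G2] .
  have crr: "continuous_on S rr" for S :: "(real^'n) set"
    using psmooth_cont_x[OF psmooth_rr] .
  have c\<beta>: "continuous_on S \<beta>" for S
    unfolding \<beta>_def[abs_def] by (intro continuous_intros cG crr)
  obtain H where H: "H > 0" "\<And>i j x. x \<in> cball 0 1 \<Longrightarrow> \<bar>G2 i j x\<bar> < H"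
    using finite_family_bound[of "cball 0 1" "\<lambda>(i, j). G2 i j"] cG by (auto simp: split_beta)
  have \<beta>_sphere: "\<beta> x > 0" if "x \<in> sphere 0 1" for x
  proof -
    have x: "norm x = 1" using that by simp
    have "PT x (\<lambda>i j. G2 i j x) = (\<Sum>i\<in>UNIV. \<Sum>k\<in>UNIV. (if i = k then 1 else 0) * G2 i k x)
        - (\<Sum>i\<in>UNIV. \<Sum>k\<in>UNIV. x $ i * x $ k * G2 i k x)"
      unfolding PT_def by (simp only: left_diff_distrib sum_subtractf)
    then have "\<beta> x = energy (x $ i0)"
      unfolding PT_G2_sphere[OF x] sum_delta_mult \<beta>_def using sphere_values(1)[OF x] by simp
    then show ?thesis using energy_pos by simp
  qed
  have "sphere (0::real^'n) 1 \<noteq> {}" by simp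
  then obtain x1 where x1: "x1 \<in> sphere 0 1" "\<And>x. x \<in> sphere 0 1 \<Longrightarrow> \<beta> x1 \<le> \<beta> x"
    using continuous_attains_inf[of "sphere 0 1" \<beta>] c\<beta> by auto
  \<comment> \<open>Half the minimum, so that the set \<open>T\<close> where \<open>\<beta>\<close>
    is at most \<open>cc\<close> stays away from the sphere.\<close>
  define cc where "cc = \<beta> x1 / 2"
  have cc: "cc > 0" "\<And>x. x \<in> sphere 0 1 \<Longrightarrow> \<beta> x > cc"
  proof -
    show "cc > 0" using \<beta>_sphere[OF x1(1)] by (simp add: cc_def)
    then show "\<beta> x > cc" if "x \<in> sphere 0 1" for x
      using x1(2)[OF that] by (simp add: cc_def)
  qed
  define T where "T = cball 0 1 \<inter> {x. \<beta> x \<le> cc}"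
  have "\<exists>r<1. \<forall>x\<in>T. rr x \<le> r"
  proof (cases "T = {}")
    case False
    have "compact T"
      unfolding T_def by (intro compact_Int_closed closed_Collect_le c\<beta> continuous_intros) auto
    then obtain x0 where x0: "x0 \<in> T" "\<And>x. x \<in> T \<Longrightarrow> rr x \<le> rr x0"
      using continuous_attains_sup[of T rr] False crr by blast
    have "norm x0 \<noteq> 1" "norm x0 \<le> 1" using x0(1) cc(2)[of x0] by (auto simp: T_def)
    then have "rr x0 < 1" by (simp add: rr_norm power_less_one_iff)
    then show ?thesis using x0(2) by blast
  qed (auto intro: exI[of _ 0])
  then obtain r where r: "r < 1" "\<And>x. x \<in> T \<Longrightarrow> rr x \<le> r" by blast
  \<comment> \<open>The quotient makes \<open>L * (1 - r)\<close> outweigh \<open>\<beta>\<close> on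
    \<open>T\<close>; the summand \<open>H + 1\<close> makes the full trace at most
    \<open>-1\<close> at the origin.\<close>
  define L where "L = (2 * ?n\<^sup>2 * H + cc) / (1 - r) + H + 1"
  have L: "L \<ge> 0" "L * (1 - r) \<ge> 2 * ?n\<^sup>2 * H + cc" "L \<ge> H + 1"
  proof -
    have q: "(2 * ?n\<^sup>2 * H + cc) / (1 - r) \<ge> 0" using H(1) cc(1) r(1) by simp
    then show "L \<ge> H + 1" by (simp add: L_def)
    then show "L \<ge> 0" using H(1) by linarith
    have "(L - (H + 1)) * (1 - r) = 2 * ?n\<^sup>2 * H + cc" using r(1) by (simp add: L_def)
    moreover have "(H + 1) * (1 - r) \<ge> 0" using r(1) H(1) by simp
    ultimately show "L * (1 - r) \<ge> 2 * ?n\<^sup>2 * H + cc" by (simp add: left_diff_distrib)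
  qed
  have main: "(\<Sum>i\<in>UNIV. \<Sum>k\<in>UNIV. x $ i * x $ k * K L 0 i k x) - rr x * (\<Sum>i\<in>UNIV. K L 0 i i x) \<ge> cc * rr x"
    "(\<Sum>i\<in>UNIV. K L 0 i i x) \<le> - 1 + ?n * L * rr x" if x: "x \<in> cball 0 1" for x
  proof -
    have rx: "0 \<le> rr x" "rr x \<le> 1" using x rr_nonneg[of x] by (auto simp: rr_norm power_le_one)
    have trK: "(\<Sum>i\<in>UNIV. K L 0 i i x) = - (\<Sum>i\<in>UNIV. G2 i i x) - ?n * (L * (1 - rr x))"
      by (simp add: K_def sum_subtractf sum_negf)
    have trG: "\<bar>\<Sum>i\<in>UNIV. G2 i i x\<bar> \<le> ?n * H"
    proof -
      have "\<bar>\<Sum>i\<in>UNIV. G2 i i x\<bar> \<le> (\<Sum>i\<in>(UNIV::'n set). H)"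
        using H(2)[OF x] by (intro order_trans[OF sum_abs] sum_mono) (auto intro: less_imp_le)
      then show ?thesis by simp
    qed
    have "?n * 1 \<le> ?n * (L - H)" using L(3) n by (intro mult_left_mono) auto
    then show "(\<Sum>i\<in>UNIV. K L 0 i i x) \<le> - 1 + ?n * L * rr x"
      unfolding trK using trG n by (simp add: algebra_simps)
    have "(\<Sum>i\<in>UNIV. \<Sum>k\<in>UNIV. x $ i * x $ k * K L 0 i k x) =
        (\<Sum>i\<in>UNIV. \<Sum>k\<in>UNIV. - (x $ i * x $ k * G2 i k x) - (if i = k then 1 else 0) * (L * (1 - rr x) * (x $ i * x $ k)))"
      by (intro sum.cong refl) (simp add: K_def algebra_simps)
    also have "\<dots> = - (\<Sum>i\<in>UNIV. \<Sum>k\<in>UNIV. x $ i * x $ k * G2 i k x) - L * (1 - rr x) * rr x"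
      unfolding sum_subtractf sum_delta_mult rr_def[of x] sum_distrib_left by (simp add: sum_negf)
    finally have eq: "(\<Sum>i\<in>UNIV. \<Sum>k\<in>UNIV. x $ i * x $ k * K L 0 i k x) - rr x * (\<Sum>i\<in>UNIV. K L 0 i i x)
        = \<beta> x + (?n - 1) * (L * (1 - rr x)) * rr x"
      unfolding trK \<beta>_def by (simp add: algebra_simps)
    have L1: "0 \<le> L * (1 - rr x)" using L(1) rx by simp
    show "(\<Sum>i\<in>UNIV. \<Sum>k\<in>UNIV. x $ i * x $ k * K L 0 i k x) - rr x * (\<Sum>i\<in>UNIV. K L 0 i i x) \<ge> cc * rr x"
    proof (cases "x \<in> T")
      case False
      then have "\<beta> x > cc" using x by (simp add: T_def)
      moreover have "cc * rr x \<le> cc" using cc(1) rx by (simp add: mult_left_le)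
      moreover have "0 \<le> (?n - 1) * (L * (1 - rr x)) * rr x" using L(1) n rx by (intro mult_nonneg_nonneg) auto
      ultimately show ?thesis unfolding eq by linarith
    next
      case True
      have "\<bar>\<Sum>i\<in>UNIV. \<Sum>k\<in>UNIV. x $ i * x $ k * G2 i k x\<bar> \<le> ?n\<^sup>2 * (rr x * H)"
      proof (rule abs_sum2_le)
        fix i k
        have "\<bar>x $ i\<bar> * \<bar>x $ k\<bar> * \<bar>G2 i k x\<bar> \<le> norm x * norm x * H"
          using H(2)[OF x, of i k] abs_component_le_norm[of x] by (intro mult_mono) auto
        then show "\<bar>x $ i * x $ k * G2 i k x\<bar> \<le> rr x * H"
          by (simp add: abs_mult rr_norm power2_eq_square)
      qed
      moreover have "\<bar>rr x * (\<Sum>i\<in>UNIV. G2 i i x)\<bar> \<le> ?n\<^sup>2 * (rr x * H)"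
      proof -
        have "?n * H \<le> ?n\<^sup>2 * H" using n H(1) by (intro mult_right_mono) (auto simp: power2_eq_square)
        then have "rr x * \<bar>\<Sum>i\<in>UNIV. G2 i i x\<bar> \<le> rr x * (?n\<^sup>2 * H)"
          using trG rx by (intro mult_left_mono) auto
        then show ?thesis using rx by (simp add: abs_mult algebra_simps)
      qed
      ultimately have b: "\<beta> x \<ge> - (2 * ?n\<^sup>2 * H) * rr x" unfolding \<beta>_def by (simp add: algebra_simps)
      have "L * (1 - r) \<le> L * (1 - rr x)" using r(2)[OF True] L(1) by (intro mult_left_mono) auto
      also have "1 * (L * (1 - rr x)) \<le> (?n - 1) * (L * (1 - rr x))" using n L1 by (intro mult_right_mono) auto
      finally have "2 * ?n\<^sup>2 * H + cc \<le> (?n - 1) * (L * (1 - rr x))" using L(2) by simp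
      then have "(2 * ?n\<^sup>2 * H + cc) * rr x \<le> (?n - 1) * (L * (1 - rr x)) * rr x"
        using rx by (intro mult_right_mono) auto
      then show ?thesis unfolding eq using b by (simp add: algebra_simps)
    qed
  qed
  show ?thesis using L(1) cc(1) main by blast
qed


section \<open>The principal part on the layer against the lower order terms\<close>

definition DD :: "real \<Rightarrow> real \<Rightarrow> real \<Rightarrow> real^'n \<Rightarrow> 'n \<Rightarrow> 'n \<Rightarrow> 'n \<Rightarrow> 'n \<Rightarrow> real" where
  "DD N L t x = (\<lambda>p q i j. pd p (pd q (kk N L t i j)) x)"

text \<open>Controls the change of the metric and of its first derivatives. Second derivatives are
  left out on purpose: they are of order \<open>N^2\<close> and are kept exactly, through
  \<open>DD\<close>.\<close>

definition size1 :: "real \<Rightarrow> real \<Rightarrow> real \<Rightarrow> real^'n \<Rightarrow> real" where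
  "size1 N L t x = (\<Sum>i\<in>UNIV. \<Sum>j\<in>UNIV. \<bar>kk N L t i j x\<bar> + (\<Sum>p\<in>UNIV. \<bar>pd p (kk N L t i j) x\<bar>))"

lemma ginv_G_0:
  "det (G 0 x) \<noteq> 0" "ginv (G 0) x $ i $ j = (if i = j then inverse ((A0 x)\<^sup>2) else 0)"
proof -
  have "A0 x \<noteq> 0" using rr_nonneg[of x] by (simp add: A0_def)
  then have "(inverse ((A0 x)\<^sup>2) *\<^sub>R mat 1) ** G 0 x = mat 1"
  proof -
    have "(\<Sum>k\<in>UNIV. inverse ((A0 x)\<^sup>2) * (if i = k then 1 else 0) * ((A0 x)\<^sup>2 * (if k = j then 1 else 0))) =
        (if i = j then 1 else 0)" for i j :: 'n
      using sum_delta_mult(1)[of i "\<lambda>k. inverse ((A0 x)\<^sup>2) * ((A0 x)\<^sup>2 * (if k = j then 1 else 0))"] \<open>A0 x \<noteq> 0\<close>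
      by (simp add: mult_ac)
    then show ?thesis by (simp add: G_0 vec_eq_iff matrix_matrix_mult_def mat_def)
  qed
  note u = matrix_inv_unique_left[OF this]
  show "det (G 0 x) \<noteq> 0" by (rule u(1))
  show "ginv (G 0) x $ i $ j = (if i = j then inverse ((A0 x)\<^sup>2) else 0)"
    unfolding ginv_def u(2) by (simp add: mat_def)
qed

lemma pd_lay: "pd u (lay N) = (\<lambda>x. 2 * N * x $ u * lay N x)"
proof
  fix x :: "real^'n"
  have dr: "rr differentiable (at x)" for x :: "real^'n"
    by (rule psmooth_diff[OF psmooth_rr])
  show "pd u (lay N) x = 2 * N * x $ u * lay N x"
    unfolding lay_def[abs_def] by (simp add: pd_exp pd_cmult pd_diff dr pd_rr)
qed

lemma pd_kk: "pd u (kk N L t i j) = (\<lambda>x. lay N x * (2 * N * x $ u * K L t i j x + pd u (K L t i j) x))"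
  using psmooth_diff[OF psmooth_lay] psmooth_diff[OF psmooth_K]
  by (simp add: kk_def[abs_def] fun_eq_iff pd_mult pd_lay algebra_simps)

lemma DD_eq: "DD N L t x u q i j = lay N x * (4 * N\<^sup>2 * (x $ u * x $ q) * K L t i j x
    + 2 * N * ((if u = q then 1 else 0) * K L t i j x)
    + 2 * N * (x $ q * pd u (K L t i j) x + x $ u * pd q (K L t i j) x) + pd u (pd q (K L t i j)) x)"
proof -
  note d = psmooth_diff[OF psmooth_lay] psmooth_diff[OF psmooth_K] psmooth_diff[OF psmooth_pd[OF psmooth_K]]
    differentiable_coord
  have dd: "(\<lambda>x. 2 * N * x $ q * K L t i j x) differentiable (at x)"
    "(\<lambda>x. 2 * N * x $ q) differentiable (at x)" 
    by (intro differentiable_mult differentiable_const d)+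
  have dd2: "(\<lambda>x. 2 * N * x $ q * K L t i j x + pd q (K L t i j) x) differentiable (at x)"
    by (intro differentiable_add dd d)
  have c: "pd u (\<lambda>x. 2 * N * x $ q) x = 2 * N * (if u = q then 1 else 0)"
    using pd_cmult[OF differentiable_coord, of u "2 * N" q x] by (simp add: pd_coord)
  have "DD N L t x u q i j = 2 * N * x $ u * lay N x * (2 * N * x $ q * K L t i j x + pd q (K L t i j) x)
     + lay N x * ((2 * N * (if u = q then 1 else 0)) * K L t i j x + 2 * N * x $ q * pd u (K L t i j) x + pd u (pd q (K L t i j)) x)"
    unfolding DD_def pd_kk
    by (simp only: pd_mult[OF d(1) dd2] pd_lay pd_add[OF dd(1) d(3)] pd_mult[OF dd(2) d(2)] c)
  then show ?thesis by (simp add: algebra_simps power2_eq_square)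
qed

text \<open>The terms are sorted by powers of \<open>N\<close>, that is, by how many derivatives
  fall on the exponential. On the boundary the bracket with \<open>N^2\<close> is minus the
  tangential trace of \<open>K\<close>.\<close>

lemma PrJ_layer:
  "PrJ (\<lambda>i j. ginv (G 0) x $ i $ j) (DD N L t x) = (inverse ((A0 x)\<^sup>2))\<^sup>2 * (lay N x * (
      4 * N\<^sup>2 * ((\<Sum>i\<in>UNIV. \<Sum>k\<in>UNIV. x $ i * x $ k * K L t i k x) - rr x * (\<Sum>i\<in>UNIV. K L t i i x))
    - 2 * N * (real CARD('n) - 1) * (\<Sum>i\<in>UNIV. K L t i i x)
    + 2 * N * (\<Sum>i\<in>UNIV. \<Sum>k\<in>UNIV. x $ i * pd k (K L t i k) x + x $ k * pd i (K L t i k) x - 2 * (x $ k * pd k (K L t i i) x))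
    + (\<Sum>i\<in>UNIV. \<Sum>k\<in>UNIV. pd k (pd i (K L t i k)) x - pd k (pd k (K L t i i)) x)))"
proof -
  have "DD N L t x k i i k - DD N L t x k k i i = lay N x * (
      4 * N\<^sup>2 * (x $ i * x $ k * K L t i k x) - 4 * N\<^sup>2 * (K L t i i x * (x $ k * x $ k))
    + 2 * N * ((if k = i then 1 else 0) * K L t i k x) - 2 * N * K L t i i x
    + 2 * N * (x $ i * pd k (K L t i k) x + x $ k * pd i (K L t i k) x - 2 * (x $ k * pd k (K L t i i) x))
    + (pd k (pd i (K L t i k)) x - pd k (pd k (K L t i i)) x))" for i k
    unfolding DD_eq by (simp add: algebra_simps)
  moreover have "(\<Sum>i\<in>UNIV. \<Sum>k\<in>UNIV. K L t i i x * (x $ k * x $ k)) = rr x * (\<Sum>i\<in>UNIV. K L t i i x)"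
    unfolding rr_def by (simp only: sum_distrib_left[symmetric] sum_distrib_right[symmetric] mult.commute)
  moreover have "(\<Sum>i\<in>(UNIV::'n set). \<Sum>k\<in>(UNIV::'n set). K L t i i x) = real CARD('n) * (\<Sum>i\<in>UNIV. K L t i i x)"
    by (simp add: sum_distrib_left)
  ultimately have "(\<Sum>i\<in>UNIV. \<Sum>k\<in>UNIV. DD N L t x k i i k - DD N L t x k k i i) = lay N x * (
      4 * N\<^sup>2 * (\<Sum>i\<in>UNIV. \<Sum>k\<in>UNIV. x $ i * x $ k * K L t i k x) - 4 * N\<^sup>2 * (rr x * (\<Sum>i\<in>UNIV. K L t i i x))
    + 2 * N * (\<Sum>i\<in>UNIV. K L t i i x) - 2 * N * (real CARD('n) * (\<Sum>i\<in>UNIV. K L t i i x))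
    + 2 * N * (\<Sum>i\<in>UNIV. \<Sum>k\<in>UNIV. x $ i * pd k (K L t i k) x + x $ k * pd i (K L t i k) x - 2 * (x $ k * pd k (K L t i i) x))
    + (\<Sum>i\<in>UNIV. \<Sum>k\<in>UNIV. pd k (pd i (K L t i k)) x - pd k (pd k (K L t i i)) x))"
    by (simp only: sum.distrib sum_subtractf sum_distrib_left[symmetric] sum_delta_mult)
  note E = this
  show ?thesis
    unfolding ginv_G_0 PrJ_conformal E by (simp add: algebra_simps)
qed

text \<open>A derivative of the exponential produces \<open>N\<close> together with a factor
  \<open>norm x\<close>. This factor is essential, since near the origin only a fixed multiple of
  \<open>N\<close> is available to dominate errors.\<close>

lemma size1_le:
  assumes H: "\<And>i j. \<bar>K L t i j x\<bar> \<le> H" "\<And>p i j. \<bar>pd p (K L t i j) x\<bar> \<le> H" and N: "N \<ge> 0"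
  shows "size1 N L t x \<le> lay N x * (real CARD('n) ^ 2 * (H + real CARD('n) * (2 * N * norm x * H + H)))"
proof -
  have l: "lay N x > 0" by (simp add: lay_def)
  have H0: "H \<ge> 0" using H(1)[of undefined undefined] by linarith
  have "\<bar>kk N L t i j x\<bar> + (\<Sum>p\<in>UNIV. \<bar>pd p (kk N L t i j) x\<bar>) \<le>
     lay N x * (H + real CARD('n) * (2 * N * norm x * H + H))" for i j
  proof -
    have "\<bar>kk N L t i j x\<bar> \<le> lay N x * H"
      unfolding kk_def abs_mult using l H(1) by (intro mult_mono) auto
    moreover have "\<bar>pd p (kk N L t i j) x\<bar> \<le> lay N x * (2 * N * norm x * H + H)" for p
    proof -
      have "\<bar>2 * N * x $ p * K L t i j x + pd p (K L t i j) x\<bar> \<le> 2 * N * norm x * H + H"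
      proof (rule order_trans[OF abs_triangle_ineq], rule add_mono)
        have "2 * N * (\<bar>x $ p\<bar> * \<bar>K L t i j x\<bar>) \<le> 2 * N * (norm x * H)"
          using N H(1) abs_component_le_norm[of x p] by (intro mult_left_mono mult_mono) auto
        then show "\<bar>2 * N * x $ p * K L t i j x\<bar> \<le> 2 * N * norm x * H"
          using N by (simp add: abs_mult)
      qed (rule H(2))
      then show ?thesis unfolding pd_kk abs_mult using l by (intro mult_mono) auto
    qed
    then have "(\<Sum>p\<in>UNIV. \<bar>pd p (kk N L t i j) x\<bar>) \<le> (\<Sum>p\<in>(UNIV::'n set). lay N x * (2 * N * norm x * H + H))"
      by (intro sum_mono)
    ultimately show ?thesis by (simp add: algebra_simps)
  qed
  then have "size1 N L t x \<le> (\<Sum>i\<in>(UNIV::'n set). \<Sum>j\<in>(UNIV::'n set). lay N x * (H + real CARD('n) * (2 * N * norm x * H + H)))"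
    unfolding size1_def by (intro sum_mono)
  then show ?thesis by (simp add: power2_eq_square algebra_simps)
qed

text \<open>\<open>M\<close> is given before \<open>N\<close>: in the lower order terms at most one
  derivative falls on the layer, so they are of order \<open>N * norm x\<close> plus a constant, and
  \<open>layer_dominates\<close> applies.\<close>

lemma layer_positive:
  assumes M: "M \<ge> 0"
  shows "\<exists>N L. \<forall>x\<in>cball 0 1. PrJ (\<lambda>i j. ginv (G 0) x $ i $ j) (DD N L 0 x) - M * size1 N L 0 x > 0"
proof -
  let ?n = "real CARD('n)"
  have n: "?n \<ge> 3" using n3 by simp
  obtain L cc where L: "L \<ge> 0" "cc > 0" and
    al: "\<And>x. x \<in> cball 0 1 \<Longrightarrow>
     (\<Sum>i\<in>UNIV. \<Sum>k\<in>UNIV. x $ i * x $ k * K L 0 i k x) - rr x * (\<Sum>i\<in>UNIV. K L 0 i i x) \<ge> cc * rr x" and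
    tr: "\<And>x. x \<in> cball 0 1 \<Longrightarrow> (\<Sum>i\<in>UNIV. K L 0 i i x) \<le> - 1 + ?n * L * rr x"
    using K_bounds by blast
  have cK: "continuous_on S (K L 0 i j)" "continuous_on S (pd p (K L 0 i j))"
    "continuous_on S (pd q (pd p (K L 0 i j)))" for S i j p q
    using psmooth_cont_x[OF psmooth_K] psmooth_cont_x[OF psmooth_pd[OF psmooth_K]]
      psmooth_cont_x[OF psmooth_pd[OF psmooth_pd[OF psmooth_K]]] by blast+
  obtain H0 where H0: "\<And>i j x. x \<in> cball 0 1 \<Longrightarrow> \<bar>K L 0 i j x\<bar> < H0"
    by (rule finite_family_bound2[where K="cball 0 1" and f="\<lambda>i j. K L 0 i j"]) (use cK in \<open>auto simp del: mem_cball\<close>)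
  obtain H1 where H1: "\<And>p i j x. x \<in> cball 0 1 \<Longrightarrow> \<bar>pd p (K L 0 i j) x\<bar> < H1"
    by (rule finite_family_bound3[where K="cball 0 1" and f="\<lambda>p i j. pd p (K L 0 i j)"]) (use cK in \<open>auto simp del: mem_cball\<close>)
  obtain H2 where H2: "\<And>q p i j x. x \<in> cball 0 1 \<Longrightarrow> \<bar>pd q (pd p (K L 0 i j)) x\<bar> < H2"
    by (rule finite_family_bound4[where K="cball 0 1" and f="\<lambda>q p i j. pd q (pd p (K L 0 i j))"]) (use cK in \<open>auto simp del: mem_cball\<close>)
  define H where "H = max H0 (max H1 H2)"
  have H: "\<And>i j x. x \<in> cball 0 1 \<Longrightarrow> \<bar>K L 0 i j x\<bar> \<le> H"
    "\<And>p i j x. x \<in> cball 0 1 \<Longrightarrow> \<bar>pd p (K L 0 i j) x\<bar> \<le> H"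
    "\<And>q p i j x. x \<in> cball 0 1 \<Longrightarrow> \<bar>pd q (pd p (K L 0 i j)) x\<bar> \<le> H"
    using H0 H1 H2 unfolding H_def by (meson less_imp_le max.coboundedI1 max.coboundedI2)+
  have "(0 :: real^'n) \<in> cball 0 1" by simp
  from H(1)[OF this, of undefined undefined] have Hp: "H \<ge> 0" by linarith
  \<comment> \<open>Collects \<open>2 * N * E1\<close> and \<open>E2\<close> (the summand with 8)
    and sixteen times the bound for \<open>M * size1\<close>; the factor 16 is the loss from
    \<open>(inverse ((A0 x)^2))^2 >= 1/16\<close>.\<close>
  define P where "P = 8 * ?n\<^sup>2 * H + 16 * (M * ?n\<^sup>2 * (H + ?n * H)) + 32 * (M * ?n ^ 3 * H)"
  have P: "P \<ge> 0" unfolding P_def using M Hp by (intro add_nonneg_nonneg mult_nonneg_nonneg) auto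
  obtain N where N: "N > 0" "\<And>\<rho>. 4 * N\<^sup>2 * cc * \<rho>\<^sup>2 + 2 * N * (?n - 1) * (1 - (?n * L) * \<rho>\<^sup>2) - N * P * \<rho> - P > 0"
    using layer_dominates[of cc "?n * L" P "?n - 1"] L P n by auto
  have "PrJ (\<lambda>i j. ginv (G 0) x $ i $ j) (DD N L 0 x) - M * size1 N L 0 x > 0" if x: "x \<in> cball 0 1" for x
  proof -
    let ?\<rho> = "norm x"
    have \<rho>: "0 \<le> ?\<rho>" "?\<rho> \<le> 1" using x by auto
    have l: "lay N x > 0" by (simp add: lay_def)
    define E1 where "E1 = (\<Sum>i\<in>UNIV. \<Sum>k\<in>UNIV. x $ i * pd k (K L 0 i k) x + x $ k * pd i (K L 0 i k) x - 2 * (x $ k * pd k (K L 0 i i) x))"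
    define E2 where "E2 = (\<Sum>i\<in>UNIV. \<Sum>k\<in>UNIV. pd k (pd i (K L 0 i k)) x - pd k (pd k (K L 0 i i)) x)"
    define al where "al = (\<Sum>i\<in>UNIV. \<Sum>k\<in>UNIV. x $ i * x $ k * K L 0 i k x) - rr x * (\<Sum>i\<in>UNIV. K L 0 i i x)"
    define tr where "tr = (\<Sum>i\<in>UNIV. K L 0 i i x)"
    define Z where "Z = 4 * N\<^sup>2 * al - 2 * N * (?n - 1) * tr + 2 * N * E1 + E2"
    have pr: "PrJ (\<lambda>i j. ginv (G 0) x $ i $ j) (DD N L 0 x) = (inverse ((A0 x)\<^sup>2))\<^sup>2 * (lay N x * Z)"
      unfolding PrJ_layer Z_def al_def tr_def E1_def E2_def ..
    have xp: "\<bar>x $ i * pd p (K L 0 j k) x\<bar> \<le> ?\<rho> * H" for i p j k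
      unfolding abs_mult using H(2)[OF x] abs_component_le_norm[of x i] by (intro mult_mono) auto
    have E1: "\<bar>E1\<bar> \<le> ?n\<^sup>2 * (4 * (?\<rho> * H))"
      unfolding E1_def
    proof (rule abs_sum2_le)
      fix i k
      show "\<bar>x $ i * pd k (K L 0 i k) x + x $ k * pd i (K L 0 i k) x - 2 * (x $ k * pd k (K L 0 i i) x)\<bar> \<le> 4 * (?\<rho> * H)"
        using xp[of i k i k] xp[of k i i k] xp[of k k i i] by linarith
    qed
    have E2: "\<bar>E2\<bar> \<le> ?n\<^sup>2 * (2 * H)"
      unfolding E2_def
    proof (rule abs_sum2_le)
      fix i k
      show "\<bar>pd k (pd i (K L 0 i k)) x - pd k (pd k (K L 0 i i)) x\<bar> \<le> 2 * H"
        using H(3)[OF x, of k i i k] H(3)[OF x, of k k i i] by linarith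
    qed
    have "cc * ?\<rho>\<^sup>2 \<le> al"
      using al[OF x] unfolding al_def rr_norm .
    then have "4 * N\<^sup>2 * (cc * ?\<rho>\<^sup>2) \<le> 4 * N\<^sup>2 * al"
      by (rule mult_left_mono) simp
    moreover have "2 * N * (?n - 1) * tr \<le> 2 * N * (?n - 1) * (- 1 + ?n * L * ?\<rho>\<^sup>2)"
    proof (rule mult_left_mono)
      show "tr \<le> - 1 + ?n * L * ?\<rho>\<^sup>2" using tr[OF x] unfolding tr_def rr_norm .
    qed (use n N(1) in simp)
    moreover have "2 * N * \<bar>E1\<bar> \<le> 2 * N * (?n\<^sup>2 * (4 * (?\<rho> * H)))"
      by (rule mult_left_mono[OF E1]) (use N(1) in linarith)
    moreover have "2 * N * E1 \<ge> - (2 * N * \<bar>E1\<bar>)"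
    proof -
      have "2 * N * (- \<bar>E1\<bar>) \<le> 2 * N * E1" by (rule mult_left_mono) (linarith, use N(1) in linarith)
      then show ?thesis by simp
    qed
    moreover have "E2 \<ge> - (?n\<^sup>2 * (2 * H))" using E2 by linarith
    ultimately have Zge: "Z \<ge> 4 * N\<^sup>2 * cc * ?\<rho>\<^sup>2 + 2 * N * (?n - 1) * (1 - (?n * L) * ?\<rho>\<^sup>2)
        - 8 * (N * ?n\<^sup>2 * H * ?\<rho>) - 2 * (?n\<^sup>2 * H)"
      unfolding Z_def by (simp add: algebra_simps)
    define Q where "Q = M * (?n\<^sup>2 * (H + ?n * (2 * N * ?\<rho> * H + H)))"
    have Q: "Q \<ge> 0" unfolding Q_def using M Hp N(1) \<rho>
      by (intro mult_nonneg_nonneg add_nonneg_nonneg) auto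
    have nn: "0 \<le> ?n\<^sup>2 * H" "0 \<le> M * ?n\<^sup>2 * (H + ?n * H)" "0 \<le> M * ?n ^ 3 * H"
      using M Hp by (auto intro!: mult_nonneg_nonneg add_nonneg_nonneg)
    have "N * P * ?\<rho> + P \<ge> 8 * (N * ?n\<^sup>2 * H * ?\<rho>) + 2 * (?n\<^sup>2 * H) + 16 * Q"
    proof -
      have "N * P * ?\<rho> = 8 * (N * ?n\<^sup>2 * H * ?\<rho>) + 32 * (N * ?\<rho> * (M * ?n ^ 3 * H)) + 16 * (N * ?\<rho> * (M * ?n\<^sup>2 * (H + ?n * H)))"
        unfolding P_def by (simp add: algebra_simps)
      moreover have "0 \<le> N * ?\<rho> * (M * ?n\<^sup>2 * (H + ?n * H))"
        by (rule mult_nonneg_nonneg[OF mult_nonneg_nonneg nn(2)]) (use N(1) in auto)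
      moreover have "16 * Q = 16 * (M * ?n\<^sup>2 * (H + ?n * H)) + 32 * (N * ?\<rho> * (M * ?n ^ 3 * H))"
        unfolding Q_def by (simp add: algebra_simps power2_eq_square power3_eq_cube)
      ultimately show ?thesis using nn unfolding P_def by linarith
    qed
    with Zge N(2)[of ?\<rho>] have ZQ: "Z > 16 * Q" by linarith
    have "A0 x > 0" "A0 x \<le> 2" using rr_nonneg[of x] by (auto simp: A0_def field_simps)
    then have "(A0 x)\<^sup>2 \<le> 2\<^sup>2" "(A0 x)\<^sup>2 > 0"
      using power_mono[of "A0 x" 2 2] by auto
    then have "inverse ((A0 x)\<^sup>2) \<ge> inverse 4" by (intro le_imp_inverse_le) auto
    then have "(inverse ((A0 x)\<^sup>2))\<^sup>2 \<ge> (inverse 4)\<^sup>2" by (rule power_mono) simp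
    then have "(inverse ((A0 x)\<^sup>2))\<^sup>2 * (lay N x * Z) \<ge> (inverse 4)\<^sup>2 * (lay N x * Z)"
      using l ZQ Q by (intro mult_right_mono) auto
    moreover have "(inverse 4)\<^sup>2 * (lay N x * Z) > lay N x * Q"
      using l ZQ by (simp add: power2_eq_square)
    moreover have "M * size1 N L 0 x \<le> M * (lay N x * (?n\<^sup>2 * (H + ?n * (2 * N * ?\<rho> * H + H))))"
      using size1_le[of L 0 x H N] H x N(1) M by (intro mult_left_mono) auto
    moreover have "\<dots> = lay N x * Q" unfolding Q_def by simp
    ultimately show ?thesis unfolding pr by linarith
  qed
  then show ?thesis by blast
qed

subsubsection \<open>Scalar curvature\<close>

text \<open>The jets of \<open>gm N L t\<close> and \<open>G t\<close> are compared. The second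
  derivatives of the correction enter linearly through \<open>PrJ\<close> and give the gain; the
  changes of the inverse metric and of the first derivatives are treated by the Lipschitz
  bound.\<close>

lemma scalar_curv_gm:
  "\<exists>N L. \<forall>\<^sub>F t in at_right 0. \<forall>x\<in>cball 0 1.
     scalar_curv (gm N L t) x > real CARD('n) * (real CARD('n) - 1)"
proof -
  let ?W = "\<lambda>t x i j. ginv (G t) x $ i $ j"
  let ?B = "\<lambda>t x p i j. pd p (\<lambda>y. G t y $ i $ j) x"
  let ?C = "\<lambda>t x p q i j. pd p (pd q (\<lambda>y. G t y $ i $ j)) x"
  have contW: "isCont (\<lambda>z. ginv (g (fst z)) (snd z) $ i $ j) (0, x)"
    if "\<And>i j. psmooth (\<lambda>t x. g t x $ i $ j)" "g 0 = G 0" for g i j and x :: "real^'n"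
    unfolding ginv_def using that(2) ginv_G_0(1)[of x]
    by (intro isCont_matrix_inv psmooth_isCont[OF that(1)]) auto
  have cx: "continuous_on S (\<lambda>x. ?W 0 x i j)" "continuous_on S (\<lambda>x. ?B 0 x p i j)" "continuous_on S (\<lambda>x. ?C 0 x p q i j)"
    for S i j p q
  proof -
    have nz: "1 + rr x \<noteq> 0" for x :: "real^'n" using rr_nonneg[of x] by linarith
    show "continuous_on S (\<lambda>x. ?W 0 x i j)"
      unfolding ginv_G_0(2) using psmooth_cont_x[OF psmooth_rr] nz
      by (cases "i = j") (auto simp: A0_def intro!: continuous_intros)
    show "continuous_on S (\<lambda>x. ?B 0 x p i j)" "continuous_on S (\<lambda>x. ?C 0 x p q i j)"
      using psmooth_cont_x[OF psmooth_pd[OF psmooth_G]] psmooth_cont_x[OF psmooth_pd[OF psmooth_pd[OF psmooth_G]]] by blast+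
  qed
  obtain a0 where a0: "\<And>i j x. x \<in> cball 0 1 \<Longrightarrow> \<bar>?W 0 x i j\<bar> < a0"
    by (rule finite_family_bound2[where K="cball 0 1" and f="\<lambda>i j x. ?W 0 x i j"]) (use cx(1) in \<open>auto simp del: mem_cball\<close>)
  obtain a1 where a1: "\<And>p i j x. x \<in> cball 0 1 \<Longrightarrow> \<bar>?B 0 x p i j\<bar> < a1"
    by (rule finite_family_bound3[where K="cball 0 1" and f="\<lambda>p i j x. ?B 0 x p i j"]) (use cx(2) in \<open>auto simp del: mem_cball\<close>)
  obtain a2 where a2: "\<And>p q i j x. x \<in> cball 0 1 \<Longrightarrow> \<bar>?C 0 x p q i j\<bar> < a2"
    by (rule finite_family_bound4[where K="cball 0 1" and f="\<lambda>p q i j x. ?C 0 x p q i j"]) (use cx(3) in \<open>auto simp del: mem_cball\<close>)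
  \<comment> \<open>\<open>A\<close> and hence \<open>M\<close> involve only the jet of
    \<open>G 0\<close>, so they are available before \<open>N\<close> and \<open>L\<close>. The
    strict bounds then extend to \<open>G t\<close> and \<open>gm N L t\<close> for small
    \<open>t\<close>, because both families start at \<open>G 0\<close>.\<close>
  define A where "A = max a0 (max a1 a2)"
  have A: "\<And>i j x. x \<in> cball 0 1 \<Longrightarrow> \<bar>?W 0 x i j\<bar> < A" "\<And>p i j x. x \<in> cball 0 1 \<Longrightarrow> \<bar>?B 0 x p i j\<bar> < A"
    "\<And>p q i j x. x \<in> cball 0 1 \<Longrightarrow> \<bar>?C 0 x p q i j\<bar> < A"
    using a0 a1 a2 unfolding A_def by (simp_all add: less_max_iff_disj)
  obtain M where M: "M \<ge> 0" "\<And>W B C W' B' C' d. jnear A d W B C W' B' (C' :: 'n \<Rightarrow> 'n \<Rightarrow> 'n \<Rightarrow> 'n \<Rightarrow> real) \<Longrightarrow>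
     \<bar>(PrJ W C + QJ W B) - (PrJ W' C' + QJ W' B')\<bar> \<le> M * d"
    using lipJ_scalar unfolding lipJ_def by meson
  have "0 \<le> M * (A\<^sup>2 + 1)" using M(1) by simp
  then obtain N L where NL: "\<And>x. x \<in> cball 0 1 \<Longrightarrow>
      PrJ (\<lambda>i j. ginv (G 0) x $ i $ j) (DD N L 0 x) - (M * (A\<^sup>2 + 1)) * size1 N L 0 x > 0"
    using layer_positive by blast
  let ?g = "gm N L"
  let ?W' = "\<lambda>t x i j. ginv (?g t) x $ i $ j"
  let ?B' = "\<lambda>t x p i j. pd p (\<lambda>y. ?g t y $ i $ j) x"
  have det: "\<forall>\<^sub>F t in at_right 0. \<forall>x\<in>cball 0 1. det (g t x) \<noteq> 0"
    if "\<And>i j. psmooth (\<lambda>t x. g t x $ i $ j)" "g 0 = G 0" for g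
    using pos_def_family[OF that]
  proof eventually_elim
    case (elim t)
    show ?case
    proof
      fix x :: "real^'n" assume "x \<in> cball 0 1"
      then have "x \<in> cball 0 2" by simp
      then show "det (g t x) \<noteq> 0" using elim by (intro pos_def_det_nz) blast
    qed
  qed
  have ev: "\<forall>\<^sub>F t in at_right 0. \<forall>i j. \<forall>x\<in>cball 0 1. \<bar>?W t x i j\<bar> < A"
    "\<forall>\<^sub>F t in at_right 0. \<forall>i j. \<forall>x\<in>cball 0 1. \<bar>?W' t x i j\<bar> < A"
    "\<forall>\<^sub>F t in at_right 0. \<forall>p i j. \<forall>x\<in>cball 0 1. \<bar>?B t x p i j\<bar> < A"
    "\<forall>\<^sub>F t in at_right 0. \<forall>p i j. \<forall>x\<in>cball 0 1. \<bar>?B' t x p i j\<bar> < A"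
    "\<forall>\<^sub>F t in at_right 0. \<forall>p q i j. \<forall>x\<in>cball 0 1. \<bar>?C t x p q i j\<bar> < A"
  proof -
    have "\<forall>\<^sub>F t in at_right 0. \<forall>x\<in>cball 0 1. \<bar>?W t x i j\<bar> < A" for i j
      using eventually_bounded_on_compact[of "cball 0 1" "\<lambda>z. ?W (fst z) (snd z) i j" A] contW[OF psmooth_G] A(1)
      by simp
    then show "\<forall>\<^sub>F t in at_right 0. \<forall>i j. \<forall>x\<in>cball 0 1. \<bar>?W t x i j\<bar> < A"
      by (intro eventually_all_finite)
    have "\<forall>\<^sub>F t in at_right 0. \<forall>x\<in>cball 0 1. \<bar>?W' t x i j\<bar> < A" for i j
      using eventually_bounded_on_compact[of "cball 0 1" "\<lambda>z. ?W' (fst z) (snd z) i j" A] contW[OF psmooth_gm gm_0] A(1)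
      by (simp add: gm_0)
    then show "\<forall>\<^sub>F t in at_right 0. \<forall>i j. \<forall>x\<in>cball 0 1. \<bar>?W' t x i j\<bar> < A"
      by (intro eventually_all_finite)
    have "\<forall>\<^sub>F t in at_right 0. \<forall>x\<in>cball 0 1. \<bar>?B t x p i j\<bar> < A" for p i j
      using eventually_bounded_on_compact[of "cball 0 1" "\<lambda>z. ?B (fst z) (snd z) p i j" A]
        psmooth_isCont[OF psmooth_pd[OF psmooth_G]] A(2) by simp
    then show "\<forall>\<^sub>F t in at_right 0. \<forall>p i j. \<forall>x\<in>cball 0 1. \<bar>?B t x p i j\<bar> < A"
      by (intro eventually_all_finite)
    have "\<forall>\<^sub>F t in at_right 0. \<forall>x\<in>cball 0 1. \<bar>?B' t x p i j\<bar> < A" for p i j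
      using eventually_bounded_on_compact[of "cball 0 1" "\<lambda>z. ?B' (fst z) (snd z) p i j" A]
        psmooth_isCont[OF psmooth_pd[OF psmooth_gm]] A(2) by (simp add: gm_0)
    then show "\<forall>\<^sub>F t in at_right 0. \<forall>p i j. \<forall>x\<in>cball 0 1. \<bar>?B' t x p i j\<bar> < A"
      by (intro eventually_all_finite)
    have "\<forall>\<^sub>F t in at_right 0. \<forall>x\<in>cball 0 1. \<bar>?C t x p q i j\<bar> < A" for p q i j
      using eventually_bounded_on_compact[of "cball 0 1" "\<lambda>z. ?C (fst z) (snd z) p q i j" A]
        psmooth_isCont[OF psmooth_pd[OF psmooth_pd[OF psmooth_G]]] A(3) by simp
    then show "\<forall>\<^sub>F t in at_right 0. \<forall>p q i j. \<forall>x\<in>cball 0 1. \<bar>?C t x p q i j\<bar> < A"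
      by (intro eventually_all_finite)
  qed
  have evP: "\<forall>\<^sub>F t in at_right 0. \<forall>x\<in>cball 0 1. PrJ (?W' t x) (DD N L t x) - (M * (A\<^sup>2 + 1)) * size1 N L t x > 0"
  proof -
    define f where "f z = PrJ (?W' (fst z) (snd z)) (DD N L (fst z) (snd z)) - (M * (A\<^sup>2 + 1)) * size1 N L (fst z) (snd z)" for z
    have "\<forall>\<^sub>F t in at_right 0. \<forall>x\<in>cball 0 1. f (t, x) > 0"
    proof (rule eventually_pos_on_compact)
      fix x :: "real^'n" assume x: "x \<in> cball 0 1"
      show "f (0, x) > 0" unfolding f_def fst_conv snd_conv gm_0 using NL[OF x] by simp
      have D: "isCont (\<lambda>z. DD N L (fst z) (snd z) p q i j) (0, x)" for p q i j
        unfolding DD_def by (rule psmooth_isCont[OF psmooth_pd[OF psmooth_pd[OF psmooth_kk]]])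
      have s: "isCont (\<lambda>z. kk N L (fst z) i j (snd z)) (0, x)" "isCont (\<lambda>z. pd p (kk N L (fst z) i j) (snd z)) (0, x)" for p i j
        by (rule psmooth_isCont[OF psmooth_kk], rule psmooth_isCont[OF psmooth_pd[OF psmooth_kk]])
      show "isCont f (0, x)"
        unfolding f_def[abs_def] size1_def
        by (intro continuous_intros isCont_PrJ contW psmooth_gm gm_0 D s)
    qed simp
    then show ?thesis by (simp add: f_def)
  qed
  have "\<forall>\<^sub>F t :: real in at_right 0. t > 0" by (rule eventually_at_right_less)
  with det[OF psmooth_G refl] det[of "gm N L", OF psmooth_gm gm_0] ev evP
  have "\<forall>\<^sub>F t in at_right 0. \<forall>x\<in>cball 0 1.
     scalar_curv (gm N L t) x > real CARD('n) * (real CARD('n) - 1)"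
  proof eventually_elim
    case (elim t)
    show ?case
    proof
      fix x :: "real^'n" assume x: "x \<in> cball 0 1"
      have nz: "det (G t x) \<noteq> 0" "det (?g t x) \<noteq> 0" using elim x by blast+
      let ?k = "kk N L t"
      note dG = psmooth_diff[OF psmooth_G] psmooth_diff[OF psmooth_pd[OF psmooth_G]]
        and dk = psmooth_diff[OF psmooth_kk] psmooth_diff[OF psmooth_pd[OF psmooth_kk]]
      have B': "pd p (\<lambda>y. ?g t y $ i $ j) = (\<lambda>x. ?B t x p i j + t\<^sup>2 * pd p (?k i j) x)" for p i j
        unfolding gm_def by (simp add: pd_add pd_cmult dG dk fun_eq_iff)
      have C': "pd p (pd q (\<lambda>y. ?g t y $ i $ j)) x = ?C t x p q i j + t\<^sup>2 * DD N L t x p q i j" for p q i j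
        unfolding B' DD_def by (simp add: pd_add pd_cmult dG dk)
      have R: "scalar_curv (?g t) x = PrJ (?W' t x) (?C t x) + t\<^sup>2 * PrJ (?W' t x) (DD N L t x) + QJ (?W' t x) (?B' t x)"
        using scalar_curv_jet[of "?g t" x] psmooth_freeze[OF psmooth_gm] nz(2)
        unfolding C' PrJ_add by simp
      have R0: "PrJ (?W t x) (?C t x) + QJ (?W t x) (?B t x) = real CARD('n) * (real CARD('n) - 1)"
        using scalar_curv_jet[of "G t" x] psmooth_freeze[OF psmooth_G] nz(1) scalar_curv_G[OF nz(1)] by simp
      let ?s = "size1 N L t x"
      have sk: "(\<Sum>a\<in>UNIV. \<Sum>b\<in>UNIV. \<bar>?k a b x\<bar>) \<le> ?s"
        unfolding size1_def by (intro sum_mono) (simp add: sum_nonneg)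
      have sp: "\<bar>pd p (?k i j) x\<bar> \<le> ?s" for p i j
      proof -
        have "\<bar>pd p (?k i j) x\<bar> \<le> (\<Sum>p\<in>UNIV. \<bar>pd p (?k i j) x\<bar>)" by (rule member_le_sum) auto
        also have "\<dots> \<le> \<bar>?k i j x\<bar> + (\<Sum>p\<in>UNIV. \<bar>pd p (?k i j) x\<bar>)" by simp
        also have "\<dots> \<le> (\<Sum>j\<in>UNIV. \<bar>?k i j x\<bar> + (\<Sum>p\<in>UNIV. \<bar>pd p (?k i j) x\<bar>))"
          by (rule member_le_sum) (auto intro!: add_nonneg_nonneg sum_nonneg)
        also have "\<dots> \<le> ?s"
          unfolding size1_def
          by (rule member_le_sum[where f="\<lambda>i. \<Sum>j\<in>UNIV. \<bar>?k i j x\<bar> + (\<Sum>p\<in>UNIV. \<bar>pd p (?k i j) x\<bar>)"])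
            (auto intro!: add_nonneg_nonneg sum_nonneg)
        finally show ?thesis .
      qed
      have s0: "?s \<ge> 0" using sp[of undefined undefined undefined] by linarith
      \<comment> \<open>In the factor \<open>A^2 + 1\<close>, \<open>A^2\<close> accounts for the
        change of the inverse metric (two bounded inverses around the perturbation) and
        \<open>1\<close> for the change of the first derivatives.\<close>
      define d where "d = t\<^sup>2 * ((A\<^sup>2 + 1) * ?s)"
      have d1: "t\<^sup>2 * ?s \<le> d" "t\<^sup>2 * (A\<^sup>2 * ?s) \<le> d"
        unfolding d_def using s0 by (auto intro!: mult_left_mono simp: distrib_right)
      have dW: "\<bar>?W t x i j - ?W' t x i j\<bar> \<le> d" for i j
      proof -
        have "?W t x i j - ?W' t x i j = (\<Sum>a\<in>UNIV. \<Sum>b\<in>UNIV. ?W' t x i a * (t\<^sup>2 * ?k a b x) * ?W t x b j)"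
          unfolding ginv_def matrix_inv_difference[OF nz] by (simp add: gm_def)
        also have "\<bar>\<dots>\<bar> \<le> (\<Sum>a\<in>UNIV. \<Sum>b\<in>UNIV. t\<^sup>2 * A\<^sup>2 * \<bar>?k a b x\<bar>)"
        proof (intro order_trans[OF sum_abs] sum_mono)
          fix a b
          have "\<bar>?W' t x i a\<bar> * \<bar>?W t x b j\<bar> \<le> A * A"
          proof (rule mult_mono)
            show "\<bar>?W' t x i a\<bar> \<le> A" "\<bar>?W t x b j\<bar> \<le> A" using elim x by (auto intro: less_imp_le)
            show "0 \<le> A" using A(1)[OF x, of i j] by linarith
          qed auto
          then have "(t\<^sup>2 * \<bar>?k a b x\<bar>) * (\<bar>?W' t x i a\<bar> * \<bar>?W t x b j\<bar>) \<le> (t\<^sup>2 * \<bar>?k a b x\<bar>) * (A * A)"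
            by (intro mult_left_mono) auto
          then show "\<bar>?W' t x i a * (t\<^sup>2 * ?k a b x) * ?W t x b j\<bar> \<le> t\<^sup>2 * A\<^sup>2 * \<bar>?k a b x\<bar>"
            by (simp add: abs_mult power2_eq_square[of A] mult_ac)
        qed
        also have "\<dots> = t\<^sup>2 * (A\<^sup>2 * (\<Sum>a\<in>UNIV. \<Sum>b\<in>UNIV. \<bar>?k a b x\<bar>))"
          by (simp add: sum_distrib_left mult.assoc)
        also have "\<dots> \<le> t\<^sup>2 * (A\<^sup>2 * ?s)" using sk by (intro mult_left_mono) auto
        finally show ?thesis using d1 by linarith
      qed
      have dB: "\<bar>?B t x p i j - ?B' t x p i j\<bar> \<le> d" for p i j
      proof -
        have "\<bar>?B t x p i j - ?B' t x p i j\<bar> = t\<^sup>2 * \<bar>pd p (?k i j) x\<bar>"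
          unfolding B' by (simp add: abs_mult)
        also have "\<dots> \<le> t\<^sup>2 * ?s" using sp by (intro mult_left_mono) auto
        finally show ?thesis using d1 by linarith
      qed
      \<comment> \<open>Both jets are given the second derivatives of \<open>G t\<close>; those of
        the correction have been split off in \<open>R\<close>.\<close>
      have "jnear A d (?W t x) (?B t x) (?C t x) (?W' t x) (?B' t x) (?C t x)"
        unfolding jnear_def using dW dB elim x s0
        by (auto intro: less_imp_le simp: d_def)
      from M(2)[OF this] have "\<bar>real CARD('n) * (real CARD('n) - 1) - (PrJ (?W' t x) (?C t x) + QJ (?W' t x) (?B' t x))\<bar> \<le> M * d"
        unfolding R0 .
      moreover have "t\<^sup>2 * (PrJ (?W' t x) (DD N L t x) - (M * (A\<^sup>2 + 1)) * ?s) > 0"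
        using elim x by (intro mult_pos_pos) auto
      then have "t\<^sup>2 * PrJ (?W' t x) (DD N L t x) > M * d"
        unfolding d_def by (simp add: algebra_simps)
      ultimately show "scalar_curv (?g t) x > real CARD('n) * (real CARD('n) - 1)"
        unfolding R by linarith
    qed
  qed
  then show ?thesis by blast
qed

lemma good_metric_exists:
  "\<exists>(g :: real^'n \<Rightarrow> real^'n^'n) U. open U \<and> cball 0 1 \<subseteq> U \<and> riemannian_metric_on U g \<and>
     (\<forall>x\<in>cball 0 1. scalar_curv g x > real CARD('n) * (real CARD('n) - 1)) \<and>
     (\<forall>x. norm x = 1 \<longrightarrow> g x = round_metric x) \<and> (\<forall>x. norm x = 1 \<longrightarrow> mean_curv g x > 0)"
proof -
  obtain N L where sc: "\<forall>\<^sub>F t in at_right 0. \<forall>x\<in>cball 0 1.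
     scalar_curv (gm N L t) x > real CARD('n) * (real CARD('n) - 1)"
    using scalar_curv_gm by blast
  from sc mean_curv_gm[of N L] pos_def_family[of "gm N L", OF psmooth_gm gm_0]
  have "\<forall>\<^sub>F t in at_right 0. (\<forall>x\<in>cball 0 1. scalar_curv (gm N L t) x > real CARD('n) * (real CARD('n) - 1)) \<and>
     (\<forall>x\<in>sphere 0 1. mean_curv (gm N L t) x > 0) \<and> (\<forall>x\<in>cball 0 2. \<forall>v. v \<noteq> 0 \<longrightarrow> v \<bullet> (gm N L t x *v v) > 0)"
    by eventually_elim blast
  then obtain t where t: "\<forall>x\<in>cball 0 1. scalar_curv (gm N L t) x > real CARD('n) * (real CARD('n) - 1)"
    "\<forall>x\<in>sphere 0 1. mean_curv (gm N L t) x > 0" "\<forall>x\<in>cball 0 2. \<forall>v. v \<noteq> 0 \<longrightarrow> v \<bullet> (gm N L t x *v v) > 0"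
    using eventually_happens'[of "at_right (0::real)"] trivial_limit_at_right_real by blast
  have "transpose (gm N L t x) = gm N L t x" for x
    using gm_sym[of N L t x] by (simp add: transpose_def vec_eq_iff)
  then have "riemannian_metric_on (ball 0 2) (gm N L t)"
    unfolding riemannian_metric_on_def using t(3) psmooth_imp_smooth_fun_on[OF psmooth_gm open_ball] by auto
  moreover have "gm N L t x = round_metric x" if "norm x = 1" for x
    by (simp add: gm_sphere[OF that] round_metric_def that)
  ultimately show ?thesis
    using t by (intro exI[of _ "gm N L t"] exI[of _ "ball 0 2"]) auto
qed

end

theorem theorem1p4:
  assumes "CARD('n::finite) \<ge> 3"
  shows "\<exists>(g :: real^'n \<Rightarrow> real^'n^'n) U. open U \<and> cball 0 1 \<subseteq> U \<and>
           riemannian_metric_on U g \<and>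
           (\<forall>x\<in>cball 0 1. scalar_curv g x > real CARD('n) * (real CARD('n) - 1)) \<and>
           (\<forall>x. norm x = 1 \<longrightarrow> g x = round_metric x) \<and>
           (\<forall>x. norm x = 1 \<longrightarrow> mean_curv g x > 0)"
proof -
  obtain p c :: "real poly" where
    "\<And>z. - ((1 - z\<^sup>2) * poly (pderiv (pderiv p)) z - (real CARD('n) - 1) * z * poly (pderiv p) z
         + (real CARD('n) - 1) * poly p z) > 0"
    "\<And>z. (1 - z\<^sup>2) * (poly (pderiv p) z)\<^sup>2 - (real CARD('n) - 1) * (poly p z)\<^sup>2
       + 2 * ((1 - z\<^sup>2) * poly (pderiv c) z - (real CARD('n) - 1) * z * poly c z) > 0"
    using normal_speed_exists[of "real CARD('n) - 1"] assms by auto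
  \<comment> \<open>Any coordinate can serve as the axis of symmetry, so an arbitrary index is
    taken.\<close>
  then interpret good_deformation "undefined :: 'n" p c
    using assms by unfold_locales (simp_all add: deformation.wmean_def deformation.energy_def)
  show ?thesis by (rule good_metric_exists)
qed

end
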